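(* For every $m\ge 1$, a random $2$-generator $m$-relator group (in the few relators model) admits a Cayley representation. That is, for fixed $m\ge 1$, if for each $l\ge 1$ one chooses $m$ cyclically reduced words $r_1,\dots,r_m$ of length at most $l$ in the free group on $x,y$, uniformly at random and independently, then the probability that the group presented by $\langle x,y\mid r_1,\dots,r_m\rangle$ admits a Cayley representation tends to $1$ as $l\to\infty$.
   Context: Few relators model (Arzhantseva and Ol'shanskii): the number $n$ of generators and the number $m$ of relators are fixed. For each $l\ge 1$, $m$ cyclically reduced words of length at most $l$ in the generators are chosen at random, independently and uniformly among all cyclically reduced words of length at most $l$, to form the set of relators. A random $n$-generator $m$-relator group satisfies a property if the presented group satisfies it with probability tending to $1$ as $l\to\infty$. For a group $G$ and a non-empty subset $S\subseteq G$, the Cayley poset $P(G,S)$ has as underlying set the disjoint union of two copies $G$ and $G'=\{g' : g\in G\}$ of $G$; for $g,h\in G$ one sets $g<h'$ if and only if $h\in gS$, and no other pair of different points is comparable. Left multiplication on each copy of $G$ gives an action $L:G\to \mathrm{Aut}(P(G,S))$, where $\mathrm{Aut}$ denotes the group of poset automorphisms. If every automorphism of $P(G,S)$ is in the image of $L$, then $P(G,S)$ is called a Cayley representation of $G$. The group $G$ admits a Cayley representation if there is a non-empty $S\subseteq G$ such that $P(G,S)$ is a Cayley representation of $G$. *)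

theory Defs
  imports "HOL-Algebra.Algebra" "HOL-Probability.Probability"
begin

text \<open>The letter \<open>(x, True)\<close> stands for the generator \<open>x\<close> and \<open>(x, False)\<close> for its inverse.\<close>

type_synonym 'a letter = "'a \<times> bool"

definition inv_letter :: "'a letter \<Rightarrow> 'a letter" where
  "inv_letter a = (fst a, \<not> snd a)"

definition reduced_word :: "'a letter list \<Rightarrow> bool" where
  "reduced_word w \<longleftrightarrow> successively (\<lambda>a b. b \<noteq> inv_letter a) w"

definition cyclically_reduced :: "'a letter list \<Rightarrow> bool" where
  "cyclically_reduced w \<longleftrightarrow> reduced_word w \<and> (w \<noteq> [] \<longrightarrow> hd w \<noteq> inv_letter (last w))"

definition cons_reduce :: "'a letter \<Rightarrow> 'a letter list \<Rightarrow> 'a letter list" where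
  "cons_reduce a w = (if w \<noteq> [] \<and> hd w = inv_letter a then tl w else a # w)"

text \<open>On reduced words, \<open>foldr cons_reduce u v\<close> is the reduced form of \<open>u @ v\<close>.\<close>

definition free_group :: "'a set \<Rightarrow> 'a letter list monoid" where
  "free_group A =
     \<lparr>carrier = {w. set w \<subseteq> A \<times> UNIV \<and> reduced_word w},
      monoid.mult = foldr cons_reduce, one = []\<rparr>"

definition normal_closure :: "('a, 'b) monoid_scheme \<Rightarrow> 'a set \<Rightarrow> 'a set" where
  "normal_closure G R = \<Inter>{N. N \<lhd> G \<and> R \<subseteq> N}"

definition presented_group :: "'a set \<Rightarrow> 'a letter list set \<Rightarrow> 'a letter list set monoid" where
  "presented_group A R = free_group A Mod normal_closure (free_group A) R"

lemma inv_letter_inv_letter [simp]: "inv_letter (inv_letter a) = a"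
  by (simp add: inv_letter_def)

lemma inv_letter_neq [simp]: "inv_letter a \<noteq> a" "a \<noteq> inv_letter a"
  by (auto simp: inv_letter_def prod_eq_iff)

lemma reduced_Nil [simp]: "reduced_word []"
  by (simp add: reduced_word_def)

lemma reduced_Cons:
  "reduced_word (a # w) \<longleftrightarrow> reduced_word w \<and> (w = [] \<or> hd w \<noteq> inv_letter a)"
  by (cases w) (auto simp: reduced_word_def)

lemma reduced_cons_reduce: "reduced_word w \<Longrightarrow> reduced_word (cons_reduce a w)"
  by (cases w) (auto simp: cons_reduce_def reduced_Cons)

lemma reduced_foldr: "reduced_word w \<Longrightarrow> reduced_word (foldr cons_reduce u w)"
  by (induction u) (auto intro: reduced_cons_reduce)

lemma set_cons_reduce:
  "a \<in> A \<times> UNIV \<Longrightarrow> set w \<subseteq> A \<times> UNIV \<Longrightarrow> set (cons_reduce a w) \<subseteq> A \<times> UNIV"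
  by (cases w) (auto simp: cons_reduce_def)

lemma set_foldr:
  "set u \<subseteq> A \<times> UNIV \<Longrightarrow> set w \<subseteq> A \<times> UNIV \<Longrightarrow>
     set (foldr cons_reduce u w) \<subseteq> A \<times> UNIV"
  by (induction u) (simp_all add: set_cons_reduce)

lemma cons_reduce_inv: "reduced_word w \<Longrightarrow> cons_reduce (inv_letter a) (cons_reduce a w) = w"
  by (cases w) (auto simp: cons_reduce_def reduced_Cons)

lemma foldr_cons_reduce:
  assumes "reduced_word w"
  shows "foldr cons_reduce (cons_reduce a v) w = cons_reduce a (foldr cons_reduce v w)"
proof (cases "v \<noteq> [] \<and> hd v = inv_letter a")
  case True
  then obtain v' where "v = inv_letter a # v'" by (cases v) auto
  then show ?thesis
    using cons_reduce_inv[of "foldr cons_reduce v' w" "inv_letter a"] reduced_foldr[OF assms]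
    by (simp add: cons_reduce_def[of a])
qed (auto simp: cons_reduce_def[of a v])

lemma foldr_assoc:
  assumes "reduced_word w"
  shows "foldr cons_reduce (foldr cons_reduce u v) w = foldr cons_reduce u (foldr cons_reduce v w)"
  by (induction u) (simp_all add: foldr_cons_reduce[OF assms])

lemma foldr_cons_reduce_Nil: "reduced_word u \<Longrightarrow> foldr cons_reduce u [] = u"
  by (induction u) (auto simp: reduced_Cons cons_reduce_def)

lemma free_group_left_inverse:
  assumes "set u \<subseteq> A \<times> UNIV" "reduced_word u"
  shows "\<exists>v. set v \<subseteq> A \<times> UNIV \<and> reduced_word v \<and> foldr cons_reduce v u = []"
  using assms
proof (induction u)
  case (Cons a u)
  then obtain v where v: "set v \<subseteq> A \<times> UNIV" "reduced_word v" "foldr cons_reduce v u = []"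
    by (auto simp: reduced_Cons)
  have a: "set [inv_letter a] \<subseteq> A \<times> UNIV"
    using Cons.prems by (auto simp: inv_letter_def)
  have "foldr cons_reduce (foldr cons_reduce v [inv_letter a]) (a # u) = []"
    using foldr_assoc[OF Cons.prems(2), of v "[inv_letter a]"] v
    by (simp add: cons_reduce_def[of "inv_letter a"])
  moreover have "reduced_word (foldr cons_reduce v [inv_letter a])"
    by (rule reduced_foldr) (simp add: reduced_Cons)
  ultimately show ?case using set_foldr[OF v(1) a] by blast
qed (auto intro: exI[of _ "[]"])

lemma group_free_group: "group (free_group A)"
proof (rule groupI)
  fix u assume "u \<in> carrier (free_group A)"
  then show "\<exists>v\<in>carrier (free_group A). v \<otimes>\<^bsub>free_group A\<^esub> u = \<one>\<^bsub>free_group A\<^esub>"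
    using free_group_left_inverse[of u A] by (auto simp: free_group_def)
next
  fix u v assume "u \<in> carrier (free_group A)" "v \<in> carrier (free_group A)"
  then show "u \<otimes>\<^bsub>free_group A\<^esub> v \<in> carrier (free_group A)"
    using set_foldr[of u A v] reduced_foldr[of v u] unfolding free_group_def by simp
qed (auto simp: free_group_def foldr_assoc)

lemma (in group) normal_normal_closure:
  assumes "R \<subseteq> carrier G"
  shows "normal_closure G R \<lhd> G"
proof -
  let ?C = "{N. N \<lhd> G \<and> R \<subseteq> N}"
  have ne: "carrier G \<in> ?C"
    using assms by (auto simp: normal_inv_iff subgroup_self)
  have "subgroup (\<Inter>?C) G"
    by (rule subgroups_Inter) (use ne in \<open>auto simp: normal_imp_subgroup\<close>)
  then show ?thesis
    unfolding normal_closure_def by (auto simp: normal_inv_iff)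
qed

lemma group_presented_group:
  assumes "R \<subseteq> carrier (free_group A)"
  shows "group (presented_group A R)"
  unfolding presented_group_def
  by (intro normal.factorgroup_is_group group.normal_normal_closure group_free_group assms)

text \<open>The two copies of the group are the two summands of a sum type.\<close>

definition cayley_poset_carrier :: "('a, 'b) monoid_scheme \<Rightarrow> ('a + 'a) set" where
  "cayley_poset_carrier G = carrier G <+> carrier G"

definition cayley_poset ::
  "('a, 'b) monoid_scheme \<Rightarrow> 'a set \<Rightarrow> ('a + 'a) rel" where
  "cayley_poset G S =
     Id_on (cayley_poset_carrier G) \<union>
     {(Inl g, Inr h) | g h. g \<in> carrier G \<and> h \<in> carrier G \<and> h \<in> g <#\<^bsub>G\<^esub> S}"

definition poset_auts :: "'a set \<Rightarrow> 'a rel \<Rightarrow> ('a \<Rightarrow> 'a) set" where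
  "poset_auts A r =
     {f \<in> Bij A. \<forall>x\<in>A. \<forall>y\<in>A. (x, y) \<in> r \<longleftrightarrow> (f x, f y) \<in> r}"

definition left_mult_action ::
  "('a, 'b) monoid_scheme \<Rightarrow> 'a \<Rightarrow> 'a + 'a \<Rightarrow> 'a + 'a" where
  "left_mult_action G g =
     (\<lambda>p \<in> cayley_poset_carrier G. map_sum (monoid.mult G g) (monoid.mult G g) p)"

definition is_cayley_representation :: "('a, 'b) monoid_scheme \<Rightarrow> 'a set \<Rightarrow> bool" where
  "is_cayley_representation G S \<longleftrightarrow>
     poset_auts (cayley_poset_carrier G) (cayley_poset G S) \<subseteq> left_mult_action G ` carrier G"

definition admits_cayley_representation :: "('a, 'b) monoid_scheme \<Rightarrow> bool" where
  "admits_cayley_representation G \<longleftrightarrow>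
     (\<exists>S. S \<noteq> {} \<and> S \<subseteq> carrier G \<and> is_cayley_representation G S)"

lemma partial_order_cayley_poset:
  "partial_order_on (cayley_poset_carrier G) (cayley_poset G S)"
  by (auto simp: partial_order_on_def preorder_on_def refl_on_def trans_def antisym_def
      cayley_poset_def cayley_poset_carrier_def)

lemma (in group) left_mult_action_aut:
  assumes "g \<in> carrier G" "S \<subseteq> carrier G"
  shows "left_mult_action G g \<in> poset_auts (cayley_poset_carrier G) (cayley_poset G S)"
proof -
  let ?A = "cayley_poset_carrier G"
  have bij: "bij_betw (left_mult_action G g) ?A ?A"
    by (rule bij_betw_byWitness[where f' = "left_mult_action G (inv g)"])
       (use assms in \<open>auto simp: left_mult_action_def cayley_poset_carrier_def
          m_assoc [symmetric] InlI InrI\<close>)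
  have coset: "g \<otimes> h \<in> (g \<otimes> k) <# S \<longleftrightarrow> h \<in> k <# S"
    if "h \<in> carrier G" "k \<in> carrier G" for h k
    using that assms by (auto simp: l_coset_def m_assoc subset_iff)
  have "(x, y) \<in> cayley_poset G S \<longleftrightarrow>
          (left_mult_action G g x, left_mult_action G g y) \<in> cayley_poset G S"
    if "x \<in> ?A" "y \<in> ?A" for x y
    using that assms
    by (auto simp: cayley_poset_def cayley_poset_carrier_def left_mult_action_def coset InlI InrI)
  then show ?thesis
    using bij by (simp add: poset_auts_def Bij_def left_mult_action_def)
qed

definition cyc_reduced_words :: "nat \<Rightarrow> nat \<Rightarrow> nat letter list set" where
  "cyc_reduced_words n l = {w. set w \<subseteq> {..<n} \<times> UNIV \<and> cyclically_reduced w \<and> length w \<le> l}"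

definition random_relators :: "nat \<Rightarrow> nat \<Rightarrow> nat \<Rightarrow> (nat \<Rightarrow> nat letter list) pmf" where
  "random_relators n m l = Pi_pmf {..<m} [] (\<lambda>_. pmf_of_set (cyc_reduced_words n l))"

lemma finite_cyc_reduced_words: "finite (cyc_reduced_words n l)"
  by (rule finite_subset[OF _ finite_lists_length_le[of "{..<n} \<times> UNIV" l]])
     (auto simp: cyc_reduced_words_def)

lemma cyc_reduced_words_nonempty: "cyc_reduced_words n l \<noteq> {}"
proof -
  have "[] \<in> cyc_reduced_words n l"
    by (simp add: cyc_reduced_words_def cyclically_reduced_def)
  then show ?thesis by blast
qed

lemma cyc_reduced_words_subset: "cyc_reduced_words n l \<subseteq> carrier (free_group {..<n})"
  by (auto simp: cyc_reduced_words_def cyclically_reduced_def free_group_def)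

end

(* If x and y generate G and no short nontrivial word in them is trivial, let
   S = {1, x, x^2, x^4, x^6, y}. An automorphism of P(G,S) preserves the number of 4-cycles through
   each edge, and these numbers tell the six kinds of edges g < (gs)' apart; so it commutes with
   right multiplication by S and is a left multiplication.

   With probability tending to 1 the relators are long compared with k = 2h, h = l div 133, and
   distinct cyclic conjugates of relators and their inverses have distinct prefixes of length k:
   otherwise h consecutive letters of some relator would be determined by its other letters and by
   the other relators, which happens for a proportion poly(l) / 3^h of the words.

   Such relators have no short consequences. A word w that is a product of n conjugates of relators,
   with n minimal, can be turned into a freely trivial word f by n expansions of a letter a to
   s^-1, where a s is a relator. The cancellation in f pairs off blocks of contiguous letters of
   single relators, and there are O(|w| + n) blocks. As the relators are long, some block has at
   least k letters; then the two relators that meet there are mirror images, and can be removed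
   from the product, against the minimality of n. *)

theory Submission
  imports Defs "HOL-Real_Asymp.Real_Asymp"
begin

section \<open>Words and the free group\<close>

text \<open>The constants are read off backwards. Telling the edges apart involves relations no
  longer than y x^i y x^j with |i|, |j| \<le> 6, that is, 14 letters. For words of that length the
  cancellation argument asks for relators of at least (4 * 14 + 10) k = 66 k = 132 h letters, and
  discarding words of length at most l - h provides this when 133 h \<le> l.

  The obstacle is that small cancellation theory normally argues with planar diagrams. Planarity is
  replaced here by the order of the expansions: they are made from left to right, unread letters
  form a stack, and so the histories of two cancelling blocks are nested or disjoint. This is what
  allows both mirror relators to be removed by conjugating other factors only.

  The prefix length is 2 h and not h because a relator may overlap its own inverse. The overlap can
  then meet its mirror image, but one half of it is disjoint from its image, and these h letters are
  determined by the others.\<close>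

definition winv :: "'a letter list \<Rightarrow> 'a letter list" where
  "winv w = rev (map inv_letter w)"

lemma winv_Nil [simp]: "winv [] = []"
  and winv_Cons: "winv (a # w) = winv w @ [inv_letter a]"
  and winv_append [simp]: "winv (v @ w) = winv w @ winv v"
  and length_winv [simp]: "length (winv w) = length w"
  and winv_eq_Nil [simp]: "winv w = [] \<longleftrightarrow> w = []"
  by (auto simp: winv_def)

lemma winv_winv [simp]: "winv (winv w) = w"
  by (simp add: winv_def rev_map comp_def)

lemma inv_letter_inject [simp]: "inv_letter a = inv_letter b \<longleftrightarrow> a = b"
  by (metis inv_letter_inv_letter)

definition normal_form :: "'a letter list \<Rightarrow> 'a letter list" where
  "normal_form w = foldr cons_reduce w []"

lemma normal_form_Nil [simp]: "normal_form [] = []"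
  and normal_form_Cons: "normal_form (a # w) = cons_reduce a (normal_form w)"
  by (simp_all add: normal_form_def)

lemma reduced_normal_form [simp]: "reduced_word (normal_form w)"
  by (simp add: normal_form_def reduced_foldr)

lemma normal_form_reduced: "reduced_word w \<Longrightarrow> normal_form w = w"
  by (simp add: normal_form_def foldr_cons_reduce_Nil)

lemma normal_form_append: "normal_form (v @ w) = foldr cons_reduce (normal_form v) (normal_form w)"
  unfolding normal_form_def
  using foldr_assoc[of "foldr cons_reduce w []" v "[]"] by (simp add: reduced_foldr)

lemma normal_form_winv_left: "normal_form (winv w @ w) = []"
proof (induction w)
  case (Cons a w)
  have "normal_form (inv_letter a # a # w) = normal_form w"
    using cons_reduce_inv[of "normal_form w" a] by (simp add: normal_form_Cons)
  with Cons show ?case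
    by (simp add: winv_Cons normal_form_append)
qed simp

lemma reduced_append1: "reduced_word (v @ w) \<Longrightarrow> reduced_word v"
  and reduced_append2: "reduced_word (v @ w) \<Longrightarrow> reduced_word w"
  by (auto simp: reduced_word_def successively_append_iff)

lemma reduced_append_iff:
  "reduced_word (v @ w) \<longleftrightarrow> reduced_word v \<and> reduced_word w \<and>
     (v \<noteq> [] \<longrightarrow> w \<noteq> [] \<longrightarrow> hd w \<noteq> inv_letter (last v))"
  by (auto simp: reduced_word_def successively_append_iff)

lemma reduced_winv [simp]: "reduced_word (winv w) \<longleftrightarrow> reduced_word w"
proof -
  have *: "reduced_word (winv w)" if "reduced_word w" for w :: "'a letter list"
    using that
    by (induction w) (auto simp: winv_Cons reduced_append_iff reduced_Cons winv_def last_rev hd_map)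
  from *[of w] *[of "winv w"] show ?thesis by auto
qed

text \<open>In the tree of reduced words the edge from \<open>p\<close> to \<open>p @ [a]\<close>
  separates the empty word from the normal form of \<open>w\<close>, so the path spelled by
  \<open>w\<close> must cross it. Cutting \<open>w\<close> at such a crossing gives \<open>u\<close>
  and \<open>v\<close>.\<close>

lemma normal_form_split:
  assumes "normal_form w = p @ a # q"
  shows "\<exists>u v. w = u @ a # v \<and> normal_form u = p \<and> normal_form v = q"
  using assms
proof (induction w arbitrary: p)
  case (Cons c w)
  show ?case
  proof (cases "normal_form w \<noteq> [] \<and> hd (normal_form w) = inv_letter c")
    case True
    then have "normal_form w = (inv_letter c # p) @ a # q"
      using Cons.prems by (cases "normal_form w") (auto simp: normal_form_Cons cons_reduce_def)
    from Cons.IH[OF this] obtain u v where uv: "w = u @ a # v" "normal_form u = inv_letter c # p"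
        "normal_form v = q" by blast
    then show ?thesis
      by (intro exI[of _ "c # u"] exI[of _ v]) (simp add: normal_form_Cons cons_reduce_def)
  next
    case False
    then have nf: "normal_form (c # w) = c # normal_form w"
      by (auto simp: normal_form_Cons cons_reduce_def)
    show ?thesis
    proof (cases p)
      case Nil
      then show ?thesis using nf Cons.prems by (intro exI[of _ "[]"] exI[of _ w]) auto
    next
      case (Cons c' p')
      then have p: "p = c # p'" "normal_form w = p' @ a # q"
        using nf Cons.prems by auto
      from Cons.IH[OF p(2)] obtain u v where uv: "w = u @ a # v" "normal_form u = p'"
        "normal_form v = q" by blast
      have "reduced_word (c # p')"
        using reduced_normal_form[of "c # w"] Cons.prems p(1) by (metis reduced_append1)
      then show ?thesis
        using uv p(1) by (intro exI[of _ "c # u"] exI[of _ v])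
          (auto simp: normal_form_Cons cons_reduce_def reduced_Cons)
    qed
  qed
qed simp

section \<open>The free group on all letters as a type\<close>

typedef 'a fgroup = "{w :: 'a letter list. reduced_word w}"
  morphisms word_of of_word
  by (auto intro: exI[of _ "[]"])

definition val :: "'a letter list \<Rightarrow> 'a fgroup" where
  "val w = of_word (normal_form w)"

lemma word_of_val [simp]: "word_of (val w) = normal_form w"
  by (simp add: val_def of_word_inverse)

lemma val_word_of [simp]: "val (word_of g) = g"
  using word_of[of g] by (simp add: val_def word_of_inverse normal_form_reduced)

lemma reduced_word_of [simp]: "reduced_word (word_of g)"
  using word_of[of g] by simp

lemma val_eq_iff: "val v = val w \<longleftrightarrow> normal_form v = normal_form w"
  by (metis word_of_val val_def)

text \<open>Written additively although it is not commutative: \<open>group_add\<close> supplies the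
  simplification rules for groups, and a type avoids membership side conditions.\<close>

instantiation fgroup :: (type) group_add
begin

definition "0 = val []"
definition "g + h = val (word_of g @ word_of h)"
definition "- g = val (winv (word_of g))"
definition "(g :: 'a fgroup) - h = g + - h"

instance
proof
  fix a b c :: "'a fgroup"
  show "a + b + c = a + (b + c)"
    by (simp add: plus_fgroup_def val_eq_iff normal_form_append normal_form_reduced
        foldr_assoc reduced_foldr)
  show "0 + a = a" "a + 0 = a"
    by (simp_all add: plus_fgroup_def zero_fgroup_def)
  show "- a + a = 0"
    using normal_form_winv_left[of "word_of a"]
    by (simp add: plus_fgroup_def zero_fgroup_def uminus_fgroup_def val_eq_iff normal_form_append
        normal_form_reduced)
  show "a + - b = a - b"
    by (simp add: minus_fgroup_def)
qed

end

lemmas group_simps = diff_conv_add_uminus minus_add add.assoc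

lemma val_Nil [simp]: "val [] = 0"
  by (simp add: zero_fgroup_def)

lemma val_append [simp]: "val (v @ w) = val v + val w"
  by (simp add: plus_fgroup_def val_eq_iff normal_form_append normal_form_reduced)

definition gen :: "'a letter \<Rightarrow> 'a fgroup" where
  "gen a = val [a]"

lemma val_Cons [simp]: "val (a # w) = gen a + val w"
  using val_append[of "[a]" w] by (simp add: gen_def)

lemma gen_inv_letter [simp]: "gen (inv_letter a) = - gen a"
proof -
  have "val [inv_letter a, a] = 0"
    by (simp add: zero_fgroup_def val_def normal_form_Cons cons_reduce_def)
  then show ?thesis by (simp add: eq_neg_iff_add_eq_0)
qed

lemma val_winv [simp]: "val (winv w) = - val w"
  by (induction w) (simp_all add: winv_Cons minus_add)

lemma val_eq_0_iff: "val w = 0 \<longleftrightarrow> normal_form w = []"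
  using val_eq_iff[of w "[]"] by simp

lemma word_of_0 [simp]: "word_of 0 = []"
  using word_of_val[of "[]"] by (simp del: word_of_val)

section \<open>Products of conjugates of relators\<close>

text \<open>A symmetrized set of relators in the sense of small cancellation theory.\<close>

definition cyc_closed :: "'a letter list set \<Rightarrow> bool" where
  "cyc_closed R \<longleftrightarrow> (\<forall>r\<in>R. r \<noteq> [] \<and> rotate1 r \<in> R \<and> winv r \<in> R \<and> cyclically_reduced r)"

definition conj_val :: "'a letter list \<times> 'a letter list \<Rightarrow> 'a fgroup" where
  "conj_val c = val (fst c) + val (snd c) - val (fst c)"

definition prod_val :: "('a letter list \<times> 'a letter list) list \<Rightarrow> 'a fgroup" where
  "prod_val cs = sum_list (map conj_val cs)"

lemma prod_val_Nil [simp]: "prod_val [] = 0"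
  and prod_val_Cons [simp]: "prod_val (c # cs) = conj_val c + prod_val cs"
  and prod_val_append [simp]: "prod_val (cs @ ds) = prod_val cs + prod_val ds"
  by (simp_all add: prod_val_def)

text \<open>The count corresponds to the area of a van Kampen diagram. An upper bound in place of
  the exact minimum makes the sets increasing in \<open>n\<close> and compatible with
  products.\<close>

definition area_le :: "'a letter list set \<Rightarrow> nat \<Rightarrow> 'a fgroup set" where
  "area_le R n = {prod_val cs |cs. length cs \<le> n \<and> snd ` set cs \<subseteq> R}"

lemma area_leI: "length cs \<le> n \<Longrightarrow> snd ` set cs \<subseteq> R \<Longrightarrow> prod_val cs \<in> area_le R n"
  by (auto simp: area_le_def)

lemma area_le_0 [simp]: "0 \<in> area_le R n"
  using area_leI[of "[]"] by simp

lemma area_le_mono: "g \<in> area_le R m \<Longrightarrow> m \<le> n \<Longrightarrow> g \<in> area_le R n"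
  unfolding area_le_def by fastforce

lemma area_le_add:
  assumes "g \<in> area_le R m" "h \<in> area_le R n"
  shows "g + h \<in> area_le R (m + n)"
proof -
  from assms obtain cs ds where "g = prod_val cs" "length cs \<le> m" "snd ` set cs \<subseteq> R"
    "h = prod_val ds" "length ds \<le> n" "snd ` set ds \<subseteq> R"
    by (auto simp: area_le_def)
  then show ?thesis using area_leI[of "cs @ ds" "m + n" R] by auto
qed

text \<open>Stems are extended without reduction, so their total length grows by exactly
  \<open>length v * length cs\<close>, the same amount for all lists of one length.\<close>

definition conj_by :: "'a letter list \<Rightarrow> ('a letter list \<times> 'a letter list) list \<Rightarrow>
    ('a letter list \<times> 'a letter list) list" where
  "conj_by v cs = map (\<lambda>(u, r). (v @ u, r)) cs"

lemma conj_by_simps [simp]: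
  "length (conj_by v cs) = length cs" "snd ` set (conj_by v cs) = snd ` set cs"
  by (auto simp: conj_by_def image_image case_prod_beta)

lemma prod_val_conj_by: "prod_val (conj_by v cs) = val v + prod_val cs - val v"
proof (induction cs)
  case (Cons c cs)
  have "prod_val (conj_by v (c # cs)) = conj_val (v @ fst c, snd c) + prod_val (conj_by v cs)"
    by (simp add: conj_by_def case_prod_beta)
  then show ?case
    using Cons by (simp add: conj_val_def group_simps del: add_uminus_conv_diff)
qed (simp add: conj_by_def)

lemma area_le_conj:
  assumes "g \<in> area_le R n" shows "h + g - h \<in> area_le R n"
proof -
  from assms obtain cs where "g = prod_val cs" "length cs \<le> n" "snd ` set cs \<subseteq> R"
    by (auto simp: area_le_def)
  then show ?thesis
    using area_leI[of "conj_by (word_of h) cs" n R] by (simp add: prod_val_conj_by)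
qed

lemma area_le_conj': "g \<in> area_le R n \<Longrightarrow> - h + g + h \<in> area_le R n"
  using area_le_conj[of g R n "- h"] by simp

lemma area_le_1: "r \<in> R \<Longrightarrow> val r \<in> area_le R 1"
  using area_leI[of "[([], r)]" 1 R] by (simp add: conj_val_def)

definition prod_inv :: "('a letter list \<times> 'a letter list) list \<Rightarrow>
    ('a letter list \<times> 'a letter list) list" where
  "prod_inv cs = rev (map (\<lambda>(u, r). (u, winv r)) cs)"

lemma prod_val_inv: "prod_val (prod_inv cs) = - prod_val cs"
proof (induction cs)
  case (Cons c cs)
  have "prod_val (prod_inv (c # cs)) = prod_val (prod_inv cs) + conj_val (fst c, winv (snd c))"
    by (simp add: prod_inv_def case_prod_beta)
  also have "conj_val (fst c, winv (snd c)) = - conj_val c"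
    by (simp add: conj_val_def group_simps del: add_uminus_conv_diff)
  finally show ?case using Cons by (simp add: minus_add)
qed (simp add: prod_inv_def)

lemma prod_inv_inv [simp]: "prod_inv (prod_inv cs) = cs"
  by (simp add: prod_inv_def rev_map comp_def case_prod_beta)

lemma length_prod_inv [simp]: "length (prod_inv cs) = length cs"
  by (simp add: prod_inv_def)

lemma prod_inv_subset:
  "cyc_closed R \<Longrightarrow> snd ` set cs \<subseteq> R \<Longrightarrow> snd ` set (prod_inv cs) \<subseteq> R"
  by (auto simp: prod_inv_def cyc_closed_def)

lemma area_le_uminus:
  assumes "cyc_closed R" "g \<in> area_le R n" shows "- g \<in> area_le R n"
proof -
  from assms(2) obtain cs where "g = prod_val cs" "length cs \<le> n" "snd ` set cs \<subseteq> R"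
    by (auto simp: area_le_def)
  then show ?thesis
    using area_leI[of "prod_inv cs" n R] prod_inv_subset[OF assms(1)] by (simp add: prod_val_inv)
qed

lemma cyc_closed_rotate:
  assumes "cyc_closed R" "r \<in> R" shows "rotate n r \<in> R"
  using assms by (induction n) (auto simp: cyc_closed_def)

lemma cyc_closed_swap:
  assumes "cyc_closed R" "p @ q \<in> R" shows "q @ p \<in> R"
  using cyc_closed_rotate[OF assms, of "length p"] by (simp add: rotate_append)

section \<open>Products with the fewest conjugates and, among these, the shortest stems\<close>

definition stems :: "('a letter list \<times> 'a letter list) list \<Rightarrow> nat" where
  "stems cs = (\<Sum>c\<leftarrow>cs. length (fst c))"

lemma stems_simps [simp]:
  "stems [] = 0" "stems (c # cs) = length (fst c) + stems cs" "stems (cs @ ds) = stems cs + stems ds"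
  by (simp_all add: stems_def)

text \<open>The number of conjugates alone does not control the stems. The tie-break forbids stems
  that could be shortened by reordering the conjugates, and this locates the first letter of the
  reduced product.\<close>

definition optimal :: "'a letter list set \<Rightarrow> ('a letter list \<times> 'a letter list) list \<Rightarrow> bool" where
  "optimal R cs \<longleftrightarrow> snd ` set cs \<subseteq> R \<and>
     (\<forall>ds. snd ` set ds \<subseteq> R \<longrightarrow> prod_val ds = prod_val cs \<longrightarrow>
        length cs < length ds \<or> length cs = length ds \<and> stems cs \<le> stems ds)"

lemma optimalD:
  assumes "optimal R cs" "snd ` set ds \<subseteq> R" "prod_val ds = prod_val cs"
  shows "length cs < length ds \<or> length cs = length ds \<and> stems cs \<le> stems ds"
  using assms by (auto simp: optimal_def)

lemma optimal_subset: "optimal R cs \<Longrightarrow> snd ` set cs \<subseteq> R"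
  by (simp add: optimal_def)

lemma optimal_exists:
  assumes "g \<in> area_le R n"
  shows "\<exists>cs. optimal R cs \<and> prod_val cs = g \<and> length cs \<le> n"
proof -
  define P where "P cs \<longleftrightarrow> snd ` set cs \<subseteq> R \<and> prod_val cs = g" for cs
  obtain cs0 where cs0: "P cs0" "length cs0 \<le> n"
    using assms by (auto simp: area_le_def P_def)
  obtain cs1 where cs1: "P cs1" "\<And>ds. P ds \<Longrightarrow> length cs1 \<le> length ds"
    using ex_has_least_nat[of P cs0 length] cs0 by blast
  obtain cs where cs: "P cs" "length cs = length cs1"
      "\<And>ds. P ds \<Longrightarrow> length ds = length cs1 \<Longrightarrow> stems cs \<le> stems ds"
    using ex_has_least_nat[of "\<lambda>ds. P ds \<and> length ds = length cs1" cs1 stems] cs1(1) by blast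
  have "optimal R cs"
    unfolding optimal_def
  proof (intro conjI allI impI)
    fix ds assume "snd ` set ds \<subseteq> R" "prod_val ds = prod_val cs"
    then have "P ds" using cs(1) by (simp add: P_def)
    then show "length cs < length ds \<or> length cs = length ds \<and> stems cs \<le> stems ds"
      using cs(2,3) cs1(2) by (metis le_neq_implies_less)
  qed (use cs(1) P_def in blast)
  moreover have "length cs \<le> n" using cs(2) cs1(2)[OF cs0(1)] cs0(2) by simp
  ultimately show ?thesis using cs(1) by (auto simp: P_def)
qed

lemma optimal_sub:
  assumes "optimal R (cs1 @ cs2 @ cs3)" shows "optimal R cs2"
  unfolding optimal_def
proof (intro conjI allI impI)
  show "snd ` set cs2 \<subseteq> R" using optimal_subset[OF assms] by auto
  fix ds assume ds: "snd ` set ds \<subseteq> R" "prod_val ds = prod_val cs2"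
  then show "length cs2 < length ds \<or> length cs2 = length ds \<and> stems cs2 \<le> stems ds"
    using optimalD[OF assms, of "cs1 @ ds @ cs3"] optimal_subset[OF assms] by auto
qed

lemma stems_conj_by: "stems (conj_by v cs) = length v * length cs + stems cs"
  by (induction cs) (auto simp: conj_by_def)

lemma optimal_conj_byD:
  assumes "optimal R (conj_by v cs)" shows "optimal R cs"
  unfolding optimal_def
proof (intro conjI allI impI)
  show "snd ` set cs \<subseteq> R" using optimal_subset[OF assms] by simp
  fix ds assume ds: "snd ` set ds \<subseteq> R" "prod_val ds = prod_val cs"
  then show "length cs < length ds \<or> length cs = length ds \<and> stems cs \<le> stems ds"
    using optimalD[OF assms, of "conj_by v ds"] by (auto simp: prod_val_conj_by stems_conj_by)
qed

lemma stems_prod_inv [simp]: "stems (prod_inv cs) = stems cs"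
  by (induction cs) (auto simp: prod_inv_def)

lemma optimal_prod_inv:
  assumes "cyc_closed R" "optimal R cs" shows "optimal R (prod_inv cs)"
  unfolding optimal_def
proof (intro conjI allI impI)
  show "snd ` set (prod_inv cs) \<subseteq> R"
    using prod_inv_subset[OF assms(1) optimal_subset[OF assms(2)]] .
  fix ds assume ds: "snd ` set ds \<subseteq> R" "prod_val ds = prod_val (prod_inv cs)"
  then show "length (prod_inv cs) < length ds \<or>
      length (prod_inv cs) = length ds \<and> stems (prod_inv cs) \<le> stems ds"
    using optimalD[OF assms(2), of "prod_inv ds"] prod_inv_subset[OF assms(1) ds(1)]
    by (auto simp: prod_val_inv)
qed

section \<open>The first letter of a consequence of the relators\<close>

definition literal :: "('a letter list \<times> 'a letter list) list \<Rightarrow> 'a letter list" where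
  "literal cs = concat (map (\<lambda>c. fst c @ snd c @ winv (fst c)) cs)"

lemma val_literal: "val (literal cs) = prod_val cs"
  by (induction cs) (auto simp: literal_def conj_val_def group_simps simp del: add_uminus_conv_diff)

lemma append_eq_split:
  assumes "x @ y = p @ a # q"
  shows "(\<exists>q'. x = p @ a # q') \<or> (\<exists>p'. p = x @ p' \<and> y = p' @ a # q)"
  using assms by (auto simp: append_eq_append_conv2 append_eq_Cons_conv)

lemma literal_split:
  assumes "literal cs = l @ a # l'"
  shows "\<exists>cs1 u r cs2 p q. cs = cs1 @ (u, r) # cs2 \<and> u @ r @ winv u = p @ a # q \<and> l = literal cs1 @ p"
  using assms
proof (induction cs arbitrary: l)
  case (Cons c cs)
  obtain u r where c: "c = (u, r)" by fastforce
  have "(u @ r @ winv u) @ literal cs = l @ a # l'"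
    using Cons.prems by (simp add: literal_def c)
  from append_eq_split[OF this] show ?case
  proof (elim disjE exE conjE)
    fix q' assume "u @ r @ winv u = l @ a # q'"
    then show ?thesis
      by (intro exI[of _ "[]"] exI[of _ u] exI[of _ r] exI[of _ cs] exI[of _ l] exI[of _ q'])
        (simp add: literal_def c)
  next
    fix p' assume p': "l = (u @ r @ winv u) @ p'" "literal cs = p' @ a # l'"
    from Cons.IH[OF p'(2)] obtain cs1 u' r' cs2 p q where
      "cs = cs1 @ (u', r') # cs2" "u' @ r' @ winv u' = p @ a # q" "p' = literal cs1 @ p" by blast
    then show ?thesis using p'(1)
      by (intro exI[of _ "c # cs1"] exI[of _ u'] exI[of _ r'] exI[of _ cs2] exI[of _ p] exI[of _ q])
        (simp add: literal_def c)
  qed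
qed (simp add: literal_def)

text \<open>The path spelled by \<open>literal cs\<close> leaves the trivial prefix for good through an edge labelled
  \<open>a\<close>. If that edge lies on a relator, the relator can be moved to the front; if it lies on a stem,
  moving the conjugate to the front does not lengthen its stem.\<close>

lemma optimal_head:
  assumes R: "cyc_closed R" and opt: "optimal R cs" and word: "word_of (prod_val cs) = a # q"
  shows "(\<exists>s. a # s \<in> R \<and> - val (a # s) + prod_val cs \<in> area_le R (length cs - 1)) \<or>
         (\<exists>u r ds. cs = (a # u, r) # ds)"
proof -
  have "normal_form (literal cs) = [] @ a # q"
    using word by (metis append_Nil val_literal word_of_val)
  from normal_form_split[OF this] obtain l l' where l: "literal cs = l @ a # l'" "val l = 0"
    by (auto simp: val_eq_0_iff)
  from literal_split[OF l(1)] obtain cs1 u r cs2 p p' where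
    cs: "cs = cs1 @ (u, r) # cs2" and u: "u @ r @ winv u = p @ a # p'" and "l = literal cs1 @ p"
    by blast
  then have cs1: "prod_val cs1 + val p = 0"
    using l(2) by (simp add: val_literal)
  then have p_cs1: "val p = - prod_val cs1"
    by (metis minus_unique)
  have sub: "snd ` set (cs1 @ cs2) \<subseteq> R" "r \<in> R"
    using optimal_subset[OF opt] cs by auto
  have rest: "prod_val cs1 + prod_val cs2 \<in> area_le R (length cs - 1)"
    using area_leI[of "cs1 @ cs2" "length cs - 1" R] sub cs by simp
  have W: "prod_val cs = prod_val cs1 + (val u + val r - val u) + prod_val cs2"
    by (simp add: cs conj_val_def add.assoc)
  consider (stem) q' where "u = p @ a # q'" | (rel) p1 q' where "p = u @ p1" "r = p1 @ a # q'"
    | (stem_inv) p1 where "p = u @ r @ p1" "winv u = p1 @ a # p'"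
    using append_eq_split[OF u] append_eq_split[of r "winv u" _ a p'] by fastforce
  then show ?thesis
  proof cases
    case stem
    have eq: "prod_val ((a # q', r) # cs1 @ cs2) = prod_val cs"
      by (simp add: W stem p_cs1 conj_val_def group_simps del: add_uminus_conv_diff)
    have "length cs < length ((a # q', r) # cs1 @ cs2) \<or>
      length cs = length ((a # q', r) # cs1 @ cs2) \<and> stems cs \<le> stems ((a # q', r) # cs1 @ cs2)"
      by (rule optimalD[OF opt _ eq]) (use sub in auto)
    \<comment> \<open>The stem \<open>p @ a # q'\<close> has become \<open>a # q'\<close>, so the
      total stem length drops by \<open>length p\<close>.\<close>
    then have p: "p = []" by (simp add: cs stem)
    then have "prod_val ((u, r) # cs2) = prod_val cs" using cs1 by (simp add: cs)
    from optimalD[OF opt _ this] have "cs1 = []"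
      using sub by (auto simp: cs)
    then show ?thesis by (simp add: cs stem p)
  next
    case rel
    have "a # q' @ p1 \<in> R"
      using cyc_closed_swap[OF R, of p1 "a # q'"] sub(2) rel by simp
    moreover have "- val (a # q' @ p1) + prod_val cs = prod_val cs1 + prod_val cs2"
    proof -
      have "val u = - prod_val cs1 - val p1"
        using p_cs1 rel(1) by (simp add: eq_diff_eq)
      then show ?thesis
        by (simp add: W rel(2) group_simps del: add_uminus_conv_diff)
    qed
    ultimately show ?thesis using rest by (intro disjI1 exI[of _ "q' @ p1"]) simp
  next
    case stem_inv
    have u': "u = winv p' @ inv_letter a # winv p1"
      using arg_cong[OF stem_inv(2), of winv] by (simp add: winv_Cons)
    have "prod_val ((winv p1, r) # cs1 @ cs2) = prod_val cs"
    proof -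
      have "prod_val cs1 + val u + val r + val p1 = 0"
        using cs1 stem_inv(1) by (simp add: add.assoc)
      then have "val p1 = - (prod_val cs1 + val u + val r)"
        by (metis minus_unique)
      then show ?thesis
        by (simp add: W conj_val_def group_simps del: add_uminus_conv_diff)
    qed
    \<comment> \<open>The number of conjugates is unchanged, but the stem \<open>winv p1\<close> is
      shorter than \<open>u\<close> by \<open>length p' + 1\<close>.\<close>
    from optimalD[OF opt _ this] have False using sub by (auto simp: cs u')
    then show ?thesis ..
  qed
qed

lemma hd_winv: "w \<noteq> [] \<Longrightarrow> hd (winv w) = inv_letter (last w)"
  by (simp add: winv_def hd_rev last_map)

text \<open>Let V be the product of the leading conjugates whose stems start with \<open>a\<close>,
  stripped of that letter, and Z the product of the rest, so that the value is a V a^-1 Z. Unless a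
  relator starting with \<open>a\<close> splits off, nothing cancels around a^-1:
  \<open>optimal_head\<close> applied to Z shows that Z does not start with \<open>a\<close>, and
  applied to the inverse of V that V does not end with \<open>a\<close>. Hence \<open>q\<close> is
  literally V a^-1 Z.\<close>

lemma peel_reduced:
  assumes R: "cyc_closed R" and opt: "optimal R cs" and word: "word_of (prod_val cs) = a # q"
  shows "(\<exists>s. a # s \<in> R \<and> - val (a # s) + prod_val cs \<in> area_le R (length cs - 1)) \<or>
         (\<exists>y z i j. q = y @ inv_letter a # z \<and> val y \<in> area_le R i \<and> val z \<in> area_le R j \<and>
            i + j \<le> length cs)"
proof (rule disj_imp[THEN iffD2, rule_format])
  assume no: "\<nexists>s. a # s \<in> R \<and> - val (a # s) + prod_val cs \<in> area_le R (length cs - 1)"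
  define P where "P c \<longleftrightarrow> fst c \<noteq> [] \<and> hd (fst c) = a" for c :: "'a letter list \<times> 'a letter list"
  define cs1 where "cs1 = takeWhile P cs"
  define cs2 where "cs2 = dropWhile P cs"
  define ds where "ds = map (\<lambda>(u, r). (tl u, r)) cs1"
  have cs: "cs = cs1 @ cs2" by (simp add: cs1_def cs2_def)
  have cs1: "cs1 = conj_by [a] ds"
    unfolding conj_by_def ds_def map_map
    by (rule map_idI[symmetric])
      (auto simp: cs1_def P_def dest!: set_takeWhileD)
  have opt1: "optimal R cs1" and opt2: "optimal R cs2"
    using optimal_sub[of R "[]" cs1 cs2] optimal_sub[of R cs1 cs2 "[]"] opt by (simp_all add: cs)
  have optd: "optimal R ds" using opt1 unfolding cs1 by (rule optimal_conj_byD)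
  have len: "length cs1 = length ds" by (simp add: ds_def)
  define V where "V = prod_val ds"
  define Z where "Z = prod_val cs2"
  have W: "prod_val cs = gen a + V - gen a + Z"
    by (simp add: cs cs1 prod_val_conj_by V_def Z_def)
  have V_area: "V \<in> area_le R (length ds)" and Z_area: "Z \<in> area_le R (length cs2)"
    unfolding V_def Z_def
    using area_leI[OF order_refl] optimal_subset[OF optd] optimal_subset[OF opt2] by blast+
  have Z: "word_of Z = [] \<or> hd (word_of Z) \<noteq> a"
  proof (rule ccontr)
    assume "\<not> ?thesis"
    then have wZ: "word_of (prod_val cs2) = a # tl (word_of Z)"
      by (cases "word_of Z") (auto simp: Z_def)
    have "\<nexists>u r es. cs2 = (a # u, r) # es"
      using hd_dropWhile[of P cs] unfolding cs2_def[symmetric] by (auto simp: P_def)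
    with optimal_head[OF R opt2 wZ] obtain s where
      s: "a # s \<in> R" "- val (a # s) + Z \<in> area_le R (length cs2 - 1)" by (auto simp: Z_def)
    have "cs2 \<noteq> []" using wZ by auto
    \<comment> \<open>The relator stands at the front of Z only. Pulling it to the front of the
      whole product conjugates the earlier factor, which costs no area.\<close>
    have "- val (a # s) + prod_val cs =
        (- val (a # s) + (gen a + V - gen a) + val (a # s)) + (- val (a # s) + Z)"
      by (simp add: W group_simps del: add_uminus_conv_diff)
    also have "\<dots> \<in> area_le R (length ds + (length cs2 - 1))"
      by (intro area_le_add area_le_conj area_le_conj' V_area s)
    finally show False
      using no s(1) \<open>cs2 \<noteq> []\<close> by (cases cs2) (auto simp: cs len)
  qed
  have V: "word_of V = [] \<or> last (word_of V) \<noteq> a"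
  proof (rule ccontr)
    assume "\<not> ?thesis"
    then have V: "word_of V \<noteq> []" "last (word_of V) = a" by auto
    have "word_of (- V) = winv (word_of V)"
      by (metis normal_form_reduced reduced_winv reduced_word_of val_winv val_word_of word_of_val)
    then have wV: "word_of (prod_val (prod_inv ds)) = inv_letter a # tl (winv (word_of V))"
      using V hd_winv[of "word_of V"] by (metis V_def hd_Cons_tl prod_val_inv winv_eq_Nil)
    from optimal_head[OF R optimal_prod_inv[OF R optd] wV] show False
    proof (elim disjE exE conjE)
      fix s assume s: "inv_letter a # s \<in> R"
        "- val (inv_letter a # s) + prod_val (prod_inv ds) \<in> area_le R (length (prod_inv ds) - 1)"
      have "winv (inv_letter a # s) \<in> R" using R s(1) by (auto simp: cyc_closed_def)
      then have s': "a # winv s \<in> R"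
        using cyc_closed_swap[OF R, of "winv s" "[a]"] by (simp add: winv_Cons)
      define g where "g = - val (inv_letter a # s) - V"
      have g: "g \<in> area_le R (length ds - 1)"
        using s(2) by (simp add: g_def prod_val_inv V_def)
      have "V = - g - val (inv_letter a # s)"
        by (simp add: g_def group_simps del: add_uminus_conv_diff)
      then have "- val (a # winv s) + prod_val cs =
        (- val (a # winv s) + (gen a + - g - gen a) + val (a # winv s)) + Z"
        by (simp add: W group_simps del: add_uminus_conv_diff)
      also have "\<dots> \<in> area_le R ((length ds - 1) + length cs2)"
        by (intro area_le_add area_le_conj area_le_conj' area_le_uminus R g Z_area)
      finally show False
        using no s' V by (cases ds) (auto simp: cs len V_def)
    next
      fix u r es assume "prod_inv ds = (inv_letter a # u, r) # es"
      then have "ds = prod_inv ((inv_letter a # u, r) # es)" by (metis prod_inv_inv)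
      then have ds: "cs1 = conj_by [a] (prod_inv es) @ [(a # inv_letter a # u, winv r)]"
        by (simp add: cs1 prod_inv_def conj_by_def)
      \<comment> \<open>The last stem of \<open>cs1\<close> starts with \<open>a\<close> and its
        inverse; deleting both keeps the value and shortens the stem.\<close>
      have "prod_val (conj_by [a] (prod_inv es) @ [(u, winv r)]) = prod_val cs1"
        unfolding ds by (simp add: conj_val_def group_simps del: add_uminus_conv_diff)
      from optimalD[OF opt1 _ this] show False
        using optimal_subset[OF opt1] unfolding ds by auto
    qed
  qed
  have "reduced_word (word_of V @ inv_letter a # word_of Z)"
    using V Z by (auto simp: reduced_append_iff reduced_Cons)
  moreover have "val (a # q) = val (a # word_of V @ inv_letter a # word_of Z)"
  proof -
    have "val (a # q) = prod_val cs" by (metis val_word_of word)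
    then show ?thesis by (simp add: W group_simps del: add_uminus_conv_diff)
  qed
  then have "val q = val (word_of V @ inv_letter a # word_of Z)"
    by simp
  moreover have "reduced_word q"
    using reduced_word_of[of "prod_val cs"] word by (simp add: reduced_Cons)
  ultimately have "q = word_of V @ inv_letter a # word_of Z"
    by (metis normal_form_reduced val_eq_iff)
  then show "\<exists>y z i j. q = y @ inv_letter a # z \<and> val y \<in> area_le R i \<and> val z \<in> area_le R j \<and>
      i + j \<le> length cs"
    using V_area Z_area len by (intro exI conjI) (auto simp: cs)
qed

text \<open>Extends \<open>peel_reduced\<close> to words that are not reduced. If \<open>a\<close>
  cancels freely, its partner splits the word with a trivial part in between. Otherwise
  \<open>a\<close> is the first letter of the normal form, and a factorization of the normal form is
  pulled back by \<open>normal_form_split\<close>.\<close>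

lemma peel:
  assumes R: "cyc_closed R" and area: "val (a # w) \<in> area_le R n"
  shows "(\<exists>s. a # s \<in> R \<and> n > 0 \<and> val (winv s @ w) \<in> area_le R (n - 1)) \<or>
         (\<exists>y z i j. w = y @ inv_letter a # z \<and> val y \<in> area_le R i \<and> val z \<in> area_le R j \<and>
            i + j \<le> n)"
proof (cases "normal_form w \<noteq> [] \<and> hd (normal_form w) = inv_letter a")
  case True
  then have "normal_form w = [] @ inv_letter a # tl (normal_form w)"
    by (cases "normal_form w") auto
  from normal_form_split[OF this] obtain y z where yz: "w = y @ inv_letter a # z" "val y = 0"
    by (auto simp: val_eq_0_iff)
  then have "val z \<in> area_le R n" using area by simp
  then show ?thesis using yz by (intro disjI2 exI[of _ y] exI[of _ z] exI[of _ 0] exI[of _ n]) simp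
next
  case False
  obtain cs where cs: "optimal R cs" "prod_val cs = val (a # w)" "length cs \<le> n"
    using optimal_exists[OF area] by blast
  have word: "word_of (prod_val cs) = a # normal_form w"
    using False unfolding cs(2) word_of_val by (auto simp: normal_form_Cons cons_reduce_def)
  then have "cs \<noteq> []" by auto
  then have n: "0 < n" "length cs - 1 \<le> n - 1" using cs(3) by (cases cs; force)+
  from peel_reduced[OF R cs(1) word] show ?thesis
  proof (elim disjE exE conjE)
    fix s assume s: "a # s \<in> R" "- val (a # s) + prod_val cs \<in> area_le R (length cs - 1)"
    have "val (winv s @ w) = - val (a # s) + prod_val cs"
      by (simp add: cs(2) group_simps del: add_uminus_conv_diff)
    then show ?thesis using s n area_le_mono by (metis One_nat_def)
  next
    fix y z i j assume yz: "normal_form w = y @ inv_letter a # z" "val y \<in> area_le R i"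
      "val z \<in> area_le R j" "i + j \<le> length cs"
    from normal_form_split[OF yz(1)] obtain u v where
      uv: "w = u @ inv_letter a # v" "normal_form u = y" "normal_form v = z" by blast
    have "val u = val y" "val v = val z"
      using uv by (auto simp: val_eq_iff normal_form_reduced)
    then show ?thesis using uv yz cs(3)
      by (intro disjI2 exI[of _ u] exI[of _ v] exI[of _ i] exI[of _ j]) auto
  qed
qed

section \<open>Leftmost expansions\<close>

text \<open>A token is a letter of a relator, or of the word under consideration, together with the place
  it comes from: \<open>(i, r)\<close> with \<open>i > 0\<close> stands for the first letter of the cyclic
  conjugate \<open>r\<close> of the relator that was used in the \<open>i\<close>-th expansion, and \<open>(0, [a])\<close> for a
  letter \<open>a\<close> of the original word.\<close>

type_synonym 'a token = "nat \<times> 'a letter list"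

definition lab :: "'a token \<Rightarrow> 'a letter" where
  "lab t = hd (snd t)"

definition face :: "nat \<Rightarrow> 'a letter list \<Rightarrow> nat \<Rightarrow> 'a token list" where
  "face i r n = map (\<lambda>m. (i, rotate m r)) [0..<n]"

definition tval :: "'a token list \<Rightarrow> 'a fgroup" where
  "tval q = val (map lab q)"

definition sval :: "(nat \<times> 'a token) list \<Rightarrow> 'a fgroup" where
  "sval f = tval (map snd f)"

lemma tval_simps [simp]:
  "tval [] = 0" "tval (t # q) = gen (lab t) + tval q" "tval (p @ q) = tval p + tval q"
  by (simp_all add: tval_def)

lemma sval_simps [simp]:
  "sval [] = 0" "sval (x # f) = gen (lab (snd x)) + sval f" "sval (f @ g) = sval f + sval g"
  by (simp_all add: sval_def)

lemma length_face [simp]: "length (face i r n) = n"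
  by (simp add: face_def)

lemma map_lab_face: "n \<le> length r \<Longrightarrow> map lab (face i r n) = take n r"
proof (rule nth_equalityI)
  fix m assume "n \<le> length r" "m < length (map lab (face i r n))"
  then have "m < length r" "r \<noteq> []" "m < n" by auto
  then show "map lab (face i r n) ! m = take n r ! m"
    by (simp add: face_def lab_def hd_rotate_conv_nth)
qed auto

text \<open>The letters of a queue are read from left to right. A letter \<open>a\<close> is either shifted, or it is
  expanded to \<open>s\<inverse>\<close> for a relator \<open>a s\<close>; then the conjugate of \<open>a s\<close> by the value \<open>h\<close> of the
  shifted letters is recorded. A shifted letter keeps the number \<open>j\<close> of preceding expansions.\<close>

inductive run :: "'a letter list set \<Rightarrow> nat \<Rightarrow> 'a fgroup \<Rightarrow> 'a token list \<Rightarrow> 'a fgroup list \<Rightarrow>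
    (nat \<times> 'a token) list \<Rightarrow> bool" for R where
  run_Nil: "run R j h [] [] []"
| run_shift: "run R j (h + gen (lab t)) q cs f \<Longrightarrow> run R j h (t # q) cs ((j, t) # f)"
| run_expand: "lab t # s \<in> R \<Longrightarrow>
    run R (Suc j) h (face (Suc j) (winv (lab t # s)) (length s) @ q) cs f \<Longrightarrow>
    run R j h (t # q) ((h + val (lab t # s) - h) # cs) f"

lemma run_append:
  assumes "run R j h p cs f" "run R (j + length cs) (h + sval f) q ds g"
  shows "run R j h (p @ q) (cs @ ds) (f @ g)"
  using assms
proof (induction rule: run.induct)
  case (run_shift j h t p cs f)
  then show ?case using run.run_shift[of R j h t "p @ q" "cs @ ds" "f @ g"] by (simp add: add.assoc)
next
  case (run_expand t s j h p cs f)
  then show ?case using run.run_expand[of t s R j h "p @ q" "cs @ ds" "f @ g"] by simp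
qed simp

text \<open>The word \<open>winv (a # s)\<close> ends with the inverse of \<open>a\<close>; the face
  stops one letter earlier and so spells the inverse of \<open>s\<close>.\<close>

lemma tval_expansion: "tval (face i (winv (a # s)) (length s)) = - val s"
  by (simp add: tval_def map_lab_face winv_Cons)

text \<open>Each expansion removes the recorded conjugate from the left of the remaining value, and
  the factors telescope. For \<open>h = 0\<close> and freely trivial \<open>f\<close>, the recorded
  conjugates multiply to the value of the queue.\<close>

lemma run_sum: "run R j h q cs f \<Longrightarrow> h + tval q = sum_list cs + (h + sval f)"
proof (induction rule: run.induct)
  case (run_expand t s j h q cs f)
  have "h + tval (t # q) = (h + val (lab t # s) - h) + (h + (- val s + tval q))"
    by (simp add: group_simps del: add_uminus_conv_diff)
  also have "h + (- val s + tval q) = sum_list cs + (h + sval f)"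
    using run_expand.IH by (simp add: tval_expansion)
  finally show ?case by (simp add: add.assoc)
qed (simp_all add: add.assoc)

lemma run_area: "run R j h q cs f \<Longrightarrow> c \<in> set cs \<Longrightarrow> c \<in> area_le R 1"
  by (induction rule: run.induct) (auto intro: area_le_conj area_le_1 simp del: val_Cons One_nat_def)

lemma sum_list_area: "set cs \<subseteq> area_le R 1 \<Longrightarrow> sum_list cs \<in> area_le R (length cs)"
proof (induction cs)
  case (Cons c cs)
  then show ?case using area_le_add[of c R 1 "sum_list cs" "length cs"] by simp
qed simp

text \<open>An expansion trades one letter for \<open>length s\<close> letters, a gain of at least
  \<open>d - 2\<close>; the inequality is arranged to avoid subtraction.\<close>

lemma run_length:
  assumes "run R j h q cs f" "\<And>r. r \<in> R \<Longrightarrow> d \<le> length r"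
  shows "length q + d * length cs \<le> length f + 2 * length cs"
  using assms
proof (induction rule: run.induct)
  case (run_expand t s j h q cs f)
  have "d \<le> Suc (length s)" using run_expand.prems[OF run_expand.hyps(1)] by simp
  with run_expand.IH[OF run_expand.prems] show ?case by simp
qed simp_all

section \<open>Runs that end in a freely trivial word\<close>

inductive dyck :: "(nat \<times> 'a token) list \<Rightarrow> bool" where
  dyck_Nil: "dyck []"
| dyck_Cons: "lab (snd y) = inv_letter (lab (snd x)) \<Longrightarrow> dyck f \<Longrightarrow> dyck g \<Longrightarrow> dyck (x # f @ y # g)"

lemma sval_dyck: "dyck f \<Longrightarrow> sval f = 0"
  by (induction rule: dyck.induct) simp_all

text \<open>\<open>peel\<close> decides what happens to the first letter. Either it is expanded,
  which lowers the area, or it is shifted and gets a partner, which leaves two shorter queues that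
  share the area. Hence the lexicographic induction on area and length.\<close>

theorem run_exists:
  assumes R: "cyc_closed R" and area: "tval q \<in> area_le R n"
  shows "\<exists>cs f. run R j h q cs f \<and> dyck f \<and> length cs \<le> n"
  using area
proof (induction "(n, length q)" arbitrary: n q j h
    rule: wf_induct_rule[OF wf_lex_prod[OF wf_less_than wf_less_than]])
  case 1
  note IH = 1(1)
  show ?case
  proof (cases q)
    case Nil
    then show ?thesis using run_Nil dyck_Nil by force
  next
    case (Cons t q')
    then have "val (lab t # map lab q') \<in> area_le R n" using 1(2) by (simp add: tval_def)
    from peel[OF R this] show ?thesis
    proof (elim disjE exE conjE)
      fix s assume s: "lab t # s \<in> R" "n > 0" "val (winv s @ map lab q') \<in> area_le R (n - 1)"
      let ?q = "face (Suc j) (winv (lab t # s)) (length s) @ q'"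
      have "tval ?q \<in> area_le R (n - 1)"
        using s(3) by (simp add: tval_expansion tval_def[of q'])
      with IH[of "n - 1" ?q "Suc j" h] s(2) obtain cs f where
        "run R (Suc j) h ?q cs f" "dyck f" "length cs \<le> n - 1" by auto
      with s(1,2) Cons show ?thesis by (intro exI conjI) (auto intro: run_expand)
    next
      fix y z m k
      assume yz: "map lab q' = y @ inv_letter (lab t) # z" "val y \<in> area_le R m"
        "val z \<in> area_le R k" "m + k \<le> n"
      then obtain p t' p' where q': "q' = p @ t' # p'" "map lab p = y" "lab t' = inv_letter (lab t)"
          "map lab p' = z"
        by (auto simp: map_eq_append_conv map_eq_Cons_conv)
      have *: "((m, length p), (n, length q)) \<in> less_than <*lex*> less_than"
        "((k, length p'), (n, length q)) \<in> less_than <*lex*> less_than"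
        using yz(4) Cons q'(1) by auto
      obtain cs f where cs: "run R j (h + gen (lab t)) p cs f" "dyck f" "length cs \<le> m"
        using IH[OF *(1)] yz(2) q'(2) by (metis tval_def)
      obtain ds g where ds: "run R (j + length cs) h p' ds g" "dyck g" "length ds \<le> k"
        using IH[OF *(2)] yz(3) q'(4) by (metis tval_def)
      \<comment> \<open>The part between \<open>t\<close> and its partner \<open>t'\<close> has
        value zero, so after \<open>t'\<close> the value of the shifted letters is \<open>h\<close>
        again.\<close>
      have "run R (j + length cs) (h + gen (lab t) + sval f) (t' # p') ds ((j + length cs, t') # g)"
        by (rule run_shift) (use ds(1) q'(3) in \<open>simp add: sval_dyck[OF cs(2)] add.assoc\<close>)
      from run_append[OF cs(1) this]
      have "run R j h q (cs @ ds) ((j, t) # f @ (j + length cs, t') # g)"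
        using run_shift by (simp add: Cons q'(1))
      moreover have "dyck ((j, t) # f @ (j + length cs, t') # g)"
        by (rule dyck_Cons) (use cs ds q' in auto)
      ultimately show ?thesis using cs(3) ds(3) yz(4) by (intro exI conjI) auto
    qed
  qed
qed

text \<open>Rotating the relator of the \<open>i\<close>-th expansion to one of its letters, and moving the recorded
  conjugate \<open>c\<^sub>i\<close> past those recorded until this letter is shifted, replaces \<open>c\<^sub>i\<close> by the conjugate
  of the inverse of the rotated relator by the value \<open>h\<close> at this letter.\<close>

definition transported :: "'a fgroup list \<Rightarrow> nat \<Rightarrow> nat \<Rightarrow> 'a fgroup \<Rightarrow> bool" where
  "transported cs i j e \<longleftrightarrow> 0 < i \<and> i \<le> j \<and> j \<le> length cs \<and>
     cs ! (i - 1) + sum_list (take (j - i) (drop i cs)) = sum_list (take (j - i) (drop i cs)) - e"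

lemma transported_append:
  assumes "transported cs i (length cs) e" shows "transported (cs @ ds) i (length cs) e"
  using assms by (auto simp: transported_def nth_append)

text \<open>An expansion recording \<open>c\<close> multiplies the value in front of every letter
  waiting further right by the inverse of \<open>c\<close> from the left. Conjugating
  \<open>e\<close> keeps pace with this.\<close>

lemma transported_snoc:
  assumes "transported cs i (length cs) e"
  shows "transported (cs @ [c]) i (Suc (length cs)) (- c + e + c)"
proof -
  have i: "0 < i" "i \<le> length cs" and eq: "cs ! (i - 1) + sum_list (drop i cs) = sum_list (drop i cs) - e"
    using assms by (auto simp: transported_def)
  have "cs ! (i - 1) + (sum_list (drop i cs) + c) = (sum_list (drop i cs) + c) - (- c + e + c)"
    unfolding add.assoc[symmetric] eq by (simp add: group_simps del: add_uminus_conv_diff)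
  moreover have "i - 1 < length cs" using i by linarith
  ultimately show ?thesis using i by (simp add: transported_def nth_append)
qed

lemma face_split:
  assumes "face i r n = x @ t # y"
  shows "t = (i, rotate (length x) r)" "x = face i r (length x)" "length x < n"
proof -
  have len: "n = length x + Suc (length y)"
    using arg_cong[OF assms, of length] by simp
  then show "length x < n" by simp
  have "face i r n ! length x = t" by (simp add: assms)
  then show "t = (i, rotate (length x) r)" using len by (simp add: face_def del: upt_Suc)
  have "take (length x) (face i r n) = x" by (simp add: assms)
  then show "x = face i r (length x)" using len by (simp add: face_def take_map del: upt_Suc)
qed

text \<open>The assumption on \<open>q\<close> is the invariant: relator letters waiting in the
  queue are transported to the current moment. It holds at once for the letters of a new face,
  because rotating the relator is undone by conjugating with the letters rotated away, and
  \<open>transported_snoc\<close> maintains it for the letters behind.\<close>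

lemma run_transported:
  assumes "run R j h q cs f" "length ds = j"
    "\<And>x t y. q = x @ t # y \<Longrightarrow> 0 < fst t \<Longrightarrow>
       transported ds (fst t) j (h + tval x + val (snd t) - (h + tval x))"
    "f = x @ (k, t) # y" "0 < fst t"
  shows "transported (ds @ cs) (fst t) k (h + sval x + val (snd t) - (h + sval x))"
  using assms
proof (induction arbitrary: ds x rule: run.induct)
  case (run_shift j h t' q cs f)
  show ?case
  proof (cases x)
    case Nil
    then have "k = j" "t' = t" using run_shift.prems by auto
    with Nil run_shift.prems(1) run_shift.prems(2)[of "[]" t q] run_shift.prems(4) show ?thesis
      using transported_append by fastforce
  next
    case (Cons x1 x')
    then have x: "x1 = (j, t')" "f = x' @ (k, t) # y" using run_shift.prems by auto
    have "transported (ds @ cs) (fst t) k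
      (h + gen (lab t') + sval x' + val (snd t) - (h + gen (lab t') + sval x'))"
    proof (rule run_shift.IH[OF run_shift.prems(1) _ x(2) run_shift.prems(4)])
      fix z u w assume "q = z @ u # w" "0 < fst u"
      then show "transported ds (fst u) j
          (h + gen (lab t') + tval z + val (snd u) - (h + gen (lab t') + tval z))"
        using run_shift.prems(2)[of "t' # z" u w] by (simp add: add.assoc)
    qed
    then show ?thesis by (simp add: Cons x(1) add.assoc)
  qed
next
  case (run_expand t' s j h q cs f)
  let ?r = "winv (lab t' # s)"
  let ?c = "h + val (lab t' # s) - h"
  have "transported ((ds @ [?c]) @ cs) (fst t) k (h + sval x + val (snd t) - (h + sval x))"
  proof (rule run_expand.IH[OF _ _ run_expand.prems(3,4)])
    show "length (ds @ [?c]) = Suc j" using run_expand.prems(1) by simp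
    fix z u w assume split: "face (Suc j) ?r (length s) @ q = z @ u # w" and u: "0 < fst u"
    from append_eq_split[OF split]
    show "transported (ds @ [?c]) (fst u) (Suc j) (h + tval z + val (snd u) - (h + tval z))"
    proof (elim disjE exE conjE)
      fix w' assume w': "face (Suc j) ?r (length s) = z @ u # w'"
      note face = face_split[OF w']
      have r: "?r = take (length z) ?r @ drop (length z) ?r" by simp
      have "tval z = val (take (length z) ?r)"
        using face(2,3) by (simp add: tval_def) (metis map_lab_face length_winv length_Cons
            less_imp_le less_SucI)
      moreover have "snd u = drop (length z) ?r @ take (length z) ?r"
        using face(1,3) by (simp add: rotate_drop_take)
      moreover have "val (lab t' # s) = - val (drop (length z) ?r) - val (take (length z) ?r)"
      proof -
        have "val (lab t' # s) = - val ?r" by (simp only: val_winv minus_minus)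
        also have "val ?r = val (take (length z) ?r) + val (drop (length z) ?r)"
          by (metis append_take_drop_id val_append)
        finally show ?thesis by (simp add: group_simps del: add_uminus_conv_diff)
      qed
      ultimately have "?c = - (h + tval z + val (snd u) - (h + tval z))"
        by (simp add: group_simps del: add_uminus_conv_diff val_Cons)
      then show ?thesis
        using face(1) run_expand.prems(1) by (simp add: transported_def nth_append del: val_Cons)
    next
      fix z' assume z': "z = face (Suc j) ?r (length s) @ z'" "q = z' @ u # w"
      have "transported ds (fst u) j
        (h + tval (t' # z') + val (snd u) - (h + tval (t' # z')))"
        using run_expand.prems(2)[of "t' # z'" u w] z'(2) u by simp
      from transported_snoc[of ds, unfolded run_expand.prems(1), OF this, of ?c]
      show ?thesis
        by (simp add: z'(1) tval_expansion group_simps del: add_uminus_conv_diff)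
    qed
  qed
  then show ?case by simp
qed simp

lemma run_tokens:
  assumes "run R j h q cs f" "(k, t) \<in> set f"
  shows "j \<le> k \<and> (t \<in> set q \<or> j < fst t)"
  using assms
proof (induction rule: run.induct)
  case (run_expand t' s j h q cs f)
  have "u \<in> set (face (Suc j) r n) \<Longrightarrow> fst u = Suc j" for u :: "'a token" and r n
    by (auto simp: face_def)
  with run_expand show ?case by fastforce
qed auto

text \<open>New faces are put in front of the queue, so face numbers never increase to the right. A
  letter shifted later therefore belongs to a face that is not newer, or to one created after the
  earlier letter was shifted. Thus the time intervals from creation to shift are nested or disjoint
  for the pairs treated in \<open>transported_cancel\<close>.\<close>

lemma run_order:
  assumes "run R j h q cs f" "sorted_wrt (\<lambda>t u. fst u \<le> fst t) q" "\<forall>t\<in>set q. fst t \<le> j"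
  shows "sorted_wrt (\<lambda>x y. fst x \<le> fst y \<and> (fst (snd y) \<le> fst (snd x) \<or> fst x < fst (snd y))) f"
  using assms
proof (induction rule: run.induct)
  case (run_shift j h t q cs f)
  then show ?case using run_tokens[OF run_shift.hyps(1)] by fastforce
next
  case (run_expand t s j h q cs f)
  show ?case
    by (rule run_expand.IH) (use run_expand.prems in \<open>auto simp: sorted_wrt_append face_def
          sorted_wrt_map less_imp_le le_SucI intro!: sorted_wrt_mono_rel[OF _ sorted_wrt_upt]\<close>)
qed simp

text \<open>\<open>w\<close> assigns a relator to each face number. Expansions redefine it at new
  numbers only, which is the clause about \<open>i \<le> j\<close>. It serves to show that no face
  cancels against itself.\<close>

lemma run_same_face:
  assumes "run R j h q cs f"
    "\<forall>t\<in>set q. fst t \<le> j \<and> (0 < fst t \<longrightarrow> (\<exists>m. snd t = rotate m (w (fst t))))"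
  shows "\<exists>w'. (\<forall>i\<le>j. w' i = w i) \<and>
    (\<forall>(k, t)\<in>set f. 0 < fst t \<longrightarrow> (\<exists>m. snd t = rotate m (w' (fst t))))"
  using assms
proof (induction arbitrary: w rule: run.induct)
  case (run_shift j h t q cs f)
  from run_shift.IH[of w] run_shift.prems obtain w' where "\<forall>i\<le>j. w' i = w i"
    "\<forall>(k, t)\<in>set f. 0 < fst t \<longrightarrow> (\<exists>m. snd t = rotate m (w' (fst t)))"
    by auto
  then show ?case using run_shift.prems by (intro exI[of _ w']) auto
next
  case (run_expand t s j h q cs f)
  define v where "v = w(Suc j := winv (lab t # s))"
  have "\<forall>t\<in>set (face (Suc j) (winv (lab t # s)) (length s) @ q).
      fst t \<le> Suc j \<and> (0 < fst t \<longrightarrow> (\<exists>m. snd t = rotate m (v (fst t))))"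
    using run_expand.prems by (auto simp: face_def v_def)
  from run_expand.IH[OF this] obtain w' where "\<forall>i\<le>Suc j. w' i = v i"
    "\<forall>(k, t)\<in>set f. 0 < fst t \<longrightarrow> (\<exists>m. snd t = rotate m (w' (fst t)))" by blast
  moreover from this(1) have "\<forall>i\<le>j. w' i = w i" by (simp add: v_def)
  ultimately show ?case by blast
next
  case (run_Nil j h)
  then show ?case by (intro exI[of _ w]) simp
qed

lemma run_relators:
  assumes "run R j h q cs f" "cyc_closed R" "\<forall>t\<in>set q. 0 < fst t \<longrightarrow> snd t \<in> R" "x \<in> set f"
    "0 < fst (snd x)"
  shows "snd (snd x) \<in> R"
  using assms
proof (induction rule: run.induct)
  case (run_expand t s j h q cs f)
  have "winv (lab t # s) \<in> R" using run_expand.hyps(1) assms(2) by (auto simp: cyc_closed_def)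
  then have "\<forall>u\<in>set (face (Suc j) (winv (lab t # s)) (length s)). snd u \<in> R"
    by (auto simp: face_def intro: cyc_closed_rotate[OF assms(2)])
  then show ?case using run_expand by auto
qed auto

section \<open>Counting blocks\<close>

definition contig :: "'a token \<Rightarrow> 'a token \<Rightarrow> bool" where
  "contig t u \<longleftrightarrow> 0 < fst t \<and> fst u = fst t \<and> snd u = rotate1 (snd t)"

fun segs :: "'a token list \<Rightarrow> nat" where
  "segs [] = 0"
| "segs [t] = 1"
| "segs (t # u # q) = (if contig t u then 0 else 1) + segs (u # q)"

lemma segs_Cons: "segs (t # q) = (if q \<noteq> [] \<and> contig t (hd q) then 0 else 1) + segs q"
  by (cases q) auto

lemma segs_append:
  "p \<noteq> [] \<Longrightarrow> q \<noteq> [] \<Longrightarrow>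
     segs (p @ q) + of_bool (contig (last p) (hd q)) = segs p + segs q"
  by (induction p) (auto simp: segs_Cons)

lemma segs_append_le: "segs (p @ q) \<le> segs p + segs q"
  using segs_append[of p q] by (cases "p = []"; cases "q = []") auto

lemma segs_append_ge: "segs p + segs q \<le> Suc (segs (p @ q))"
  using segs_append[of p q]
  by (cases "p = []"; cases "q = []") (auto simp: of_bool_def split: if_splits)

lemma segs_le_Cons: "segs q \<le> segs (t # q)" "segs (t # q) \<le> Suc (segs q)"
  by (auto simp: segs_Cons)

lemma segs_le_length: "segs q \<le> length q"
  by (induction q) (auto simp: segs_Cons)

lemma segs_face: "segs (face (Suc i) r n) \<le> 1"
proof (induction n)
  case (Suc n)
  show ?case
  proof (cases n)
    case 0
    then show ?thesis by (simp add: face_def)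
  next
    case (Suc m)
    have "contig (last (face (Suc i) r n)) (Suc i, rotate n r)"
      by (simp add: face_def contig_def Suc)
    moreover have "face (Suc i) r (Suc n) = face (Suc i) r n @ [(Suc i, rotate n r)]"
      by (simp add: face_def)
    moreover have "face (Suc i) r n \<noteq> []" using Suc by (simp add: face_def)
    ultimately show ?thesis
      using segs_append[of "face (Suc i) r n" "[(Suc i, rotate n r)]"] Suc.IH by simp
  qed
qed (simp add: face_def)

text \<open>An expansion can create two blocks: the new face, and a cut in the block to its left
  that has lost its continuation. The cut is paid for only when the letter to the left is shifted,
  so the induction records whether the first letter of the queue was kept. If it was not, one unit
  is still in reserve, whence the strict inequality.\<close>

lemma run_segs:
  assumes "run R j h q cs f"
  shows "q = [] \<and> f = [] \<or>
    q \<noteq> [] \<and> f \<noteq> [] \<and> snd (hd f) = hd q \<and> segs (map snd f) \<le> segs q + 2 * length cs \<or>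
    segs (map snd f) < segs q + 2 * length cs"
  using assms
proof (induction rule: run.induct)
  case (run_shift j h t q cs f)
  have "segs (t # map snd f) \<le> segs (t # q) + 2 * length cs"
    using run_shift.IH
  proof (elim disjE conjE)
    assume "q \<noteq> []" "f \<noteq> []" "snd (hd f) = hd q" "segs (map snd f) \<le> segs q + 2 * length cs"
    then show ?thesis by (simp add: segs_Cons hd_map)
  next
    assume "segs (map snd f) < segs q + 2 * length cs"
    then show ?thesis
      using segs_le_Cons(1)[where q = q and t = t] segs_le_Cons(2)[where q = "map snd f" and t = t]
      by linarith
  qed simp
  then show ?case by simp
next
  case (run_expand t s j h q cs f)
  let ?q = "face (Suc j) (winv (lab t # s)) (length s)"
  have "segs (?q @ q) \<le> 1 + segs (t # q)"
    using segs_append_le[of ?q q] segs_face[of j "winv (lab t # s)" "length s"] segs_le_Cons[where q = q and t = t]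
    by linarith
  moreover have "segs (map snd f) \<le> segs (?q @ q) + 2 * length cs"
    using run_expand.IH by (elim disjE conjE) simp_all
  ultimately show ?case by simp
qed simp

text \<open>\<open>pile d x y f\<close>: a block of \<open>d\<close> letters of one relator at the beginning of \<open>f\<close>, starting with
  \<open>x\<close>, is cancelled by a block of \<open>d\<close> letters of one relator at the end of \<open>f\<close>, ending with \<open>y\<close>.\<close>

inductive pile :: "nat \<Rightarrow> nat \<times> 'a token \<Rightarrow> nat \<times> 'a token \<Rightarrow> (nat \<times> 'a token) list \<Rightarrow> bool" where
  pile_1: "lab (snd y) = inv_letter (lab (snd x)) \<Longrightarrow> dyck f \<Longrightarrow> pile (Suc 0) x y (x # f @ [y])"
| pile_Suc: "pile d x' y' f \<Longrightarrow> contig (snd x) (snd x') \<Longrightarrow> contig (snd y') (snd y) \<Longrightarrow>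
    lab (snd y) = inv_letter (lab (snd x)) \<Longrightarrow> pile (Suc d) x y (x # f @ [y])"

lemma pile_interior:
  "pile d x y f \<Longrightarrow> \<exists>g. f = x # g @ [y] \<and> dyck g \<and> lab (snd y) = inv_letter (lab (snd x))"
proof (induction rule: pile.induct)
  case (pile_Suc d x' y' f x y)
  then obtain g where "f = x' # g @ [y']" "dyck g" "lab (snd y') = inv_letter (lab (snd x'))"
    by blast
  then have "dyck f" using dyck_Cons[of y' x' g "[]"] dyck_Nil by simp
  then show ?case using pile_Suc by blast
qed auto

text \<open>With blocks as vertices and piles as edges, this is the bound 2 s - 3 for the edges of
  an outerplanar graph with s vertices, each edge standing for at most 2 b letters. \<open>S\<close>
  leaves out one edge, the outermost pile, whose 2 d letters are kept apart so that it can still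
  grow. The integers are used because \<open>S\<close> is negative for the empty word.\<close>

lemma dyck_bound_aux:
  fixes b :: nat
  assumes "dyck f" "1 \<le> b"
    "\<And>p g s x y. f = p @ g @ s \<Longrightarrow> \<not> pile (Suc b) x y g"
    "\<And>x y. x \<in> set f \<Longrightarrow> y \<in> set f \<Longrightarrow> contig (snd x) (snd y) \<Longrightarrow>
       lab (snd y) \<noteq> inv_letter (lab (snd x))"
  defines "S \<equiv> \<lambda>f :: (nat \<times> 'a token) list. 2 * int b * (2 * int (segs (map snd f)) - 4)"
  shows "f = [] \<or> (\<exists>d x y. pile d x y f \<and> 1 \<le> d \<and> d \<le> b \<and> int (length f) \<le> S f + 2 * int d) \<or>
    int (length f) \<le> S f"
  using assms(1,3,4)
proof (induction rule: dyck.induct)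
  case (dyck_Cons y x f g)
  have S_mono: "S f1 \<le> S f2" if "segs (map snd f1) \<le> segs (map snd f2)" for f1 f2
    unfolding S_def using that by (intro mult_left_mono) auto
  have S_Suc: "S f1 + 4 * int b \<le> S f2" if "segs (map snd f1) < segs (map snd f2)" for f1 f2
  proof -
    have "2 * int b * (2 * int (segs (map snd f1)) - 4 + 2) \<le> S f2"
      unfolding S_def using that by (intro mult_left_mono) auto
    then show ?thesis unfolding S_def by (simp add: algebra_simps)
  qed
  define e where "e = x # f @ [y]"
  have whole: "x # f @ y # g = e @ g" by (simp add: e_def)
  have IHf: "f = [] \<or> (\<exists>d x y. pile d x y f \<and> 1 \<le> d \<and> d \<le> b \<and> int (length f) \<le> S f + 2 * int d) \<or>
    int (length f) \<le> S f"
  proof (rule dyck_Cons.IH(1))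
    fix p g' s x' y' assume "f = p @ g' @ s"
    then show "\<not> pile (Suc b) x' y' g'"
      using dyck_Cons.prems(1)[of "x # p" g' "s @ y # g"] by simp
  qed (use dyck_Cons.prems(2) in auto)
  have IHg: "g = [] \<or> (\<exists>d x y. pile d x y g \<and> 1 \<le> d \<and> d \<le> b \<and> int (length g) \<le> S g + 2 * int d) \<or>
    int (length g) \<le> S g"
  proof (rule dyck_Cons.IH(2))
    fix p g' s x' y' assume "g = p @ g' @ s"
    then show "\<not> pile (Suc b) x' y' g'"
      using dyck_Cons.prems(1)[of "x # f @ y # p" g' s] by simp
  qed (use dyck_Cons.prems(2) in auto)
  have no_pile: "\<not> pile (Suc b) x y e"
    using dyck_Cons.prems(1)[of "[]" e g] whole by simp
  have pile1: "pile 1 x y e" using pile_1[OF dyck_Cons.hyps(1,2)] by (simp add: e_def)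
  have segs_ef: "segs (map snd f) \<le> segs (map snd e)"
    using segs_append_ge[of "map snd f" "[snd y]"]
      segs_le_Cons(1)[where q = "map snd f @ [snd y]" and t = "snd x"]
    by (simp add: e_def)
  have e: "\<exists>d. pile d x y e \<and> 1 \<le> d \<and> d \<le> b \<and> int (length e) \<le> S e + 2 * int d"
  proof (cases "f = []")
    case True
    \<comment> \<open>Neighbours that cancel lie in different blocks, so \<open>e\<close> consists
      of two blocks and \<open>S e\<close> is zero.\<close>
    have "\<not> contig (snd x) (snd y)" using dyck_Cons.prems(2)[of x y] dyck_Cons.hyps(1) by auto
    then have "S e = 0" by (simp add: S_def e_def True)
    then show ?thesis using pile1 assms(2) by (intro exI[of _ 1]) (simp add: e_def True)
  next
    case False
    show ?thesis
    proof (cases "int (length f) \<le> S f")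
      case True
      then show ?thesis using S_mono[OF segs_ef] pile1 assms(2)
        by (intro exI[of _ 1]) (simp add: e_def)
    next
      case nS: False
      with False IHf obtain d x' y' where d: "pile d x' y' f" "1 \<le> d" "d \<le> b"
        "int (length f) \<le> S f + 2 * int d" by blast
      obtain m where m: "f = x' # m @ [y']" using pile_interior[OF d(1)] by blast
      show ?thesis
      proof (cases "contig (snd x) (snd x') \<and> contig (snd y') (snd y)")
        case True
        then have "pile (Suc d) x y e"
          using pile_Suc[OF d(1)] dyck_Cons.hyps(1) by (simp add: e_def)
        moreover from this have "Suc d \<le> b" using no_pile d(3) by (metis le_antisym not_less_eq_eq)
        ultimately show ?thesis
          using d(4) S_mono[OF segs_ef] by (intro exI[of _ "Suc d"]) (simp add: e_def)
      next
        case False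
        \<comment> \<open>If the pile cannot be extended, \<open>x\<close> or \<open>y\<close> forms
          a new block. This raises \<open>S\<close> by 4 b, which absorbs the old pile.\<close>
        have "segs (map snd f) < segs (map snd e)"
        proof -
          have "segs (map snd f @ [snd y]) + of_bool (contig (snd y') (snd y)) = segs (map snd f) + 1"
            using segs_append[of "map snd f" "[snd y]"] m by simp
          moreover have "segs (map snd e) = (if contig (snd x) (snd x') then 0 else 1) +
              segs (map snd f @ [snd y])"
            by (simp add: e_def m)
          ultimately show ?thesis using False
            by (auto simp: of_bool_def split: if_splits)
        qed
        from S_Suc[OF this] show ?thesis
          using pile1 assms(2) d(3,4) by (intro exI[of _ 1]) (simp add: e_def)
      qed
    qed
  qed
  show ?case
  proof (cases "g = []")
    case True
    then show ?thesis using e whole by (metis append_Nil2)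
  next
    case False
    have "int (length g) \<le> S g + 2 * int b" using IHg False by auto
    moreover have "int (length e) \<le> S e + 2 * int b" using e by auto
    \<comment> \<open>Joining merges at most one pair of blocks; the surplus of 4 b pays for the
      outermost piles of both parts.\<close>
    moreover have "S e + S g + 4 * int b \<le> S (e @ g)"
    proof -
      have "segs (map snd e) + segs (map snd g) \<le> segs (map snd (e @ g)) + 1"
        using segs_append_ge[of "map snd e" "map snd g"] by simp
      then have "2 * int b * ((2 * int (segs (map snd e)) - 4) + (2 * int (segs (map snd g)) - 4) + 2)
          \<le> S (e @ g)"
        unfolding S_def by (intro mult_left_mono) auto
      then show ?thesis unfolding S_def by (simp add: algebra_simps)
    qed
    ultimately have "int (length (e @ g)) \<le> S (e @ g)" by simp
    then show ?thesis unfolding whole by blast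
  qed
qed simp

lemma dyck_bound:
  assumes "dyck f" "1 \<le> b"
    "\<And>p g s x y. f = p @ g @ s \<Longrightarrow> \<not> pile (Suc b) x y g"
    "\<And>x y. x \<in> set f \<Longrightarrow> y \<in> set f \<Longrightarrow> contig (snd x) (snd y) \<Longrightarrow>
       lab (snd y) \<noteq> inv_letter (lab (snd x))"
  shows "length f \<le> 4 * b * segs (map snd f)"
proof -
  let ?S = "2 * int b * (2 * int (segs (map snd f)) - 4)"
  have "f = [] \<or> (\<exists>d x y. pile d x y f \<and> 1 \<le> d \<and> d \<le> b \<and> int (length f) \<le> ?S + 2 * int d) \<or>
      int (length f) \<le> ?S"
    by (rule dyck_bound_aux[OF assms])
  then have "f = [] \<or> int (length f) \<le> ?S + 2 * int b" by fastforce
  then have "int (length f) \<le> int (4 * b * segs (map snd f))"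
    by (auto simp: algebra_simps)
  then show ?thesis by linarith
qed

text \<open>The right block is read backwards with inverted letters. \<open>rotate1\<close> moves
  the letter at \<open>y\<close> to the end of its word, so that the inverse starts with the letter
  at \<open>x\<close>. From depth 2 on contiguity is involved, and it holds between relator letters
  only.\<close>

lemma pile_labels:
  assumes "pile d x y f"
    "\<And>z. z \<in> set f \<Longrightarrow> snd (snd z) \<noteq> [] \<and> (0 < fst (snd z) \<longrightarrow> d \<le> length (snd (snd z)))"
  shows "take d (snd (snd x)) = take d (winv (rotate1 (snd (snd y)))) \<and>
     (2 \<le> d \<longrightarrow> 0 < fst (snd x) \<and> 0 < fst (snd y))"
  using assms
proof (induction rule: pile.induct)
  case (pile_1 y x f)
  then have "snd (snd x) \<noteq> []" "snd (snd y) \<noteq> []" by auto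
  then show ?case
    using pile_1.hyps(1) by (cases "snd (snd x)"; cases "snd (snd y)") (auto simp: lab_def winv_Cons)
next
  case (pile_Suc d x' y' f x y)
  obtain m where m: "f = x' # m @ [y']" using pile_interior[OF pile_Suc.hyps(1)] by blast
  have pos: "0 < fst (snd x)" "0 < fst (snd y)" using pile_Suc.hyps by (auto simp: contig_def)
  have IH: "take d (snd (snd x')) = take d (winv (rotate1 (snd (snd y'))))"
    using pile_Suc.IH pile_Suc.prems by fastforce
  obtain a p where x: "snd (snd x) = a # p" "d \<le> length p"
    using pile_Suc.prems[of x] pos by (cases "snd (snd x)") auto
  obtain b q where y: "snd (snd y) = b # q" "d \<le> length q"
    using pile_Suc.prems[of y] pos by (cases "snd (snd y)") auto
  have "take d (p @ [a]) = take d (winv (b # q))"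
    using IH pile_Suc.hyps(2,3) x(1) y(1) by (simp add: contig_def)
  then have "take d p = take d (winv q)" using x(2) y(2) by (simp add: winv_Cons)
  moreover have "a = inv_letter b" using pile_Suc.hyps(4) x(1) y(1) by (simp add: lab_def)
  ultimately show ?case using pos x y by (simp add: winv_Cons)
qed

section \<open>Cancelling a pair of mirror relators\<close>

text \<open>The first hypothesis lets the factor numbered \<open>i\<close> be deleted at the price
  of inserting the inverse of \<open>e\<close> behind factor \<open>j\<close>; the second deletes
  factor \<open>i'\<close> and inserts \<open>e\<close> behind factor \<open>j'\<close>. The two
  insertions conjugate what lies between them, so exactly two factors are lost. As the intervals are
  disjoint or nested, the deletions do not interfere.\<close>

lemma transported_cancel:
  assumes cs: "set cs \<subseteq> area_le R 1" and t: "transported cs i j e" and t': "transported cs i' j' (- e)"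
    and ord: "j \<le> j'" "i \<noteq> i'" "i' \<le> i \<or> j < i'"
  shows "sum_list cs \<in> area_le R (length cs - 2)"
proof -
  define P where "P m = sum_list (take m cs)" for m
  have area: "- P a + P b \<in> area_le R (b - a)" if "a \<le> b" "b \<le> length cs" for a b
  proof -
    have "P b = P a + sum_list (take (b - a) (drop a cs))"
      using that by (simp add: P_def flip: sum_list_append take_add)
    moreover have "sum_list (take (b - a) (drop a cs)) \<in> area_le R (b - a)"
      using sum_list_area[of "take (b - a) (drop a cs)" R] cs that
      by (auto dest!: in_set_takeD in_set_dropD)
    ultimately show ?thesis by (simp add: add.assoc)
  qed
  have area0: "P b \<in> area_le R b" if "b \<le> length cs" for b
    using area[of 0 b] that by (simp add: P_def)
  have trans: "P b = P (a - 1) + (- P a + P b) - x" if "transported cs a b x" for a b x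
  proof -
    from that have ab: "0 < a" "a \<le> b" "b \<le> length cs"
      and eq: "cs ! (a - 1) + sum_list (take (b - a) (drop a cs)) = sum_list (take (b - a) (drop a cs)) - x"
      by (auto simp: transported_def)
    let ?D = "sum_list (take (b - a) (drop a cs))"
    have Pb: "P b = P a + ?D"
      using ab by (simp add: P_def flip: sum_list_append take_add)
    have Pa: "P a = P (a - 1) + cs ! (a - 1)"
      using ab take_Suc_conv_app_nth[of "a - 1" cs] by (simp add: P_def)
    have "P b = P (a - 1) + (cs ! (a - 1) + ?D)" by (simp only: Pb Pa add.assoc)
    then have "P b = P (a - 1) + ?D - x" by (simp only: eq add_diff_eq)
    moreover have "- P a + P b = ?D" by (simp add: Pb)
    ultimately show ?thesis by simp
  qed
  have le: "0 < i" "i \<le> j" "0 < i'" "i' \<le> j'" "j' \<le> length cs"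
    using t t' by (auto simp: transported_def)
  note t = trans[OF t] and t' = trans[OF t']
  have sum: "sum_list cs = P (length cs)" by (simp add: P_def)
  show ?thesis
  proof (cases "j < i'")
    case True
    have "P (length cs) = P (i - 1) + (- P i + P j) +
        (- e + ((- P j + P (i' - 1)) + (- P i' + P j')) + e) + (- P j' + P (length cs))"
    proof -
      have 1: "P (i - 1) + (- P i + P j) = P j + e" by (subst t) (simp add: add.assoc)
      have 2: "P (i' - 1) + (- P i' + P j') + e = P j'"
        using t'[symmetric] by (simp only: diff_minus_eq_add)
      have "P (i - 1) + (- P i + P j) +
        (- e + ((- P j + P (i' - 1)) + (- P i' + P j')) + e) + (- P j' + P (length cs))
        = P (i' - 1) + (- P i' + P j') + e + (- P j' + P (length cs))"
        unfolding 1 by (simp add: add.assoc)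
      then show ?thesis unfolding 2 by simp
    qed
    also have "\<dots> \<in> area_le R ((i - 1) + (j - i) + ((i' - 1 - j) + (j' - i')) + (length cs - j'))"
      using le True ord by (intro area_le_add area_le_conj' area area0) auto
    also have "(i - 1) + (j - i) + ((i' - 1 - j) + (j' - i')) + (length cs - j') = length cs - 2"
      using le True ord by linarith
    finally show ?thesis by (simp add: sum)
  next
    case False
    then have i: "i' < i" using ord by auto
    have "P (length cs) = P (i' - 1) + (- P i' + P (i - 1)) + (- P i + P j) +
        (- e + (- P j + P j') + e) + (- P j' + P (length cs))"
    proof -
      have 1: "P (i - 1) + (- P i + P j) = P j + e" by (subst t) (simp add: add.assoc)
      have 2: "P (i' - 1) + (- P i' + P j') + e = P j'"
        using t'[symmetric] by (simp only: diff_minus_eq_add)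
      have "P (i' - 1) + (- P i' + P (i - 1)) + (- P i + P j) +
        (- e + (- P j + P j') + e) + (- P j' + P (length cs)) =
        P (i' - 1) + (- P i' + (P (i - 1) + (- P i + P j))) +
        (- e + (- P j + P j') + e) + (- P j' + P (length cs))"
        by (simp add: add.assoc)
      also have "\<dots> = P (i' - 1) + (- P i' + P j') + e + (- P j' + P (length cs))"
        unfolding 1 by (simp add: add.assoc)
      finally show ?thesis unfolding 2 by simp
    qed
    also have "\<dots> \<in> area_le R ((i' - 1) + (i - 1 - i') + (j - i) + (j' - j) + (length cs - j'))"
      using le i ord by (intro area_le_add area_le_conj' area area0) auto
    also have "(i' - 1) + (i - 1 - i') + (j - i) + (j' - j) + (length cs - j') = length cs - 2"
      using le i ord by linarith
    finally show ?thesis by (simp add: sum)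
  qed
qed

lemma reduced_winv_eq_self:
  assumes "reduced_word w" "winv w = w" shows "w = []"
  using assms
proof (induction "length w" arbitrary: w rule: less_induct)
  case less
  show ?case
  proof (cases w)
    case (Cons a v)
    show ?thesis
    proof (cases v rule: rev_cases)
      case Nil
      then show ?thesis using less.prems Cons by (simp add: winv_Cons)
    next
      case (snoc m b)
      then have "b = inv_letter a" "winv m = m"
        using less.prems Cons by (auto simp: winv_Cons)
      moreover have "reduced_word m"
        using less.prems(1) Cons snoc by (auto simp: reduced_Cons reduced_append_iff)
      ultimately have "w = [a, inv_letter a]"
        using less.hyps[of m] Cons snoc by simp
      then show ?thesis using less.prems(1) by (simp add: reduced_Cons)
    qed
  qed simp
qed

text \<open>If r = p q and the inverse of r is q p, then p and q are their own inverses. A reduced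
  word with this property is empty: otherwise its two middle letters would cancel, or its middle
  letter would be its own inverse.\<close>

lemma winv_not_rotate:
  assumes "reduced_word r" "r \<noteq> []" shows "winv r \<noteq> rotate m r"
proof
  define l where "l = m mod length r"
  assume "winv r = rotate m r"
  then have "winv (take l r @ drop l r) = drop l r @ take l r"
    by (simp add: rotate_drop_take l_def)
  then have "winv (drop l r) = drop l r \<and> winv (take l r) = take l r"
    unfolding winv_append by (subst (asm) append_eq_append_conv) auto
  moreover have "reduced_word (take l r)" "reduced_word (drop l r)"
    using assms(1) by (metis append_take_drop_id reduced_append1 reduced_append2)+
  ultimately have "take l r = []" "drop l r = []" by (blast intro: reduced_winv_eq_self)+
  then show False using assms(2) by (metis append_take_drop_id append_Nil)
qed

lemma rotate_inverse: "\<exists>l. v = rotate l (rotate m v)"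
proof (cases "v = []")
  case False
  then have "m * length v - m + m = m * length v" by (cases "length v") auto
  then have "rotate (m * length v - m) (rotate m v) = v"
    by (simp only: rotate_rotate rotate_id mod_mult_self2_is_0)
  then show ?thesis by metis
qed simp

lemma cyclically_reduced_contig:
  assumes "cyclically_reduced r" "r \<noteq> []" shows "hd (rotate1 r) \<noteq> inv_letter (hd r)"
proof (cases r)
  case (Cons a s)
  then show ?thesis using assms
    by (cases s) (auto simp: cyclically_reduced_def reduced_Cons)
qed (use assms in simp)

text \<open>The factor 4 L + 10 comes from two estimates of the length of \<open>f\<close>. If no
  pile had depth \<open>k\<close>, \<open>dyck_bound\<close> and \<open>run_segs\<close> would allow
  at most 4 (k - 1) (L + 2 n) letters, while \<open>run_length\<close> demands at least ((4 L + 10)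
  k - 2) n.\<close>

theorem small_cancellation:
  assumes R: "cyc_closed R"
    and len: "\<And>r. r \<in> R \<Longrightarrow> (4 * L + 10) * k \<le> length r"
    and inj: "\<And>r r'. r \<in> R \<Longrightarrow> r' \<in> R \<Longrightarrow> take k r = take k r' \<Longrightarrow> r = r'"
    and k: "2 \<le> k"
    and w: "length w \<le> L" "val w \<in> area_le R n0"
  shows "val w = 0"
proof (rule ccontr)
  assume nz: "val w \<noteq> 0"
  define n where "n = (LEAST n. val w \<in> area_le R n)"
  have n: "val w \<in> area_le R n" unfolding n_def using w(2) by (rule LeastI)
  have least: "n \<le> m" if "val w \<in> area_le R m" for m
    unfolding n_def using that by (rule Least_le)
  have n0: "n \<noteq> 0"
  proof
    assume "n = 0"
    then show False using n nz by (auto simp: area_le_def)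
  qed
  define q where "q = map (\<lambda>a. (0 :: nat, [a])) w"
  have q: "tval q = val w" "length q = length w" "\<And>t. t \<in> set q \<Longrightarrow> fst t = 0 \<and> snd t \<noteq> []"
    by (auto simp: q_def tval_def lab_def comp_def)
  obtain cs f where run: "run R 0 0 q cs f" and f: "dyck f" and cs_le: "length cs \<le> n"
    using run_exists[OF R, of q n 0 0] n q by auto
  have sum: "sum_list cs = val w"
    using run_sum[OF run] by (simp add: q sval_dyck[OF f])
  have cs_area: "set cs \<subseteq> area_le R 1" using run_area[OF run] by blast
  have cs: "length cs = n"
    using least[of "length cs"] sum_list_area[OF cs_area] sum cs_le by simp
  have rel: "snd (snd x) \<in> R" if "x \<in> set f" "0 < fst (snd x)" for x
    using run_relators[OF run R _ that] q by simp
  have ne: "snd (snd x) \<noteq> []" if "x \<in> set f" for x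
  proof (cases "fst (snd x) = 0")
    case True
    have "(fst x, snd x) \<in> set f" using that by simp
    from run_tokens[OF run this] show ?thesis using True q by auto
  next
    case False
    then show ?thesis using rel[OF that] R by (auto simp: cyc_closed_def)
  qed
  have "\<exists>p g s x y. f = p @ g @ s \<and> pile k x y g"
  proof (rule ccontr)
    assume no: "\<not> ?thesis"
    obtain b where b: "k = Suc b" "1 \<le> b" using k by (cases k) auto
    have "length f \<le> 4 * b * segs (map snd f)"
    proof (rule dyck_bound[OF f b(2)])
      fix x y assume xy: "x \<in> set f" "y \<in> set f" "contig (snd x) (snd y)"
      then have "snd (snd x) \<in> R" using rel by (auto simp: contig_def)
      then have "cyclically_reduced (snd (snd x))" using R by (auto simp: cyc_closed_def)
      from cyclically_reduced_contig[OF this ne[OF xy(1)]]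
      show "lab (snd y) \<noteq> inv_letter (lab (snd x))"
        using xy(3) by (simp add: contig_def lab_def)
    qed (use no b in blast)
    also have "\<dots> \<le> 4 * b * (L + 2 * n)"
      using run_segs[OF run] segs_le_length[of q] w(1) q(2) cs by (intro mult_left_mono) auto
    finally have "length w + (4 * L + 10) * k * n \<le> 4 * b * (L + 2 * n) + 2 * n"
      using run_length[OF run len] cs q by simp
    moreover have "4 * b * L \<le> 4 * b * L * n" using n0 by simp
    moreover have "(4 * L + 10) * k * n = 4 * b * L * n + 4 * L * n + 10 * b * n + 10 * n"
      by (simp add: b algebra_simps)
    moreover have "4 * b * (L + 2 * n) = 4 * b * L + 8 * b * n" by (simp add: algebra_simps)
    ultimately show False using n0 by linarith
  qed
  then obtain p g s x y where f_eq: "f = p @ g @ s" and pile: "pile k x y g" by blast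
  obtain m where g: "g = x # m @ [y]" "dyck m" and lab: "lab (snd y) = inv_letter (lab (snd x))"
    using pile_interior[OF pile] by blast
  have kle: "k \<le> length r" if "r \<in> R" for r
    using len[OF that] by (simp add: add_mult_distrib)
  obtain jx i r where x: "x = (jx, i, r)" by (cases x) auto
  obtain jy i' r' where y: "y = (jy, i', r')" by (cases y) auto
  have mem: "x \<in> set f" "y \<in> set f" by (simp_all add: f_eq g)
  have lp: "take k r = take k (winv (rotate1 r')) \<and> 0 < i \<and> 0 < i'"
    using pile_labels[OF pile] k rel ne kle by (force simp: x y f_eq)
  then have rR: "r \<in> R" "r' \<in> R" using rel[OF mem(1)] rel[OF mem(2)] x y by auto
  then have "winv (rotate1 r') \<in> R" using R by (auto simp: cyc_closed_def)
  with lp rR inj have r: "r = winv (rotate1 r')" by blast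
  define h where "h = sval p"
  have tx: "transported cs i jx (h + val r - h)"
    using run_transported[OF run, of "[]" p jx "(i, r)" "m @ y # s"] q lp
    by (simp add: f_eq g x h_def)
  \<comment> \<open>The letters between \<open>x\<close> and \<open>y\<close> have value zero, so
    only the letter of \<open>x\<close> separates the two values. It makes up for the rotation by
    one between \<open>r\<close> and the inverse of \<open>r'\<close>, and the two conjugates become
    inverse to each other.\<close>
  have ty0: "transported cs i' jy (h + gen (lab (snd x)) + val r' - (h + gen (lab (snd x))))"
    using run_transported[OF run, of "[]" "p @ x # m" jy "(i', r')" s] q lp sval_dyck[OF g(2)]
    by (simp add: f_eq g y h_def add.assoc)
  obtain b t where r': "r' = b # t" using ne[OF mem(2)] by (cases r') (auto simp: y)
  have b: "gen b = - gen (lab (snd x))" using lab by (simp add: y lab_def r')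
  have "val r = - gen b - val t" unfolding r r'
    by (simp add: group_simps del: add_uminus_conv_diff)
  then have "h + gen (lab (snd x)) + val r' - (h + gen (lab (snd x))) = - (h + val r - h)"
    by (simp add: r' b group_simps del: add_uminus_conv_diff)
  with ty0 have ty: "transported cs i' jy (- (h + val r - h))" by simp
  have "jx \<le> jy \<and> (i' \<le> i \<or> jx < i')"
  proof -
    have "sorted_wrt (\<lambda>x y. fst x \<le> fst y \<and> (fst (snd y) \<le> fst (snd x) \<or> fst x < fst (snd y))) f"
      by (rule run_order[OF run]) (use q in \<open>auto simp: q_def sorted_wrt_map\<close>)
    then show ?thesis by (auto simp: f_eq g x y sorted_wrt_append)
  qed
  \<comment> \<open>A face folded onto itself would make a relator a rotation of its own
    inverse.\<close>
  moreover have "i \<noteq> i'"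
  proof
    assume "i = i'"
    obtain v where "\<forall>(k, t)\<in>set f. 0 < fst t \<longrightarrow> (\<exists>m. snd t = rotate m (v (fst t)))"
      using run_same_face[OF run, of "\<lambda>_. []"] q by auto
    with mem lp \<open>i = i'\<close> obtain c d where "r = rotate c (v i)" "r' = rotate d (v i)"
      by (fastforce simp: x y)
    then obtain l where "r = rotate l (rotate1 r')"
      using rotate_inverse[of "v i" "Suc d"] by (metis rotate_Suc rotate_rotate)
    then have "winv (rotate1 r') = rotate l (rotate1 r')" using r by simp
    moreover have "reduced_word (rotate1 r')" "rotate1 r' \<noteq> []"
      using R rR(2) by (auto simp: cyc_closed_def cyclically_reduced_def)
    ultimately show False using winv_not_rotate by blast
  qed
  ultimately have "val w \<in> area_le R (n - 2)"
    using transported_cancel[OF cs_area tx ty] sum cs by auto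
  from least[OF this] show False using n0 by simp
qed

section \<open>Rigid Cayley posets\<close>

context group
begin

lemma mult_inv_cancel:
  assumes "x \<in> carrier G" "y \<in> carrier G"
  shows "x \<otimes> (inv x \<otimes> y) = y" "inv x \<otimes> (x \<otimes> y) = y"
  using assms by (simp_all add: m_assoc[symmetric])

text \<open>The number of 4-cycles through the edge from \<open>g\<close> to \<open>g s\<close> in the Cayley poset; it does not
  depend on \<open>g\<close>.\<close>

definition squares :: "'a set \<Rightarrow> 'a \<Rightarrow> nat" where
  "squares S s = card {(t, u). t \<in> S - {s} \<and> u \<in> S - {s} \<and> t \<otimes> inv s \<otimes> u \<in> S}"

lemma mem_l_coset_iff:
  assumes "g \<in> carrier G" "h \<in> carrier G" "S \<subseteq> carrier G"
  shows "h \<in> g <# S \<longleftrightarrow> inv g \<otimes> h \<in> S"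
proof
  assume "h \<in> g <# S"
  then obtain s where "s \<in> S" "h = g \<otimes> s" by (auto simp: l_coset_def)
  then show "inv g \<otimes> h \<in> S" using assms by (auto simp: m_assoc[symmetric] subsetD)
next
  assume *: "inv g \<otimes> h \<in> S"
  have "h = g \<otimes> (inv g \<otimes> h)" using assms by (simp add: m_assoc[symmetric])
  with * show "h \<in> g <# S" by (auto simp: l_coset_def)
qed

definition square_set :: "'a set \<Rightarrow> 'a \<Rightarrow> 'a \<Rightarrow> ('a \<times> 'a) set" where
  "square_set S g h = {(a, b). a \<in> carrier G \<and> b \<in> carrier G \<and> a \<noteq> g \<and> b \<noteq> h \<and>
     h \<in> a <# S \<and> b \<in> g <# S \<and> b \<in> a <# S}"

text \<open>A 4-cycle through g < (g s)' has two further points a and b' with a = g s t^-1 and b = g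
  u; the remaining relation a < b' says that t s^-1 u lies in \<open>S\<close>.\<close>

lemma card_square_set:
  assumes S: "S \<subseteq> carrier G" and g: "g \<in> carrier G" and s: "s \<in> S"
  shows "card (square_set S g (g \<otimes> s)) = squares S s"
proof -
  have sc: "s \<in> carrier G" using S s by auto
  have simps: "inv (g \<otimes> s \<otimes> inv t) \<otimes> (g \<otimes> s) = t"
      "inv (g \<otimes> s \<otimes> inv t) \<otimes> (g \<otimes> u) = t \<otimes> inv s \<otimes> u"
    if "t \<in> carrier G" "u \<in> carrier G" for t u
    using that g sc by (simp_all add: inv_mult_group m_assoc inv_solve_left')
  let ?T = "{(t, u). t \<in> S - {s} \<and> u \<in> S - {s} \<and> t \<otimes> inv s \<otimes> u \<in> S}"
  let ?f = "\<lambda>(t, u). (g \<otimes> s \<otimes> inv t, g \<otimes> u)"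
  let ?f' = "\<lambda>(a, b). (inv a \<otimes> (g \<otimes> s), inv g \<otimes> b)"
  have 1: "?f' (?f (t, u)) = (t, u) \<and> ?f (t, u) \<in> square_set S g (g \<otimes> s)" if tu: "(t, u) \<in> ?T" for t u
  proof -
    have c: "t \<in> carrier G" "u \<in> carrier G" using tu S by auto
    have "t = s" if "g \<otimes> s \<otimes> inv t = g"
      using that c g sc by (metis inv_equality inv_inv inv_closed l_cancel_one m_assoc m_closed)
    then show ?thesis
      using c g sc S tu simps[of t u]
      by (auto simp: square_set_def mem_l_coset_iff m_assoc[symmetric])
  qed
  have 2: "?f (?f' (a, b)) = (a, b) \<and> ?f' (a, b) \<in> ?T"
    if ab: "(a, b) \<in> square_set S g (g \<otimes> s)" for a b
  proof -
    have c: "a \<in> carrier G" "b \<in> carrier G" using ab by (auto simp: square_set_def)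
    have inv_a: "inv (inv a \<otimes> (g \<otimes> s)) = inv (g \<otimes> s) \<otimes> a" using c g sc by (simp add: inv_mult_group)
    have "g \<otimes> s \<otimes> inv (inv a \<otimes> (g \<otimes> s)) = a" "g \<otimes> (inv g \<otimes> b) = b"
      unfolding inv_a using c g sc by (simp_all add: m_assoc[symmetric])
    moreover have "a = g" if "inv a \<otimes> (g \<otimes> s) = s"
    proof -
      have "g \<otimes> s = a \<otimes> s"
        using that c g sc by (metis inv_solve_left m_closed)
      then show ?thesis using c g sc by simp
    qed
    moreover have "b = g \<otimes> s" if "inv g \<otimes> b = s"
      using that c g sc by (metis inv_solve_left)
    moreover have "inv a \<otimes> (g \<otimes> s) \<otimes> inv s \<otimes> (inv g \<otimes> b) = inv a \<otimes> b"
      using c g sc by (simp add: m_assoc mult_inv_cancel)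
    ultimately show ?thesis
      using ab c g sc S by (auto simp: square_set_def mem_l_coset_iff)
  qed
  have "bij_betw ?f ?T (square_set S g (g \<otimes> s))"
  proof (rule bij_betw_byWitness[where f' = ?f'])
    note T = 1[of "fst p" "snd p" for p, unfolded prod.collapse]
    note Q = 2[of "fst p" "snd p" for p, unfolded prod.collapse]
    show "\<forall>p\<in>?T. ?f' (?f p) = p" using T by blast
    show "\<forall>p\<in>square_set S g (g \<otimes> s). ?f (?f' p) = p" using Q by blast
    show "?f ` ?T \<subseteq> square_set S g (g \<otimes> s)"
      by (rule image_subsetI) (erule T[THEN conjunct2])
    show "?f' ` square_set S g (g \<otimes> s) \<subseteq> ?T"
      by (rule image_subsetI) (erule Q[THEN conjunct2])
  qed
  from bij_betw_same_card[OF this] show ?thesis by (simp add: squares_def)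
qed

text \<open>As \<one> \<in> S, every lower point has a point strictly above it, so an automorphism
  preserves the two copies and is a pair of maps \<phi>, \<psi>. The counts give \<psi> (g s) =
  (\<phi> g) s, and s = \<one> identifies the two maps.\<close>

theorem cayley_representation_squares:
  assumes S: "S \<subseteq> carrier G" "\<one> \<in> S" and gen: "generate G S = carrier G"
    and inj: "inj_on (squares S) S"
  shows "is_cayley_representation G S"
  unfolding is_cayley_representation_def
proof
  fix f assume "f \<in> poset_auts (cayley_poset_carrier G) (cayley_poset G S)"
  then have f: "f \<in> extensional (cayley_poset_carrier G)"
    and bij: "bij_betw f (cayley_poset_carrier G) (cayley_poset_carrier G)"
    and iso: "\<And>x y. x \<in> cayley_poset_carrier G \<Longrightarrow> y \<in> cayley_poset_carrier G \<Longrightarrow>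
      (x, y) \<in> cayley_poset G S \<longleftrightarrow> (f x, f y) \<in> cayley_poset G S"
    by (auto simp: poset_auts_def Bij_def)
  have mem: "Inl g \<in> cayley_poset_carrier G" "Inr g \<in> cayley_poset_carrier G"
    if "g \<in> carrier G" for g
    using that by (auto simp: cayley_poset_carrier_def)
  have ex: "\<exists>a b. f (Inl g) = Inl a \<and> f (Inr g) = Inr b \<and> a \<in> carrier G \<and> b \<in> carrier G"
    if g: "g \<in> carrier G" for g
  proof -
    have "(Inl g, Inr g) \<in> cayley_poset G S"
      using S g by (auto simp: cayley_poset_def mem_l_coset_iff)
    then have "(f (Inl g), f (Inr g)) \<in> cayley_poset G S" using iso mem g by blast
    moreover have "f (Inl g) \<noteq> f (Inr g)"
      using bij mem g by (metis bij_betw_imp_inj_on inj_onD sum.distinct(1))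
    ultimately show ?thesis by (auto simp: cayley_poset_def)
  qed
  define \<phi> where "\<phi> g = projl (f (Inl g))" for g
  define \<psi> where "\<psi> g = projr (f (Inr g))" for g
  have \<phi>: "f (Inl g) = Inl (\<phi> g)" "\<phi> g \<in> carrier G" if "g \<in> carrier G" for g
    using ex[OF that] by (auto simp: \<phi>_def)
  have \<psi>: "f (Inr g) = Inr (\<psi> g)" "\<psi> g \<in> carrier G" if "g \<in> carrier G" for g
    using ex[OF that] by (auto simp: \<psi>_def)
  have inj_\<phi>: "inj_on \<phi> (carrier G)"
    by (rule inj_onI) (metis \<phi>(1) bij bij_betw_imp_inj_on inj_onD mem(1) Inl_inject)
  have inj_\<psi>: "inj_on \<psi> (carrier G)"
    by (rule inj_onI) (metis \<psi>(1) bij bij_betw_imp_inj_on inj_onD mem(2) Inr_inject)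
  have surj: "\<exists>g\<in>carrier G. \<phi> g = a" "\<exists>g\<in>carrier G. \<psi> g = a" if a: "a \<in> carrier G" for a
  proof -
    obtain p where p: "p \<in> cayley_poset_carrier G" "f p = Inl a"
      using bij mem(1)[OF a] by (metis bij_betw_imp_surj_on imageE)
    then obtain g where "p = Inl g" "g \<in> carrier G"
      using \<psi> by (auto simp: cayley_poset_carrier_def)
    with p \<phi> show "\<exists>g\<in>carrier G. \<phi> g = a" by force
    obtain p where p: "p \<in> cayley_poset_carrier G" "f p = Inr a"
      using bij mem(2)[OF a] by (metis bij_betw_imp_surj_on imageE)
    then obtain g where "p = Inr g" "g \<in> carrier G"
      using \<phi> by (auto simp: cayley_poset_carrier_def)
    with p \<psi> show "\<exists>g\<in>carrier G. \<psi> g = a" by force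
  qed
  have edge: "h \<in> g <# S \<longleftrightarrow> \<psi> h \<in> \<phi> g <# S" if "g \<in> carrier G" "h \<in> carrier G" for g h
    using iso[OF mem(1)[OF that(1)] mem(2)[OF that(2)]] that \<phi>[OF that(1)] \<psi>[OF that(2)]
    by (auto simp: cayley_poset_def)
  have card_eq: "card (square_set S (\<phi> g) (\<psi> h)) = card (square_set S g h)"
    if gh: "g \<in> carrier G" "h \<in> carrier G" for g h
  proof -
    have "bij_betw (map_prod \<phi> \<psi>) (square_set S g h) (square_set S (\<phi> g) (\<psi> h))"
      unfolding bij_betw_def
    proof
      show "inj_on (map_prod \<phi> \<psi>) (square_set S g h)"
        by (rule inj_on_subset[OF map_prod_inj_on[OF inj_\<phi> inj_\<psi>]]) (auto simp: square_set_def)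
      show "map_prod \<phi> \<psi> ` square_set S g h = square_set S (\<phi> g) (\<psi> h)"
      proof (intro equalityI subsetI)
        fix p assume "p \<in> map_prod \<phi> \<psi> ` square_set S g h"
        then obtain a b where p: "p = (\<phi> a, \<psi> b)" and ab: "(a, b) \<in> square_set S g h" by auto
        then have c: "a \<in> carrier G" "b \<in> carrier G" by (simp_all add: square_set_def)
        have "\<phi> a \<noteq> \<phi> g" "\<psi> b \<noteq> \<psi> h"
          using ab c gh inj_onD[OF inj_\<phi>, of a g] inj_onD[OF inj_\<psi>, of b h]
          by (auto simp: square_set_def)
        then show "p \<in> square_set S (\<phi> g) (\<psi> h)"
          using ab c gh edge[OF c(1) gh(2)] edge[OF gh(1) c(2)] edge[OF c] \<phi>(2) \<psi>(2)
          by (simp add: p square_set_def)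
      next
        fix p assume p: "p \<in> square_set S (\<phi> g) (\<psi> h)"
        then have "fst p \<in> carrier G" "snd p \<in> carrier G" by (auto simp: square_set_def)
        then obtain a b where c: "a \<in> carrier G" "b \<in> carrier G" and ab: "fst p = \<phi> a" "snd p = \<psi> b"
          using surj by metis
        then have p': "p = (\<phi> a, \<psi> b)" by (metis prod.collapse)
        have "(a, b) \<in> square_set S g h"
          using p c gh edge[OF c(1) gh(2)] edge[OF gh(1) c(2)] edge[OF c]
          by (auto simp: p' square_set_def)
        then show "p \<in> map_prod \<phi> \<psi> ` square_set S g h" unfolding p' by force
      qed
    qed
    from bij_betw_same_card[OF this] show ?thesis by simp
  qed
  have \<psi>_mult: "\<psi> (g \<otimes> s) = \<phi> g \<otimes> s" if g: "g \<in> carrier G" and s: "s \<in> S" for g s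
  proof -
    have gs: "g \<otimes> s \<in> carrier G" using g s S by auto
    have "\<psi> (g \<otimes> s) \<in> \<phi> g <# S"
      using edge[OF g gs] s by (auto simp: l_coset_def)
    then obtain s' where s': "s' \<in> S" "\<psi> (g \<otimes> s) = \<phi> g \<otimes> s'" by (auto simp: l_coset_def)
    have "squares S s' = squares S s"
      using card_eq[OF g gs] card_square_set[OF S(1) g s] card_square_set[OF S(1) \<phi>(2)[OF g] s'(1)]
      by (simp add: s'(2))
    then show ?thesis using inj s s' by (auto dest: inj_onD)
  qed
  have \<psi>_eq: "\<psi> g = \<phi> g" if "g \<in> carrier G" for g
    using \<psi>_mult[OF that S(2)] that \<phi>(2)[OF that] by simp
  have "\<forall>g\<in>carrier G. \<phi> (g \<otimes> a) = \<phi> g \<otimes> a" if "a \<in> generate G S" for a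
    using that
  proof (induction rule: generate.induct)
    case (incl h)
    then show ?case using \<psi>_mult \<psi>_eq S by (metis m_closed subsetD)
  next
    case (inv h)
    then have h: "h \<in> carrier G" using S by auto
    show ?case
    proof
      fix g assume g: "g \<in> carrier G"
      have "\<phi> (g \<otimes> inv h \<otimes> h) = \<phi> (g \<otimes> inv h) \<otimes> h"
        using \<psi>_mult[of "g \<otimes> inv h" h] \<psi>_eq[of "g \<otimes> inv h \<otimes> h"] g h inv by auto
      then have "\<phi> g = \<phi> (g \<otimes> inv h) \<otimes> h" using g h by (simp add: m_assoc)
      then show "\<phi> (g \<otimes> inv h) = \<phi> g \<otimes> inv h" using g h \<phi>(2) by (simp add: m_assoc)
    qed
  next
    case (eng h1 h2)
    then have c: "h1 \<in> carrier G" "h2 \<in> carrier G" using generate_in_carrier[OF S(1)] by auto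
    show ?case
    proof
      fix g assume g: "g \<in> carrier G"
      have "\<phi> (g \<otimes> h1 \<otimes> h2) = \<phi> g \<otimes> h1 \<otimes> h2" using eng.IH c g by simp
      then show "\<phi> (g \<otimes> (h1 \<otimes> h2)) = \<phi> g \<otimes> (h1 \<otimes> h2)" using c g \<phi>(2) by (simp add: m_assoc)
    qed
  qed (use \<phi>(2) in auto)
  then have left: "\<phi> a = \<phi> \<one> \<otimes> a" if "a \<in> carrier G" for a
    using that gen by (metis l_one one_closed)
  have "f = left_mult_action G (\<phi> \<one>)"
  proof (rule extensionalityI[OF f])
    show "left_mult_action G (\<phi> \<one>) \<in> extensional (cayley_poset_carrier G)"
      by (simp add: left_mult_action_def)
    fix p assume "p \<in> cayley_poset_carrier G"
    then obtain a where a: "a \<in> carrier G" "p = Inl a \<or> p = Inr a"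
      by (auto simp: cayley_poset_carrier_def)
    then show "f p = left_mult_action G (\<phi> \<one>) p"
      using \<phi>(1)[OF a(1)] \<psi>(1)[OF a(1)] \<psi>_eq[OF a(1)] left[OF a(1)] mem[OF a(1)]
      by (auto simp: left_mult_action_def)
  qed
  then show "f \<in> left_mult_action G ` carrier G" using \<phi>(2) by blast
qed

text \<open>An expression b + c - a with exponents from 0 to 6 lies between -6 and 12 and differs
  from an exponent by at most 12 in absolute value; this gives the first two bounds. Relations with
  two letters y take the form y x^i y = x^j with exponents bounded by 6.\<close>

lemma generate_two_admits:
  assumes x: "x \<in> carrier G" and y: "y \<in> carrier G" and gen: "generate G {x, y} = carrier G"
    and ne1: "\<And>i :: int. i \<noteq> 0 \<Longrightarrow> \<bar>i\<bar> \<le> 12 \<Longrightarrow> x [^] i \<noteq> \<one>"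
    and ne2: "\<And>i :: int. \<bar>i\<bar> \<le> 12 \<Longrightarrow> y \<noteq> x [^] i"
    and ne3: "\<And>(i :: int) (j :: int). \<bar>i\<bar> \<le> 6 \<Longrightarrow> \<bar>j\<bar> \<le> 6 \<Longrightarrow> y \<otimes> x [^] i \<otimes> y \<otimes> x [^] j \<noteq> \<one>"
  shows "admits_cayley_representation G"
proof -
  define A :: "int list" where "A = [0, 1, 2, 4, 6]"
  \<comment> \<open>A list version of \<open>?D\<close>, on which the simplifier can compute the
    counts.\<close>
  let ?L = "\<lambda>a. filter (\<lambda>(b, c). b \<noteq> a \<and> c \<noteq> a \<and> b + c - a \<in> set A) (List.product A A)"
  let ?D = "\<lambda>a. {(b, c). b \<in> set A \<and> c \<in> set A \<and> b \<noteq> a \<and> c \<noteq> a \<and> b + c - a \<in> set A}"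
  define px where "px i = x [^] i" for i :: int
  have px: "px i \<in> carrier G" for i using x by (simp add: px_def)
  have add: "px (i + j) = px i \<otimes> px j" for i j using x by (simp add: px_def int_pow_mult)
  have neg: "inv (px i) = px (- i)" for i using x by (simp add: px_def int_pow_neg)
  have px_inj: "a = b \<or> px a \<noteq> px b \<or> 12 < a - b \<or> 12 < b - a" for a b
    using ne1[of "a - b"] x
    by (cases "\<bar>a - b\<bar> \<le> 12") (auto simp: px_def int_pow_diff)
  have set_A: "set A = {0, 1, 2, 4, 6}" by (simp only: A_def list.set)
  have A: "0 \<le> a \<and> a \<le> 6" if "a \<in> set A" for a
    using that unfolding set_A by fastforce
  define S where "S = insert y (px ` set A)"
  have S: "S \<subseteq> carrier G" using y px by (auto simp: S_def)
  have one: "px 0 = \<one>" by (simp add: px_def)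
  have y_px: "y \<noteq> px i \<or> i < - 12 \<or> 12 < i" for i
    using ne2[of i] by (cases "\<bar>i\<bar> \<le> 12") (auto simp: px_def)
  have y_px_y: "y \<otimes> px i \<otimes> y \<noteq> px j" if "\<bar>i\<bar> \<le> 6" "\<bar>j\<bar> \<le> 6" for i j
  proof
    assume "y \<otimes> px i \<otimes> y = px j"
    then have "y \<otimes> px i \<otimes> y \<otimes> px (- j) = px (j + - j)" unfolding add by simp
    then show False using ne3[of i "- j"] that by (simp add: px_def)
  qed
  then have y_px_y: "y \<otimes> px i \<otimes> y \<noteq> px j \<or> i < - 6 \<or> 6 < i \<or> j < - 6 \<or> 6 < j" for i j
    by (metis abs_le_iff minus_le_iff not_le)
  have y_notin: "y \<notin> px ` set A"
  proof
    assume "y \<in> px ` set A"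
    then obtain a where "y = px a" "a \<in> set A" by blast
    then show False using y_px[of a] A[of a] by auto
  qed
  have A_px: "px i \<in> S \<longleftrightarrow> i \<in> set A" if "- 6 \<le> i" "i \<le> 12" for i
  proof -
    have "px i \<noteq> y" using y_px[of i] that by auto
    moreover have "px i = px a \<longleftrightarrow> i = a" if "a \<in> set A" for a
      using px_inj[of i a] A[OF that] \<open>- 6 \<le> i\<close> \<open>i \<le> 12\<close> by auto
    ultimately show ?thesis by (auto simp: S_def)
  qed
  have sq_x: "squares S (px a) = length (?L a)"
    if a: "a \<in> set A" for a
  proof -
    have sub: "(t, u) \<in> map_prod px px ` (?D a)"
      if tu: "t \<in> S - {px a}" "u \<in> S - {px a}" "t \<otimes> inv (px a) \<otimes> u \<in> S" for t u
    proof -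
      have yS: "y \<otimes> px i \<notin> S" if "i \<noteq> 0" "- 6 \<le> i" "i \<le> 6" for i
      proof
        assume "y \<otimes> px i \<in> S"
        then consider "y \<otimes> px i = y" | b where "b \<in> set A" "y \<otimes> px i = px b" by (auto simp: S_def)
        then show False
        proof cases
          case 1
          then have "px i = \<one>" using y px by simp
          then show False using px_inj[of i 0] that by (simp add: one)
        next
          case 2
          then have "y \<otimes> px i \<otimes> px (- i) = px (b - i)" unfolding diff_conv_add_uminus add by simp
          then have "y = px (b - i)" using y px by (simp add: m_assoc one flip: add)
          then show False using y_px[of "b - i"] A[OF 2(1)] that by auto
        qed
      qed
      have Sy: "px i \<otimes> y \<notin> S" if "i \<noteq> 0" "- 6 \<le> i" "i \<le> 6" for i
      proof
        assume "px i \<otimes> y \<in> S"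
        then consider "px i \<otimes> y = y" | b where "b \<in> set A" "px i \<otimes> y = px b" by (auto simp: S_def)
        then show False
        proof cases
          case 1
          then have "px i = \<one>" using y px by simp
          then show False using px_inj[of i 0] that by (simp add: one)
        next
          case 2
          then have "px (- i) \<otimes> (px i \<otimes> y) = px (- i + b)" unfolding add by simp
          then have "y = px (- i + b)" using y px by (simp add: one flip: add m_assoc)
          then show False using y_px[of "- i + b"] A[OF 2(1)] that by auto
        qed
      qed
      have yy: "y \<otimes> px (- a) \<otimes> y \<notin> S"
      proof
        assume "y \<otimes> px (- a) \<otimes> y \<in> S"
        then consider "y \<otimes> px (- a) \<otimes> y = y" | b where "b \<in> set A" "y \<otimes> px (- a) \<otimes> y = px b"
          by (auto simp: S_def)
        then show False
        proof cases
          case 1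
          then have "y \<otimes> px (- a) = \<one>" using y px by simp
          then have "y = px a" using y px inv_equality[of y "px (- a)"] by (simp add: neg)
          then show False using y_px[of a] A[OF a] by auto
        next
          case 2
          then show False using y_px_y[of "- a" b] A[OF a] A[OF 2(1)] by auto
        qed
      qed
      have t: "t \<noteq> y"
      proof
        assume "t = y"
        show False
        proof (cases "u = y")
          case True
          then show False using tu(3) \<open>t = y\<close> yy by (simp add: neg)
        next
          case False
          then obtain c where c: "u = px c" "c \<in> set A" "c \<noteq> a" using tu(2) by (auto simp: S_def)
          have "y \<otimes> (px (- a) \<otimes> px c) \<in> S"
            using tu(3) \<open>t = y\<close> c(1) y px by (simp add: neg m_assoc)
          then have "y \<otimes> px (- a + c) \<in> S" by (simp only: add)
          then show False using yS[of "- a + c"] A[OF a] A[OF c(2)] c(3) by auto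
        qed
      qed
      then obtain b where b: "t = px b" "b \<in> set A" "b \<noteq> a" using tu(1) by (auto simp: S_def)
      have "u \<noteq> y"
      proof
        assume "u = y"
        then have "px (b + - a) \<otimes> y \<in> S" using tu(3) b(1) by (simp only: neg add)
        then show False using Sy[of "b + - a"] A[OF a] A[OF b(2)] b(3) by auto
      qed
      then obtain c where c: "u = px c" "c \<in> set A" "c \<noteq> a" using tu(2) by (auto simp: S_def)
      have "px (b + - a + c) \<in> S" using tu(3) b(1) c(1) by (simp only: neg add)
      then have "b + - a + c \<in> set A"
        using A_px[of "b + - a + c"] A[OF a] A[OF b(2)] A[OF c(2)] by auto
      then show ?thesis using b c by (auto simp: algebra_simps)
    qed
    have "{(t, u). t \<in> S - {px a} \<and> u \<in> S - {px a} \<and> t \<otimes> inv (px a) \<otimes> u \<in> S} =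
        map_prod px px ` (?D a)"
    proof (intro equalityI subsetI)
      fix p assume "p \<in> map_prod px px ` (?D a)"
      then obtain b c where p: "p = (px b, px c)" "b \<in> set A" "c \<in> set A" "b \<noteq> a" "c \<noteq> a" "b + c - a \<in> set A"
        by auto
      have "px b \<otimes> inv (px a) \<otimes> px c = px (b + c - a)"
      proof -
        have "px b \<otimes> inv (px a) \<otimes> px c = px (b + - a + c)" by (simp only: neg add)
        also have "b + - a + c = b + c - a" by simp
        finally show ?thesis .
      qed
      moreover have "px b \<noteq> px a" "px c \<noteq> px a"
        using px_inj[of b a] px_inj[of c a] A[OF a] A[OF p(2)] A[OF p(3)] p(4,5) by auto
      ultimately show "p \<in> {(t, u). t \<in> S - {px a} \<and> u \<in> S - {px a} \<and> t \<otimes> inv (px a) \<otimes> u \<in> S}"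
        using p by (auto simp: S_def)
    qed (use sub in blast)
    moreover have "card (map_prod px px ` (?D a)) = card (?D a)"
    proof (rule card_image)
      have "inj_on px (set A)"
      proof (rule inj_onI)
        fix a b assume "a \<in> set A" "b \<in> set A" "px a = px b"
        then show "a = b" using px_inj[of a b] A[of a] A[of b] by auto
      qed
      then show "inj_on (map_prod px px) (?D a)"
        by (auto intro: inj_on_subset[OF map_prod_inj_on])
    qed
    moreover have "?D a = set (?L a)"
      by auto
    moreover have "distinct (?L a)"
      by (intro distinct_filter distinct_product) (simp_all add: A_def)
    ultimately show ?thesis unfolding squares_def by (simp only: distinct_card)
  qed
  \<comment> \<open>A square would give x^b y^-1 x^c = y, that is y x^(-c) y = x^b, or x^b y^-1 x^c
    = x^d, which makes y a power of x.\<close>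
  have sq_y: "squares S y = 0"
  proof -
    have "t \<otimes> inv y \<otimes> u \<notin> S" if "t \<in> S - {y}" "u \<in> S - {y}" for t u
    proof
      assume tu: "t \<otimes> inv y \<otimes> u \<in> S"
      from that obtain b c where bc: "b \<in> set A" "c \<in> set A" "t = px b" "u = px c" by (auto simp: S_def)
      consider "t \<otimes> inv y \<otimes> u = y" | d where "d \<in> set A" "t \<otimes> inv y \<otimes> u = px d" using tu by (auto simp: S_def)
      then show False
      proof cases
        case 1
        then have "px b \<otimes> inv y = y \<otimes> px (- c)" using y px bc by (metis inv_closed inv_solve_right m_closed neg)
        then have "px b = y \<otimes> px (- c) \<otimes> y" using y px by (metis inv_closed inv_inv inv_solve_right m_closed)
        then show False using y_px_y[of "- c" b] A[OF bc(1)] A[OF bc(2)] by auto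
      next
        case 2
        then have "px b \<otimes> inv y = px (d + - c)" using y px bc by (metis inv_closed inv_solve_right m_closed neg add)
        then have "px b = px (d + - c) \<otimes> y" using y px by (metis inv_closed inv_inv inv_solve_right m_closed)
        then have "y = px (- (d + - c) + b)" using y px by (metis inv_solve_left neg add)
        then show False using y_px[of "- (d + - c) + b"] A[OF bc(1)] A[OF bc(2)] A[OF 2(1)] by auto
      qed
    qed
    then have "{(t, u). t \<in> S - {y} \<and> u \<in> S - {y} \<and> t \<otimes> inv y \<otimes> u \<in> S} = {}" by blast
    then show ?thesis by (simp only: squares_def card.empty)
  qed
  have "inj_on (squares S) S"
  proof -
    have "inj_on (\<lambda>a. squares S (px a)) (set A)"
    proof -
      \<comment> \<open>For a = 0, 1, 2, 4, 6 the counts are 4, 2, 6, 5, 3.\<close>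
      have "distinct (map (\<lambda>a. length (?L a)) A)"
        by (simp add: A_def)
      then have "inj_on (\<lambda>a. length (?L a)) (set A)"
        by (simp add: distinct_map)
      then show ?thesis by (simp add: sq_x cong: inj_on_cong)
    qed
    then have inj: "inj_on (squares S) (px ` set A)" by (rule inj_on_imageI[unfolded comp_def])
    have nz: "squares S (px a) \<noteq> 0" if "a \<in> set A" for a
    proof -
      have "\<forall>a\<in>set A. length (?L a) \<noteq> 0"
        by (simp add: A_def)
      then show ?thesis using sq_x that by simp
    qed
    have "squares S y \<notin> squares S ` (px ` set A)" using nz sq_y by fastforce
    then have "inj_on (squares S) (insert y (px ` set A))"
      using inj y_notin by (simp add: inj_on_insert)
    then show ?thesis by (simp only: S_def[symmetric])
  qed
  moreover have "generate G S = carrier G"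
  proof (rule equalityI)
    show "generate G S \<subseteq> carrier G" using generate_incl[OF S] .
    have "x = px 1" using x by (simp add: px_def)
    then have "{x, y} \<subseteq> S" by (auto simp: S_def A_def)
    then show "carrier G \<subseteq> generate G S" using mono_generate gen by metis
  qed
  moreover have "\<one> \<in> S" using one by (auto simp: S_def A_def intro!: image_eqI[of _ _ 0])
  ultimately have "is_cayley_representation G S"
    using cayley_representation_squares[OF S] by blast
  then show ?thesis unfolding admits_cayley_representation_def using S \<open>\<one> \<in> S\<close> by blast
qed

end

section \<open>Presented groups without short relations\<close>

definition sym_class :: "'a letter list \<Rightarrow> 'a letter list set" where
  "sym_class r = {rotate m r |m. True} \<union> {rotate m (winv r) |m. True}"

lemma rotate_sym_class: "s \<in> sym_class r \<Longrightarrow> rotate m s \<in> sym_class r"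
  unfolding sym_class_def by (auto simp: rotate_rotate)

lemma winv_rotate: "\<exists>l. winv (rotate m r) = rotate l (winv r)"
proof -
  let ?l = "m mod length r"
  have "winv (rotate m r) = winv (take ?l r) @ winv (drop ?l r)"
    by (simp add: rotate_drop_take)
  also have "\<dots> = rotate (length (winv (drop ?l r))) (winv (drop ?l r) @ winv (take ?l r))"
    by (simp only: rotate_append)
  also have "winv (drop ?l r) @ winv (take ?l r) = winv r"
    by (metis append_take_drop_id winv_append)
  finally show ?thesis by blast
qed

lemma winv_sym_class: "s \<in> sym_class r \<Longrightarrow> winv s \<in> sym_class r"
  unfolding sym_class_def using winv_rotate[of _ r] winv_rotate[of _ "winv r"] by fastforce

lemma self_sym_class: "r \<in> sym_class r"
  unfolding sym_class_def by (auto intro: exI[of _ 0])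

lemma length_sym_class: "s \<in> sym_class r \<Longrightarrow> length s = length r"
  by (auto simp: sym_class_def)

lemma cyclically_reduced_rotate1:
  assumes "cyclically_reduced r" shows "cyclically_reduced (rotate1 r)"
proof (cases r)
  case (Cons a s)
  then show ?thesis using assms
    by (cases s) (auto simp: cyclically_reduced_def reduced_Cons reduced_append_iff hd_append
        split: if_splits)
qed (use assms in simp)

lemma cyclically_reduced_rotate: "cyclically_reduced r \<Longrightarrow> cyclically_reduced (rotate m r)"
  by (induction m) (auto intro: cyclically_reduced_rotate1)

lemma cyclically_reduced_winv:
  assumes "cyclically_reduced r" shows "cyclically_reduced (winv r)"
proof (cases "r = []")
  case False
  then have "hd (winv r) = inv_letter (last r)" "last (winv r) = inv_letter (hd r)"
    by (auto simp: hd_winv) (simp add: winv_def last_rev hd_map)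
  then show ?thesis using assms False by (auto simp: cyclically_reduced_def)
qed (use assms in simp)

lemma cyclically_reduced_sym_class:
  "cyclically_reduced r \<Longrightarrow> s \<in> sym_class r \<Longrightarrow> cyclically_reduced s"
  by (auto simp: sym_class_def cyclically_reduced_rotate cyclically_reduced_winv)

lemma cyc_closed_sym_class:
  assumes "\<And>r. r \<in> R \<Longrightarrow> r \<noteq> [] \<and> cyclically_reduced r"
  shows "cyc_closed (\<Union>r\<in>R. sym_class r)"
  unfolding cyc_closed_def
proof (intro ballI conjI)
  fix s assume "s \<in> (\<Union>r\<in>R. sym_class r)"
  then obtain r where r: "r \<in> R" "s \<in> sym_class r" by blast
  show "s \<noteq> []" using length_sym_class[OF r(2)] assms[OF r(1)] by auto
  show "rotate1 s \<in> (\<Union>r\<in>R. sym_class r)"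
    using rotate_sym_class[OF r(2), of 1] r(1) by auto
  show "winv s \<in> (\<Union>r\<in>R. sym_class r)" using winv_sym_class[OF r(2)] r(1) by blast
  show "cyclically_reduced s" using cyclically_reduced_sym_class r assms by blast
qed

section \<open>From words in the presented group to values in the free group\<close>

lemma val_foldr: "val (foldr cons_reduce u w) = val u + val w"
proof (induction u)
  case (Cons a u)
  have "val (cons_reduce a v) = gen a + val v" for v
    by (cases v) (auto simp: cons_reduce_def)
  then show ?case using Cons by (simp add: add.assoc)
qed simp

lemma val_mult_free: "val (u \<otimes>\<^bsub>free_group A\<^esub> w) = val u + val w"
  by (simp add: free_group_def val_foldr)

lemma val_one_free: "val \<one>\<^bsub>free_group A\<^esub> = 0"
  by (simp add: free_group_def)

lemma val_inv_free:
  assumes "u \<in> carrier (free_group A)" shows "val (inv\<^bsub>free_group A\<^esub> u) = - val u"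
proof -
  interpret group "free_group A" by (rule group_free_group)
  have "val (inv\<^bsub>free_group A\<^esub> u) + val u = 0"
    using l_inv[OF assms] val_mult_free[of A "inv\<^bsub>free_group A\<^esub> u" u] val_one_free[of A] by simp
  then show ?thesis by (simp add: eq_neg_iff_add_eq_0)
qed

text \<open>The words whose values are products of finitely many conjugates form a normal subgroup
  containing the relators.\<close>

lemma normal_closure_area:
  assumes R: "cyc_closed R" and R0: "R0 \<subseteq> carrier (free_group A)" "R0 \<subseteq> R"
    and w: "w \<in> normal_closure (free_group A) R0"
  shows "\<exists>n. val w \<in> area_le R n"
proof -
  interpret group "free_group A" by (rule group_free_group)
  define N where "N = {w \<in> carrier (free_group A). \<exists>n. val w \<in> area_le R n}"
  have "subgroup N (free_group A)"
  proof (rule subgroupI)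
    have "\<one>\<^bsub>free_group A\<^esub> \<in> N" using area_le_0 by (simp add: N_def val_one_free)
    then show "N \<noteq> {}" by blast
  next
    fix u assume "u \<in> N"
    then show "inv\<^bsub>free_group A\<^esub> u \<in> N"
      using area_le_uminus[OF R] by (auto simp: N_def val_inv_free)
  next
    fix u v assume "u \<in> N" "v \<in> N"
    then show "u \<otimes>\<^bsub>free_group A\<^esub> v \<in> N"
      using area_le_add by (fastforce simp: N_def val_mult_free)
  qed (auto simp: N_def)
  moreover have "u \<otimes>\<^bsub>free_group A\<^esub> v \<otimes>\<^bsub>free_group A\<^esub> inv\<^bsub>free_group A\<^esub> u \<in> N"
    if "u \<in> carrier (free_group A)" "v \<in> N" for u v
    using that area_le_conj[of "val v" R _ "val u"]
    by (auto simp: N_def val_mult_free val_inv_free diff_conv_add_uminus simp del: add_uminus_conv_diff)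
  ultimately have "N \<lhd> free_group A" by (simp add: normal_inv_iff)
  moreover have "R0 \<subseteq> N"
  proof
    fix r assume r: "r \<in> R0"
    then have "val r \<in> area_le R 1" using R0(2) area_le_1 by blast
    then show "r \<in> N" using r R0(1) by (auto simp: N_def)
  qed
  ultimately have "normal_closure (free_group A) R0 \<subseteq> N" by (auto simp: normal_closure_def)
  then show ?thesis using w by (auto simp: N_def)
qed

definition power_word :: "'a \<Rightarrow> int \<Rightarrow> 'a letter list" where
  "power_word x i = replicate (nat \<bar>i\<bar>) (x, 0 \<le> i)"

lemma val_pow_free:
  assumes "x \<in> A"
  shows "val ([(x, True)] [^]\<^bsub>free_group A\<^esub> (i :: int)) = val (power_word x i)"
proof -
  interpret group "free_group A" by (rule group_free_group)
  have c: "[(x, True)] \<in> carrier (free_group A)" using assms by (simp add: free_group_def reduced_Cons)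
  have nat: "val ([(x, True)] [^]\<^bsub>free_group A\<^esub> n) = val (replicate n (x, True))" for n :: nat
  proof (induction n)
    case (Suc n)
    then have "val ([(x, True)] [^]\<^bsub>free_group A\<^esub> Suc n) = val (replicate n (x, True) @ [(x, True)])"
      by (simp add: val_mult_free)
    then show ?case by (metis replicate_append_same replicate_Suc)
  qed (simp add: val_one_free)
  have winv_rep: "winv (replicate n (x, True)) = replicate n (x, False)" for n
    by (simp add: winv_def inv_letter_def)
  show ?thesis
  proof (cases "0 \<le> i")
    case True
    then have "[(x, True)] [^]\<^bsub>free_group A\<^esub> i = [(x, True)] [^]\<^bsub>free_group A\<^esub> nat i"
      by (simp only: int_pow_def2 not_less[symmetric] if_False)
    then show ?thesis using True nat[of "nat i"] by (simp only: power_word_def abs_of_nonneg)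
  next
    case False
    then have "[(x, True)] [^]\<^bsub>free_group A\<^esub> i =
        inv\<^bsub>free_group A\<^esub> ([(x, True)] [^]\<^bsub>free_group A\<^esub> nat (- i))"
      by (simp only: int_pow_def2 not_le if_True)
    then have "val ([(x, True)] [^]\<^bsub>free_group A\<^esub> i) = - val (replicate (nat (- i)) (x, True))"
      using val_inv_free[OF nat_pow_closed[OF c]] by (simp only: nat)
    also have "\<dots> = val (winv (replicate (nat (- i)) (x, True)))" by (rule val_winv[symmetric])
    also have "\<dots> = val (power_word x i)"
      using False unfolding winv_rep by (simp add: power_word_def)
    finally show ?thesis .
  qed
qed

lemma reduced_replicate: "reduced_word (replicate n a)"
  by (induction n) (auto simp: reduced_Cons)

theorem presented_group_admits:
  fixes R0 :: "nat letter list set"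
  defines "R \<equiv> \<Union>r\<in>R0. sym_class r"
  assumes R0: "\<And>r. r \<in> R0 \<Longrightarrow> cyclically_reduced r \<and> set r \<subseteq> {..<2} \<times> UNIV"
    and k: "2 \<le> k" and len: "\<And>r. r \<in> R0 \<Longrightarrow> 66 * k \<le> length r"
    and inj: "\<And>r r'. r \<in> R \<Longrightarrow> r' \<in> R \<Longrightarrow> take k r = take k r' \<Longrightarrow> r = r'"
  shows "admits_cayley_representation (presented_group {..<2} R0)"
proof -
  let ?F = "free_group {..<2 :: nat}"
  define H where "H = normal_closure ?F R0"
  interpret F: group ?F by (rule group_free_group)
  have R0_sub: "R0 \<subseteq> carrier ?F"
    using R0 by (auto simp: free_group_def cyclically_reduced_def)
  have normal: "H \<lhd> ?F" unfolding H_def by (rule F.normal_normal_closure[OF R0_sub])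
  interpret G: group "?F Mod H" by (rule normal.factorgroup_is_group[OF normal])
  define \<pi> where "\<pi> w = H #>\<^bsub>?F\<^esub> w" for w
  have hom: "\<pi> \<in> hom ?F (?F Mod H)"
    unfolding \<pi>_def by (rule normal.r_coset_hom_Mod[OF normal])
  interpret \<pi>: group_hom ?F "?F Mod H" \<pi>
    by (rule group_hom.intro[OF F.group_axioms G.group_axioms group_hom_axioms.intro[OF hom]])
  have R: "cyc_closed R" unfolding R_def
  proof (rule cyc_closed_sym_class)
    fix r assume "r \<in> R0"
    with R0 len[of r] k show "r \<noteq> [] \<and> cyclically_reduced r" by auto
  qed
  \<comment> \<open>This is \<open>small_cancellation\<close> with \<open>L = 14\<close>. The short
    spelling \<open>v\<close> is separate from \<open>w\<close> because powers in the group are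
    compared with explicit words through their values.\<close>
  have trivial: "val v = 0"
    if w: "w \<in> carrier ?F" "\<pi> w = \<one>\<^bsub>?F Mod H\<^esub>" and v: "val w = val v" "length v \<le> 14" for w v
  proof -
    have "w \<in> H"
      using w F.coset_join1[of H w] normal by (simp add: \<pi>_def FactGroup_def normal_imp_subgroup)
    moreover have "R0 \<subseteq> R" using self_sym_class by (auto simp: R_def)
    ultimately obtain n where "val v \<in> area_le R n"
      using normal_closure_area[OF R R0_sub, of w] v(1) unfolding H_def by auto
    moreover have "(4 * 14 + 10) * k \<le> length r" if "r \<in> R" for r
    proof -
      obtain r0 where "r0 \<in> R0" "r \<in> sym_class r0" using \<open>r \<in> R\<close> by (auto simp: R_def)
      then show ?thesis using len[of r0] length_sym_class[of r r0] by simp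
    qed
    ultimately show ?thesis
      using small_cancellation[OF R _ inj k v(2)] by blast
  qed
  have nontrivial: False
    if "w \<in> carrier ?F" "\<pi> w = \<one>\<^bsub>?F Mod H\<^esub>" "val w = val v" "length v \<le> 14" "reduced_word v" "v \<noteq> []"
    for w v
    using trivial[OF that(1-4)] that(5,6) by (simp add: val_eq_0_iff normal_form_reduced)
  note [simp del] = mult_FactGroup one_FactGroup
  let ?x = "[(0 :: nat, True)]" and ?y = "[(1 :: nat, True)]"
  have c: "?x \<in> carrier ?F" "?y \<in> carrier ?F"
    by (simp_all add: free_group_def reduced_Cons)
  have pow: "\<pi> (?x [^]\<^bsub>?F\<^esub> i) = \<pi> ?x [^]\<^bsub>?F Mod H\<^esub> i" for i :: int
    using \<pi>.hom_int_pow[OF c(1)] by simp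
  have len_pw: "length (power_word x i) \<le> n" if "\<bar>i\<bar> \<le> int n" for x :: nat and i n
    using that by (simp add: power_word_def nat_le_iff)
  have red_pw: "reduced_word (power_word x i)" for x :: nat and i
    by (simp add: power_word_def reduced_replicate)
  have hd_pw: "power_word (0::nat) i = [] \<or> fst (hd (power_word (0::nat) i)) = (0 :: nat)"
    and last_pw: "power_word (0::nat) i = [] \<or> fst (last (power_word (0::nat) i)) = (0 :: nat)" for i
    by (cases "nat \<bar>i\<bar>"; simp add: power_word_def)+
  have red: "reduced_word ((1, True) # power_word (0 :: nat) i)" for i
    using hd_pw[of i] red_pw[of 0 i] by (auto simp: reduced_Cons inv_letter_def)
  have "admits_cayley_representation (?F Mod H)"
  proof (rule G.generate_two_admits[of "\<pi> ?x" "\<pi> ?y"])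
    show "\<pi> ?x \<in> carrier (?F Mod H)" "\<pi> ?y \<in> carrier (?F Mod H)" using c \<pi>.hom_closed by blast+
    show "\<pi> ?x [^]\<^bsub>?F Mod H\<^esub> i \<noteq> \<one>\<^bsub>?F Mod H\<^esub>" if i: "i \<noteq> 0" "\<bar>i\<bar> \<le> 12" for i :: int
    proof
      assume "\<pi> ?x [^]\<^bsub>?F Mod H\<^esub> i = \<one>\<^bsub>?F Mod H\<^esub>"
      then have "\<pi> (?x [^]\<^bsub>?F\<^esub> i) = \<one>\<^bsub>?F Mod H\<^esub>" by (simp add: pow)
      moreover have "length (power_word (0::nat) i) \<le> 14" using len_pw[of i 14 0] i(2) by simp
      moreover have "power_word (0::nat) i \<noteq> []" using i(1) by (simp add: power_word_def)
      ultimately show False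
        using nontrivial[of "?x [^]\<^bsub>?F\<^esub> i" "power_word (0::nat) i"] val_pow_free[of "0::nat" "{..<2}" i] c red_pw by auto
    qed
    show "\<pi> ?y \<noteq> \<pi> ?x [^]\<^bsub>?F Mod H\<^esub> i" if i: "\<bar>i\<bar> \<le> 12" for i :: int
    proof
      assume eq: "\<pi> ?y = \<pi> ?x [^]\<^bsub>?F Mod H\<^esub> i"
      let ?w = "?y \<otimes>\<^bsub>?F\<^esub> ?x [^]\<^bsub>?F\<^esub> (- i)"
      have "\<pi> ?w = \<one>\<^bsub>?F Mod H\<^esub>"
      proof -
        have "\<pi> ?w = \<pi> ?y \<otimes>\<^bsub>?F Mod H\<^esub> inv\<^bsub>?F Mod H\<^esub> (\<pi> ?x [^]\<^bsub>?F Mod H\<^esub> i)"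
          using c G.int_pow_neg[OF \<pi>.hom_closed[OF c(1)]] by (simp add: pow)
        also have "\<dots> = \<one>\<^bsub>?F Mod H\<^esub>"
          unfolding eq[symmetric] by (rule G.r_inv[OF \<pi>.hom_closed[OF c(2)]])
        finally show ?thesis .
      qed
      moreover have "val ?w = val ((1, True) # power_word (0::nat) (- i))"
        by (simp add: val_mult_free val_pow_free)
      moreover have "length ((1 :: nat, True) # power_word (0::nat) (- i)) \<le> 14" using len_pw[of "- i" 12 0] i by simp
      moreover have "?w \<in> carrier ?F" using c by simp
      ultimately show False
        using nontrivial[of ?w "(1, True) # power_word (0::nat) (- i)"] red[of "- i"] by blast
    qed
    show "\<pi> ?y \<otimes>\<^bsub>?F Mod H\<^esub> \<pi> ?x [^]\<^bsub>?F Mod H\<^esub> i \<otimes>\<^bsub>?F Mod H\<^esub> \<pi> ?y \<otimes>\<^bsub>?F Mod H\<^esub>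
        \<pi> ?x [^]\<^bsub>?F Mod H\<^esub> j \<noteq> \<one>\<^bsub>?F Mod H\<^esub>"
      if ij: "\<bar>i\<bar> \<le> 6" "\<bar>j\<bar> \<le> 6" for i j :: int
    proof
      assume eq: "\<pi> ?y \<otimes>\<^bsub>?F Mod H\<^esub> \<pi> ?x [^]\<^bsub>?F Mod H\<^esub> i \<otimes>\<^bsub>?F Mod H\<^esub> \<pi> ?y \<otimes>\<^bsub>?F Mod H\<^esub>
        \<pi> ?x [^]\<^bsub>?F Mod H\<^esub> j = \<one>\<^bsub>?F Mod H\<^esub>"
      let ?w = "?y \<otimes>\<^bsub>?F\<^esub> ?x [^]\<^bsub>?F\<^esub> i \<otimes>\<^bsub>?F\<^esub> ?y \<otimes>\<^bsub>?F\<^esub> ?x [^]\<^bsub>?F\<^esub> j"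
      let ?v = "((1, True) # power_word (0::nat) i) @ ((1, True) # power_word (0::nat) j)"
      have "\<pi> ?w = \<one>\<^bsub>?F Mod H\<^esub>"
        using c eq by (simp add: pow)
      moreover have "val ?w = val ?v"
        by (simp add: val_mult_free val_pow_free add.assoc)
      moreover have "reduced_word ?v"
        using last_pw[of i] red[of i] red[of j] unfolding reduced_append_iff
        by (auto simp: inv_letter_def prod_eq_iff)
      moreover have "length ?v \<le> 14" using len_pw[of i 6 0] len_pw[of j 6 0] ij by simp
      moreover have "?w \<in> carrier ?F" using c by simp
      ultimately show False
        using nontrivial[of ?w ?v] by blast
    qed
    show "generate (?F Mod H) {\<pi> ?x, \<pi> ?y} = carrier (?F Mod H)"
    proof (rule equalityI)
      show "generate (?F Mod H) {\<pi> ?x, \<pi> ?y} \<subseteq> carrier (?F Mod H)"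
        by (rule G.generate_incl) (use c \<pi>.hom_closed in blast)
      have letter: "\<pi> [a] \<in> generate (?F Mod H) {\<pi> ?x, \<pi> ?y}" if "a \<in> {..<2} \<times> UNIV" for a
      proof -
        obtain i b where ib: "a = (i, b)" by (cases a)
        with that have "i < 2" by simp
        then have a: "a = (i, b)" "i = 0 \<or> i = 1" using ib by linarith+
        have mem: "\<pi> [(i, True)] \<in> {\<pi> ?x, \<pi> ?y}" using a(2) by auto
        show ?thesis
        proof (cases b)
          case True
          then show ?thesis using generate.incl[OF mem] a by simp
        next
          case False
          have ci: "[(i, True)] \<in> carrier ?F" "[(i, False)] \<in> carrier ?F"
            using a(2) by (auto simp: free_group_def reduced_Cons)
          have "[(i, False)] \<otimes>\<^bsub>?F\<^esub> [(i, True)] = \<one>\<^bsub>?F\<^esub>"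
            by (simp add: free_group_def cons_reduce_def inv_letter_def)
          then have "inv\<^bsub>?F\<^esub> [(i, True)] = [(i, False)]" using ci F.inv_equality by blast
          then have "\<pi> [(i, False)] = inv\<^bsub>?F Mod H\<^esub> \<pi> [(i, True)]"
            using \<pi>.hom_inv[OF ci(1)] by simp
          then show ?thesis using generate.inv[OF mem] a False by simp
        qed
      qed
      have word: "\<pi> w \<in> generate (?F Mod H) {\<pi> ?x, \<pi> ?y}" if "w \<in> carrier ?F" for w
        using that
      proof (induction w)
        case Nil
        have one: "\<one>\<^bsub>?F\<^esub> = []" by (simp add: free_group_def)
        have "\<pi> [] = \<one>\<^bsub>?F Mod H\<^esub>" using \<pi>.hom_one unfolding one .
        then show ?case by (simp only: generate.one)
      next
        case (Cons a w)
        then have aw: "a \<in> {..<2} \<times> UNIV" "w \<in> carrier ?F" "[a] \<in> carrier ?F" "reduced_word (a # w)"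
          by (auto simp: free_group_def reduced_Cons)
        have "a # w = [a] \<otimes>\<^bsub>?F\<^esub> w"
          using aw(4) by (cases w) (auto simp: free_group_def cons_reduce_def reduced_Cons)
        then have "\<pi> (a # w) = \<pi> [a] \<otimes>\<^bsub>?F Mod H\<^esub> \<pi> w" using aw by simp
        then show ?case using generate.eng[OF letter[OF aw(1)] Cons.IH[OF aw(2)]] by simp
      qed
      show "carrier (?F Mod H) \<subseteq> generate (?F Mod H) {\<pi> ?x, \<pi> ?y}"
        using word by (auto simp: FactGroup_def RCOSETS_def \<pi>_def)
    qed
  qed
  then show ?thesis by (simp add: presented_group_def H_def)
qed

section \<open>Words with a long repetition\<close>

definition cyc_nth :: "'a list \<Rightarrow> nat \<Rightarrow> 'a" where
  "cyc_nth y i = y ! (i mod length y)"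

lemma nth_rotate_cyc: "i < length y \<Longrightarrow> rotate q y ! i = cyc_nth y (q + i)"
  by (simp add: cyc_nth_def nth_rotate)

lemma cyc_nth_add_length [simp]: "cyc_nth y (i + length y) = cyc_nth y i"
  by (simp add: cyc_nth_def)

lemma cyc_nth_cong: "i mod length y = j mod length y \<Longrightarrow> cyc_nth y i = cyc_nth y j"
  by (simp add: cyc_nth_def)

lemma rotate_eqD:
  assumes "length x = length y" "rotate c x = rotate c y" shows "x = y"
proof (cases "x = []")
  case False
  then have "c * length x - c + c = c * length x" by (cases "length x") auto
  then have "rotate (c * length x - c) (rotate c z) = z" if "length z = length x" for z
    using that by (simp add: rotate_rotate rotate_id)
  then show ?thesis using assms by metis
qed (use assms in simp)

text \<open>The functions of a prefix \<open>t\<close> that give the remaining \<open>h\<close> letters: the last \<open>d\<close> letters of \<open>t\<close>,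
  repeated periodically, and the inverse of the block of \<open>t\<close> that ends at position \<open>d\<close>.\<close>

definition periodic_block :: "nat \<Rightarrow> nat \<Rightarrow> 'a letter list \<Rightarrow> 'a letter list" where
  "periodic_block h d t = map (\<lambda>i. t ! (length t - d + i mod d)) [0..<h]"

definition mirror_block :: "nat \<Rightarrow> nat \<Rightarrow> 'a letter list \<Rightarrow> 'a letter list" where
  "mirror_block h d t = map (\<lambda>i. inv_letter (t ! (d - i))) [0..<h]"

definition blocks :: "nat \<Rightarrow> nat \<Rightarrow> 'a letter list set \<Rightarrow> ('a letter list \<Rightarrow> 'a letter list) set" where
  "blocks h l U = (\<lambda>u t. u) ` U \<union> periodic_block h ` {..l} \<union> mirror_block h ` {..l}"

definition reduced_le :: "nat \<Rightarrow> nat letter list set" where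
  "reduced_le n = {w. set w \<subseteq> {..<2} \<times> UNIV \<and> reduced_word w \<and> length w \<le> n}"

text \<open>Such a word can be rebuilt from a rotation, a reduced word \<open>t\<close> of length at
  most l - h and a function from a small list. With polynomially many blocks in \<open>U\<close>,
  this leaves a polynomial multiple of 3^(l - h) words.\<close>

definition bad_words :: "nat \<Rightarrow> nat \<Rightarrow> nat letter list set \<Rightarrow> nat letter list set" where
  "bad_words h l U = (\<lambda>(p, t, g). rotate p (t @ g t)) ` ({..l} \<times> reduced_le (l - h) \<times> blocks h l U)"

lemma rotate_drop_nth:
  assumes "h \<le> length y" "i < h"
  shows "drop (length y - h) (rotate (q + h) y) ! i = cyc_nth y (q + i)"
proof -
  have "drop (length y - h) (rotate (q + h) y) ! i = cyc_nth y (q + h + (length y - h + i))"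
    using assms by (simp add: nth_rotate_cyc)
  also have "q + h + (length y - h + i) = (q + i) + length y" using assms by simp
  finally show ?thesis by simp
qed

lemma bad_wordsI:
  assumes y: "y \<in> cyc_reduced_words 2 l" and h: "h \<le> length y" "length y \<noteq> 0"
    and g: "g \<in> blocks h l U"
    and eq: "drop (length y - h) (rotate q y) = g (take (length y - h) (rotate q y))"
  shows "y \<in> bad_words h l U"
proof -
  define t where "t = take (length y - h) (rotate q y)"
  have z: "rotate q y = t @ g t"
    using eq by (metis append_take_drop_id t_def)
  obtain p where p: "y = rotate p (rotate q y)" using rotate_inverse by blast
  define p' where "p' = p mod length y"
  have "y = rotate p' (t @ g t)"
    using p rotate_conv_mod[of p "rotate q y"] z by (simp add: p'_def)
  moreover have "p' \<le> l"
  proof -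
    have "p' < length y" using h(2) by (simp add: p'_def)
    then show ?thesis using y by (auto simp: cyc_reduced_words_def)
  qed
  moreover have "t \<in> reduced_le (l - h)"
  proof -
    have "reduced_word (rotate q y)"
      using y cyclically_reduced_rotate by (auto simp: cyc_reduced_words_def cyclically_reduced_def)
    then have "reduced_word t" unfolding z by (rule reduced_append1)
    moreover have "set t \<subseteq> set y" unfolding t_def by (metis set_take_subset set_rotate)
    moreover have "length t \<le> l - h" using y by (auto simp: t_def cyc_reduced_words_def)
    ultimately show ?thesis using y by (auto simp: reduced_le_def cyc_reduced_words_def)
  qed
  ultimately show ?thesis using g unfolding bad_words_def by force
qed

text \<open>The shared block is rotated to the end of \<open>y\<close>. If \<rho> runs along the
  inverse of \<open>y\<close>, the block occurs inverted in \<open>y\<close>, hence the two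
  memberships in \<open>U\<close>.\<close>

lemma bad_words_const:
  assumes y: "y \<in> cyc_reduced_words 2 l" and h: "0 < h" "h \<le> length y"
    and s: "s \<in> sym_class v" "h \<le> length s" and \<rho>: "\<rho> \<in> sym_class y" "take h \<rho> = take h s"
    and U: "take h s \<in> U" "winv (take h s) \<in> U"
  shows "y \<in> bad_words h l U"
proof -
  from \<rho>(1) consider m where "\<rho> = rotate m y" | m where "\<rho> = rotate m (winv y)"
    by (auto simp: sym_class_def)
  then show ?thesis
  proof cases
    case 1
    have "drop (length y - h) (rotate (m + h) y) = take h s"
    proof (rule nth_equalityI)
      show "length (drop (length y - h) (rotate (m + h) y)) = length (take h s)" using h s by simp
      fix i assume "i < length (drop (length y - h) (rotate (m + h) y))"
      then have i: "i < h" using h by simp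
      have "take h s ! i = \<rho> ! i" using i \<rho>(2) by (metis nth_take)
      also have "\<dots> = cyc_nth y (m + i)" using i h 1 by (simp add: nth_rotate_cyc)
      finally show "drop (length y - h) (rotate (m + h) y) ! i = take h s ! i"
        using rotate_drop_nth[OF h(2) i] by simp
    qed
    moreover have "(\<lambda>t. take h s) \<in> blocks h l U" using U by (auto simp: blocks_def)
    ultimately show ?thesis using bad_wordsI[OF y h(2)] h by fastforce
  next
    case 2
    then obtain c where c: "\<rho> = winv (rotate c y)" using winv_rotate[of m "winv y"] by (metis winv_winv)
    have "winv (take h \<rho>) = drop (length y - h) (rotate c y)"
    proof -
      have "take h \<rho> = winv (drop (length y - h) (rotate c y))"
        unfolding c winv_def using h by (simp add: take_rev drop_map)
      then show ?thesis by simp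
    qed
    then have "drop (length y - h) (rotate c y) = winv (take h s)" using \<rho>(2) by simp
    moreover have "(\<lambda>t. winv (take h s)) \<in> blocks h l U" using U by (auto simp: blocks_def)
    ultimately show ?thesis using bad_wordsI[OF y h(2)] h by fastforce
  qed
qed

text \<open>Rotate \<open>y\<close> so that the copy at \<open>a + d\<close> comes last. The
  \<open>d\<close> letters before it begin at \<open>a\<close>, where the first copy begins, so the
  last block continues them with period \<open>d\<close>, even if the copies overlap. The bound on
  \<open>d\<close> keeps these letters inside the prefix.\<close>

lemma bad_words_periodic_aux:
  assumes y: "y \<in> cyc_reduced_words 2 l" and h: "0 < h" "4 * h \<le> length y"
    and d: "0 < d" "2 * d \<le> length y"
    and eq: "\<And>i. i < h \<Longrightarrow> cyc_nth y (a + i) = cyc_nth y (a + d + i)"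
  shows "y \<in> bad_words h l U"
proof -
  define z where "z = rotate (a + d + h) y"
  define t where "t = take (length y - h) z"
  define u where "u = drop (length y - h) z"
  have len: "length t = length y - h" "length u = h" using h by (auto simp: t_def u_def z_def)
  have u: "u ! i = cyc_nth y (a + d + i)" if "i < h" for i
    unfolding u_def z_def using rotate_drop_nth[of h y i "a + d"] h that by simp
  have t: "t ! j = cyc_nth y (a + d + h + j)" if "j < length y - h" for j
    unfolding t_def z_def using that by (simp add: nth_rotate_cyc)
  have "u ! i = t ! (length t - d + i mod d)" if "i < h" for i
    using that
  proof (induction i rule: less_induct)
    case (less i)
    show ?case
    proof (cases "i < d")
      case True
      have "t ! (length t - d + i) = cyc_nth y (a + d + h + (length t - d + i))"
        using t True d h len by simp
      also have "a + d + h + (length t - d + i) = a + i + length y" using d h len by simp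
      also have "cyc_nth y (a + i + length y) = u ! i" using eq[OF less.prems] u[OF less.prems] by simp
      finally show ?thesis using True by simp
    next
      case False
      then have "u ! i = cyc_nth y (a + d + (i - d))" using eq[OF less.prems] u[OF less.prems] by simp
      also have "\<dots> = u ! (i - d)" using u[of "i - d"] less.prems by simp
      also have "\<dots> = t ! (length t - d + (i - d) mod d)" using less d False by simp
      also have "(i - d) mod d = i mod d" using False by (simp add: le_mod_geq)
      finally show ?thesis .
    qed
  qed
  then have "u = periodic_block h d t"
    by (intro nth_equalityI) (simp_all add: periodic_block_def len)
  moreover have "y \<noteq> []" using h by auto
  moreover have "periodic_block h d \<in> blocks h l U"
    using d y by (auto simp: blocks_def cyc_reduced_words_def)
  ultimately show ?thesis
    using bad_wordsI[OF y, of h "periodic_block h d" U "a + d + h"] h by (simp add: t_def u_def z_def)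
qed

lemma bad_words_periodic:
  assumes y: "y \<in> cyc_reduced_words 2 l" and h: "0 < h" "4 * h \<le> length y"
    and ne: "rotate a y \<noteq> rotate b y"
    and eq: "\<And>i. i < h \<Longrightarrow> cyc_nth y (a + i) = cyc_nth y (b + i)"
  shows "y \<in> bad_words h l U"
proof -
  define a' where "a' = a mod length y"
  define b' where "b' = b mod length y"
  have L: "0 < length y" using h by linarith
  then have lt: "a' < length y" "b' < length y" by (simp_all add: a'_def b'_def)
  have ne': "a' \<noteq> b'" using ne rotate_conv_mod[of a y] rotate_conv_mod[of b y] by (auto simp: a'_def b'_def)
  have cyc': "cyc_nth y (a' + i) = cyc_nth y (a + i)" "cyc_nth y (b' + i) = cyc_nth y (b + i)" for i
    unfolding a'_def b'_def by (rule cyc_nth_cong, simp add: mod_add_left_eq)+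
  have eq': "cyc_nth y (a' + i) = cyc_nth y (b' + i)" if "i < h" for i
    using eq[OF that] by (simp add: cyc')
  have main: "y \<in> bad_words h l U"
    if lt: "a < b" "b < length y" and eq: "\<And>i. i < h \<Longrightarrow> cyc_nth y (a + i) = cyc_nth y (b + i)" for a b
  proof (cases "2 * (b - a) \<le> length y")
    case True
    show ?thesis
      by (rule bad_words_periodic_aux[OF y h _ True, of a]) (use lt eq in auto)
  next
    case False
    show ?thesis
    \<comment> \<open>On the cyclic word the complementary shift, from \<open>b\<close> around to
      \<open>a\<close>, is the shorter one.\<close>
    proof (rule bad_words_periodic_aux[OF y h, of "length y - (b - a)" b])
      fix i assume "i < h"
      have "cyc_nth y (b + (length y - (b - a)) + i) = cyc_nth y (a + i + length y)"
        using lt by (intro arg_cong[where f = "cyc_nth y"]) simp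
      then show "cyc_nth y (b + i) = cyc_nth y (b + (length y - (b - a)) + i)"
        using eq[OF \<open>i < h\<close>] by simp
    qed (use lt False in auto)
  qed
  show ?thesis
    using main[of a' b'] main[of b' a'] ne' lt eq' by (metis linorder_neqE_nat)
qed

text \<open>The letter at \<open>a + i\<close> is the inverse of the one at
  \<open>a + e - i\<close>. If \<open>e\<close> is large, the first half of the overlap is disjoint
  from its mirror image, otherwise the second half is. That half is rotated to the end and is
  determined by the prefix.\<close>

lemma bad_words_mirror:
  assumes y: "y \<in> cyc_reduced_words 2 l" and h: "0 < h" "4 * h \<le> length y"
    and eq: "take (2 * h) (rotate a y) = take (2 * h) (winv (rotate c y))"
  shows "y \<in> bad_words h l U"
proof -
  let ?L = "length y"
  have L: "0 < ?L" using h by linarith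
  \<comment> \<open>Modulo the length, \<open>a + e\<close> is the position of the last letter of
    \<open>rotate c y\<close>; \<open>?L\<close> is added to keep the subtraction exact.\<close>
  define e where "e = (c + ?L - 1 + (?L - a mod ?L)) mod ?L"
  have e: "e < ?L" using L by (simp add: e_def)
  have ae: "(a + e) mod ?L = (c + ?L - 1) mod ?L"
  proof -
    have "(a + e) mod ?L = (a mod ?L + (c + ?L - 1 + (?L - a mod ?L))) mod ?L"
      unfolding e_def by (simp add: mod_simps)
    also have "a mod ?L + (c + ?L - 1 + (?L - a mod ?L)) = (c + ?L - 1) + ?L"
      using mod_less_divisor[OF L, of a] L by linarith
    finally show ?thesis by simp
  qed
  have f: "cyc_nth y (a + i) = inv_letter (cyc_nth y (a + e + ?L - i))" if i: "i < 2 * h" for i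
  proof -
    have "cyc_nth y (a + i) = rotate a y ! i" using i h by (simp add: nth_rotate_cyc)
    also have "\<dots> = winv (rotate c y) ! i" using eq i by (metis nth_take)
    also have "\<dots> = inv_letter (rotate c y ! (?L - Suc i))"
      using i h by (simp add: winv_def rev_nth)
    also have "rotate c y ! (?L - Suc i) = cyc_nth y (c + (?L - Suc i))"
      using i h by (simp add: nth_rotate_cyc)
    also have "\<dots> = cyc_nth y (a + e + ?L - i)"
    proof (rule cyc_nth_cong)
      have "(a + e + (?L - i)) mod ?L = ((a + e) mod ?L + (?L - i)) mod ?L"
        by (simp add: mod_simps)
      also have "\<dots> = (c + ?L - 1 + (?L - i)) mod ?L" unfolding ae by (simp add: mod_simps)
      also have "c + ?L - 1 + (?L - i) = c + (?L - Suc i) + ?L" using i h by linarith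
      also have "(c + (?L - Suc i) + ?L) mod ?L = (c + (?L - Suc i)) mod ?L" by (rule mod_add_self2)
      also have "a + e + (?L - i) = a + e + ?L - i" using i h by linarith
      finally show "(c + (?L - Suc i)) mod ?L = (a + e + ?L - i) mod ?L" by (rule sym)
    qed
    finally show ?thesis .
  qed
  have main: "y \<in> bad_words h l U"
    if d: "h \<le> Suc d" "d < ?L - h" and u: "\<And>i. i < h \<Longrightarrow> cyc_nth y (q + i) = inv_letter (cyc_nth y (q + h + (d - i)))"
    for q d
  proof -
    have "drop (?L - h) (rotate (q + h) y) = mirror_block h d (take (?L - h) (rotate (q + h) y))"
    proof (rule nth_equalityI)
      fix i assume "i < length (drop (?L - h) (rotate (q + h) y))"
      then have i: "i < h" using h by simp
      then have "d - i < ?L - h" using d by linarith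
      then show "drop (?L - h) (rotate (q + h) y) ! i = mirror_block h d (take (?L - h) (rotate (q + h) y)) ! i"
        using i h u[OF i] rotate_drop_nth[of h y i q] by (simp add: mirror_block_def nth_rotate_cyc)
    qed (use h in \<open>simp add: mirror_block_def\<close>)
    moreover have "mirror_block h d \<in> blocks h l U"
      using d y by (auto simp: blocks_def cyc_reduced_words_def)
    moreover have "h \<le> ?L" "?L \<noteq> 0" using h by linarith+
    ultimately show ?thesis using bad_wordsI[OF y] by blast
  qed
  show ?thesis
  proof (cases "2 * h \<le> Suc e")
    case True
    show ?thesis
    proof (rule main[of "e - h" a])
      fix i assume i: "i < h"
      have "a + e + ?L - i = a + h + (e - h - i) + ?L" using i True e h by linarith
      then have "cyc_nth y (a + e + ?L - i) = cyc_nth y (a + h + (e - h - i))"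
        by (simp only: cyc_nth_add_length)
      moreover have "i < 2 * h" using i by linarith
      ultimately show "cyc_nth y (a + i) = inv_letter (cyc_nth y (a + h + (e - h - i)))"
        using f by metis
    qed (use True e h in linarith)+
  next
    case False
    show ?thesis
    \<comment> \<open>The image of the second half is reached by going around the cyclic
      word.\<close>
    proof (rule main[of "?L + e - 3 * h" "a + h"])
      fix i assume i: "i < h"
      have "a + e + ?L - (h + i) = a + h + h + (?L + e - 3 * h - i)" using i False h by linarith
      moreover have "h + i < 2 * h" using i by linarith
      ultimately show "cyc_nth y (a + h + i) = inv_letter (cyc_nth y (a + h + h + (?L + e - 3 * h - i)))"
        using f[of "h + i"] by (simp only: add.assoc)
    qed (use False h in linarith)+
  qed
qed

text \<open>Two rotations give the periodic case. For two inverses the common prefix is a common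
  suffix of the rotations, again periodic. Only the mixed case draws on all 2 h common
  letters.\<close>

lemma bad_words_self:
  assumes y: "y \<in> cyc_reduced_words 2 l" and h: "0 < h" "4 * h \<le> length y"
    and \<rho>: "\<rho> \<in> sym_class y" "\<rho>' \<in> sym_class y" "\<rho> \<noteq> \<rho>'" "take (2 * h) \<rho> = take (2 * h) \<rho>'"
  shows "y \<in> bad_words h l U"
proof -
  have forms: "(\<exists>a. s = rotate a y) \<or> (\<exists>c. s = winv (rotate c y))" if "s \<in> sym_class y" for s
    using that winv_rotate[of _ "winv y"] unfolding sym_class_def by (auto) (metis winv_winv)
  have fwd: ?thesis if "\<rho> = rotate a y" "\<rho>' = rotate b y" for a b
  proof (rule bad_words_periodic[OF y h, of a b])
    show "rotate a y \<noteq> rotate b y" using that \<rho>(3) by simp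
    fix i assume i: "i < h"
    then have "rotate a y ! i = rotate b y ! i"
      using \<rho>(4) that nth_take[of i "2 * h" "rotate a y"] nth_take[of i "2 * h" "rotate b y"] by simp
    then show "cyc_nth y (a + i) = cyc_nth y (b + i)" using i h by (simp add: nth_rotate_cyc)
  qed
  have bwd: ?thesis if "\<rho> = winv (rotate a y)" "\<rho>' = winv (rotate b y)" for a b
  proof -
    let ?c = "length y - 2 * h"
    have "drop ?c (rotate a y) = drop ?c (rotate b y)"
      using \<rho>(4) h unfolding that winv_def by (simp add: take_rev drop_map inj_map_eq_map[of inv_letter] inj_def)
    then have nth: "rotate a y ! (?c + i) = rotate b y ! (?c + i)" if "i < 2 * h" for i
      using that h by (metis le_add_diff_inverse2 length_rotate nth_drop diff_le_self)
    show ?thesis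
    proof (rule bad_words_periodic[OF y h, of "a + ?c" "b + ?c"])
      show "rotate (a + ?c) y \<noteq> rotate (b + ?c) y"
      proof
        assume "rotate (a + ?c) y = rotate (b + ?c) y"
        then have "rotate ?c (rotate a y) = rotate ?c (rotate b y)" by (simp add: rotate_rotate add.commute)
        then have "rotate a y = rotate b y" by (rule rotate_eqD[rotated]) simp
        then show False using that \<rho>(3) by simp
      qed
      fix i assume i: "i < h"
      have "rotate a y ! (?c + i) = cyc_nth y (a + (?c + i))" "rotate b y ! (?c + i) = cyc_nth y (b + (?c + i))"
        using i h by (simp_all add: nth_rotate_cyc)
      then show "cyc_nth y (a + ?c + i) = cyc_nth y (b + ?c + i)" using nth[of i] i by (simp add: add.assoc)
    qed
  qed
  show ?thesis
    using forms[OF \<rho>(1)] forms[OF \<rho>(2)] fwd bwd bad_words_mirror[OF y h] \<rho>(4) by metis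
qed

section \<open>Counting reduced words\<close>

definition reduced_eq :: "nat \<Rightarrow> nat letter list set" where
  "reduced_eq n = {w. set w \<subseteq> {..<2} \<times> UNIV \<and> reduced_word w \<and> length w = n}"

lemma finite_reduced_le [simp]: "finite (reduced_le n)"
  by (rule finite_subset[OF _ finite_lists_length_le[of "{..<2} \<times> UNIV" n]])
     (auto simp: reduced_le_def)

lemma finite_reduced_eq [simp]: "finite (reduced_eq n)"
  by (rule finite_subset[OF _ finite_reduced_le[of n]]) (auto simp: reduced_le_def reduced_eq_def)

lemma card_reduced_eq: "card (reduced_eq (Suc n)) = 4 * 3 ^ n"
proof (induction n)
  case 0
  have "reduced_eq (Suc 0) = (\<lambda>a. [a]) ` ({..<2} \<times> UNIV)"
    by (auto simp: reduced_eq_def length_Suc_conv reduced_Cons)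
  moreover have "inj_on (\<lambda>a. [a]) ({..<2 :: nat} \<times> (UNIV :: bool set))" by (simp add: inj_on_def)
  ultimately show ?case by (simp add: card_image card_cartesian_product)
next
  case (Suc n)
  let ?\<Lambda> = "{..<2 :: nat} \<times> (UNIV :: bool set)"
  let ?S = "SIGMA w:reduced_eq (Suc n). ?\<Lambda> - {inv_letter (hd w)}"
  have "reduced_eq (Suc (Suc n)) = (\<lambda>(w, a). a # w) ` ?S"
  proof (intro equalityI subsetI)
    fix v assume v: "v \<in> reduced_eq (Suc (Suc n))"
    then obtain a w where aw: "v = a # w" by (cases v) (auto simp: reduced_eq_def)
    moreover from aw v have "w \<noteq> []" by (auto simp: reduced_eq_def)
    moreover from aw this v have "(w, a) \<in> ?S"
      by (auto simp: reduced_eq_def reduced_Cons)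
    ultimately show "v \<in> (\<lambda>(w, a). a # w) ` ?S" by force
  next
    fix v assume "v \<in> (\<lambda>(w, a). a # w) ` ?S"
    then show "v \<in> reduced_eq (Suc (Suc n))"
      by (auto simp: reduced_eq_def reduced_Cons)
  qed
  moreover have "inj_on (\<lambda>(w, a). a # w) ?S" by (auto simp: inj_on_def)
  ultimately have "card (reduced_eq (Suc (Suc n))) = card ?S" by (simp add: card_image)
  also have "\<dots> = (\<Sum>w\<in>reduced_eq (Suc n). card (?\<Lambda> - {inv_letter (hd w)}))"
    by (rule card_SigmaI) auto
  also have "\<dots> = (\<Sum>w\<in>reduced_eq (Suc n). 3)"
  proof (rule sum.cong)
    fix w assume w: "w \<in> reduced_eq (Suc n)"
    then have "hd w \<in> ?\<Lambda>" by (cases w) (auto simp: reduced_eq_def)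
    then have "inv_letter (hd w) \<in> ?\<Lambda>" by (auto simp: inv_letter_def)
    then show "card (?\<Lambda> - {inv_letter (hd w)}) = 3"
      by (simp add: card_Diff_singleton card_cartesian_product)
  qed simp
  finally show ?case using Suc by simp
qed

lemma card_reduced_le: "card (reduced_le n) \<le> 2 * 3 ^ n"
proof (induction n)
  case 0
  have "reduced_le 0 = {[]}" by (auto simp: reduced_le_def)
  then show ?case by simp
next
  case (Suc n)
  have "reduced_le (Suc n) = reduced_le n \<union> reduced_eq (Suc n)"
    by (auto simp: reduced_le_def reduced_eq_def)
  then have "card (reduced_le (Suc n)) \<le> card (reduced_le n) + card (reduced_eq (Suc n))"
    using card_Un_le by metis
  then show ?case using Suc card_reduced_eq[of n] by simp
qed

text \<open>A reduced word that is not cyclically reduced becomes so by appending a letter of the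
  other generator, \<open>1 - fst (hd w)\<close>. The length shows whether a letter was appended, so
  this map is injective.\<close>

lemma card_cyc_reduced_words: "3 ^ n \<le> card (cyc_reduced_words 2 (Suc n))"
proof -
  define ext where "ext w = (if cyclically_reduced w then w else w @ [(1 - fst (hd w), True)])"
    for w :: "nat letter list"
  have "ext w \<in> cyc_reduced_words 2 (Suc n)" if w: "w \<in> reduced_eq n" for w
  proof (cases "cyclically_reduced w")
    case True
    then show ?thesis using w by (auto simp: ext_def cyc_reduced_words_def reduced_eq_def)
  next
    case False
    then have ne: "w \<noteq> []" and hd: "hd w = inv_letter (last w)"
      using w by (auto simp: cyclically_reduced_def reduced_eq_def)
    have "hd w \<in> set w" using ne by simp
    then have lt: "fst (hd w) < 2" using w by (auto simp: reduced_eq_def)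
    have fst: "fst (last w) = fst (hd w)" using hd by (simp add: inv_letter_def)
    have neq: "1 - fst (hd w) \<noteq> fst (hd w)" by arith
    let ?a = "(1 - fst (hd w), True)"
    have "?a \<noteq> inv_letter (last w)" "hd w \<noteq> inv_letter ?a"
      using neq fst by (auto simp: inv_letter_def prod_eq_iff)
    then show ?thesis using w ne False
      by (auto simp: ext_def cyc_reduced_words_def reduced_eq_def cyclically_reduced_def
          reduced_append_iff reduced_Cons)
  qed
  moreover have "inj_on ext (reduced_eq n)"
    by (rule inj_onI) (auto simp: ext_def reduced_eq_def split: if_splits)
  ultimately have "card (reduced_eq n) \<le> card (cyc_reduced_words 2 (Suc n))"
    by (intro card_inj_on_le[of ext]) (auto simp: finite_cyc_reduced_words)
  moreover have "3 ^ n \<le> card (reduced_eq n)"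
  proof (cases n)
    case 0
    then have "reduced_eq n = {[]}" by (auto simp: reduced_eq_def)
    then show ?thesis using 0 by simp
  qed (simp add: card_reduced_eq)
  ultimately show ?thesis by linarith
qed

lemma card_bad_words:
  assumes "finite (U :: nat letter list set)"
  shows "card (bad_words h l U) \<le> Suc l * (2 * 3 ^ (l - h) * (card U + 2 * Suc l))"
proof -
  have fin: "finite (blocks h l U)" using assms by (simp add: blocks_def)
  have blocks: "card (blocks h l U) \<le> card U + Suc l + Suc l"
  proof -
    define A where "A = (\<lambda>u (t :: nat letter list). u) ` U"
    define B where "B = (periodic_block h ` {..l} :: (nat letter list \<Rightarrow> nat letter list) set)"
    define C where "C = (mirror_block h ` {..l} :: (nat letter list \<Rightarrow> nat letter list) set)"
    have "card A \<le> card U" "card B \<le> Suc l" "card C \<le> Suc l"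
      using card_image_le[OF assms] card_image_le[of "{..l}"] by (fastforce simp: A_def B_def C_def)+
    moreover have "card (A \<union> B \<union> C) \<le> card A + card B + card C"
      using card_Un_le[of "A \<union> B" C] card_Un_le[of A B] by linarith
    ultimately show ?thesis by (simp add: blocks_def flip: A_def B_def C_def)
  qed
  have "card (bad_words h l U) \<le> Suc l * (card (reduced_le (l - h)) * card (blocks h l U))"
    unfolding bad_words_def using fin
    by (intro order_trans[OF card_image_le]) (auto simp: card_cartesian_product)
  also have "\<dots> \<le> Suc l * (2 * 3 ^ (l - h) * (card U + 2 * Suc l))"
    using card_reduced_le blocks by (intro mult_le_mono) auto
  finally show ?thesis .
qed

section \<open>Random relators\<close>

text \<open>Omitting \<open>j\<close> makes the set independent of the relator under test. The
  length condition yields \<open>card_other_blocks\<close> for every function \<open>r\<close>, as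
  \<open>prob_Pi_pmf_coordinate\<close> asks for a bound with arbitrary other coordinates.\<close>

definition other_blocks :: "nat \<Rightarrow> nat \<Rightarrow> nat \<Rightarrow> (nat \<Rightarrow> nat letter list) \<Rightarrow> nat \<Rightarrow> nat letter list set" where
  "other_blocks h l m r j = (\<Union>i\<in>{i. i < m \<and> i \<noteq> j \<and> length (r i) \<le> l}.
     take h ` sym_class (r i) \<union> (\<lambda>s. winv (take h s)) ` sym_class (r i))"

lemma other_blocks_upd: "other_blocks h l m (r(j := y)) j = other_blocks h l m r j"
  unfolding other_blocks_def by (intro SUP_cong) auto

lemma sym_class_eq:
  "sym_class r = (\<lambda>m. rotate m r) ` {..length r} \<union> (\<lambda>m. rotate m (winv r)) ` {..length r}"
proof -
  have "rotate m s \<in> (\<lambda>m. rotate m s) ` {..length s}" for m and s :: "'a letter list"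
  proof (cases "s = []")
    case False
    then show ?thesis
      using rotate_conv_mod[of m s] mod_less_divisor[of "length s" m]
      by (intro image_eqI[of _ _ "m mod length s"]) auto
  qed auto
  from this[of _ r] this[of _ "winv r"] show ?thesis unfolding sym_class_def by auto
qed

lemma finite_sym_class [simp]: "finite (sym_class r)"
  by (simp add: sym_class_eq)

lemma card_sym_class: "card (sym_class r) \<le> 2 * Suc (length r)"
proof -
  have "card (sym_class r) \<le> card ((\<lambda>m. rotate m r) ` {..length r}) +
      card ((\<lambda>m. rotate m (winv r)) ` {..length r})"
    unfolding sym_class_eq by (rule card_Un_le)
  also have "\<dots> \<le> Suc (length r) + Suc (length r)"
    by (intro add_mono order_trans[OF card_image_le]) auto
  finally show ?thesis by simp
qed

lemma finite_other_blocks [simp]: "finite (other_blocks h l m r j)"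
  unfolding other_blocks_def by (rule finite_UN_I) auto

lemma card_other_blocks: "card (other_blocks h l m r j) \<le> m * (4 * Suc l)"
proof -
  let ?I = "{i. i < m \<and> i \<noteq> j \<and> length (r i) \<le> l}"
  have "card (other_blocks h l m r j) \<le> (\<Sum>i\<in>?I. card (take h ` sym_class (r i) \<union>
      (\<lambda>s. winv (take h s)) ` sym_class (r i)))"
    unfolding other_blocks_def by (rule card_UN_le) auto
  also have "\<dots> \<le> (\<Sum>i\<in>?I. 4 * Suc l)"
  proof (rule sum_mono)
    fix i assume i: "i \<in> ?I"
    have "card (take h ` sym_class (r i) \<union> (\<lambda>s. winv (take h s)) ` sym_class (r i)) \<le>
        card (sym_class (r i)) + card (sym_class (r i))"
      by (intro order_trans[OF card_Un_le] add_mono card_image_le) auto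
    then show "card (take h ` sym_class (r i) \<union> (\<lambda>s. winv (take h s)) ` sym_class (r i)) \<le> 4 * Suc l"
      using card_sym_class[of "r i"] i by simp
  qed
  also have "\<dots> \<le> m * (4 * Suc l)"
  proof -
    have "card ?I \<le> card {..<m}" by (rule card_mono) auto
    then show ?thesis by (simp only: sum_constant card_lessThan of_nat_id mult_le_mono1)
  qed
  finally show ?thesis .
qed

text \<open>Within one class a common prefix of 2 h letters is excluded by
  \<open>bad_words_self\<close>. Between different indices its first half suffices for
  \<open>bad_words_const\<close>, which also covers equal relators.\<close>

lemma admits_if_no_bad_words:
  assumes r: "\<And>i. i < m \<Longrightarrow> r i \<in> cyc_reduced_words 2 l"
    and good: "\<And>i. i < m \<Longrightarrow> r i \<notin> bad_words h l (other_blocks h l m r i) \<union> reduced_le (l - h)"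
    and h: "0 < h" "133 * h \<le> l"
  shows "admits_cayley_representation (presented_group {..<2} (r ` {..<m}))"
proof (rule presented_group_admits[of _ "2 * h"])
  have len: "132 * h \<le> length (r i)" "length (r i) \<le> l" if "i < m" for i
  proof -
    have "\<not> length (r i) \<le> l - h"
      using good[OF that] r[OF that]
      by (auto simp: reduced_le_def cyc_reduced_words_def cyclically_reduced_def)
    then show "132 * h \<le> length (r i)" using h by linarith
    show "length (r i) \<le> l" using r[OF that] by (simp add: cyc_reduced_words_def)
  qed
  show "66 * (2 * h) \<le> length s" if "s \<in> r ` {..<m}" for s
    using that len by auto
  show "cyclically_reduced s \<and> set s \<subseteq> {..<2} \<times> UNIV" if "s \<in> r ` {..<m}" for s
    using that r by (auto simp: cyc_reduced_words_def)
  show "2 \<le> 2 * h" using h by simp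
  fix s s' assume s: "s \<in> (\<Union>r\<in>r ` {..<m}. sym_class r)" "s' \<in> (\<Union>r\<in>r ` {..<m}. sym_class r)"
    and eq: "take (2 * h) s = take (2 * h) s'"
  obtain i j where ij: "i < m" "j < m" "s \<in> sym_class (r i)" "s' \<in> sym_class (r j)"
    using s by auto
  show "s = s'"
  proof (cases "i = j")
    case True
    have "4 * h \<le> length (r i)" using len(1)[OF ij(1)] h by linarith
    then show ?thesis
      using bad_words_self[OF r[OF ij(1)] h(1) _ ij(3), of s'] ij(4) True eq good[OF ij(1)] by blast
  next
    case False
    have "take h s' \<in> other_blocks h l m r i" "winv (take h s') \<in> other_blocks h l m r i"
      unfolding other_blocks_def using ij len(2)[OF ij(2)] False by blast+
    moreover have "take h s = take h s'"
      using arg_cong[OF eq, of "take h"] by (simp add: min_def)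
    moreover have "h \<le> length (r i)" "h \<le> length s'"
      using len(1)[OF ij(1)] len(1)[OF ij(2)] length_sym_class[OF ij(4)] by simp_all
    ultimately show ?thesis
      using bad_words_const[OF r[OF ij(1)] h(1) _ ij(4) _ ij(3)] good[OF ij(1)] by blast
  qed
qed

text \<open>By independence coordinate \<open>j\<close> can be drawn last; a bound that holds for
  all choices of the others survives averaging.\<close>

lemma prob_Pi_pmf_coordinate:
  assumes "finite A" "j \<in> A" "0 \<le> \<epsilon>"
    and le: "\<And>f. measure_pmf.prob (p j) {y. f(j := y) \<in> E} \<le> \<epsilon>"
  shows "measure_pmf.prob (Pi_pmf A d p) E \<le> \<epsilon>"
proof -
  let ?Q = "Pi_pmf (A - {j}) d p"
  have "Pi_pmf A d p = Pi_pmf (insert j (A - {j})) d p"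
    using assms(2) by (simp add: insert_absorb)
  also have "\<dots> = bind_pmf (p j) (\<lambda>y. bind_pmf ?Q (\<lambda>f. return_pmf (f(j := y))))"
    using assms(1) by (intro Pi_pmf_insert') auto
  also have "\<dots> = bind_pmf ?Q (\<lambda>f. map_pmf (\<lambda>y. f(j := y)) (p j))"
    by (subst bind_commute_pmf) (simp add: map_pmf_def)
  finally have eq: "Pi_pmf A d p = bind_pmf ?Q (\<lambda>f. map_pmf (\<lambda>y. f(j := y)) (p j))" .
  have "emeasure (Pi_pmf A d p) E = (\<integral>\<^sup>+f. emeasure (map_pmf (\<lambda>y. f(j := y)) (p j)) E \<partial>?Q)"
    unfolding eq by (rule emeasure_bind_pmf)
  also have "\<dots> \<le> (\<integral>\<^sup>+f. ennreal \<epsilon> \<partial>?Q)"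
  proof (rule nn_integral_mono)
    fix f
    have "emeasure (map_pmf (\<lambda>y. f(j := y)) (p j)) E = emeasure (p j) {y. f(j := y) \<in> E}"
      by (simp add: vimage_def)
    also have "\<dots> \<le> ennreal \<epsilon>"
      using le[of f] by (simp add: measure_pmf.emeasure_eq_measure ennreal_leI)
    finally show "emeasure (map_pmf (\<lambda>y. f(j := y)) (p j)) E \<le> ennreal \<epsilon>" .
  qed
  also have "\<dots> = ennreal \<epsilon>" by simp
  finally show ?thesis
    using assms(3) by (simp add: measure_pmf.emeasure_eq_measure)
qed

text \<open>There are at least 3^(l - 1) cyclically reduced words, so the quotient leaves 3 / 3^h.
  The counts of blocks contribute 2 (4 m + 2) = 8 m + 4, which the short words raise to 8 m +
  6.\<close>

lemma prob_bad_word: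
  assumes h: "h \<le> l" "0 < l" and j: "j < m"
  shows "measure_pmf.prob (random_relators 2 m l)
      {r. r j \<in> bad_words h l (other_blocks h l m r j) \<union> reduced_le (l - h)}
    \<le> 3 * (8 * real m + 6) * (real l + 1)\<^sup>2 / 3 ^ h"
  unfolding random_relators_def
proof (rule prob_Pi_pmf_coordinate)
  let ?C = "cyc_reduced_words 2 l"
  fix f :: "nat \<Rightarrow> nat letter list"
  define B where "B = bad_words h l (other_blocks h l m f j) \<union> reduced_le (l - h)"
  have fin: "finite B"
    unfolding B_def bad_words_def blocks_def by simp
  have "card (?C \<inter> B) \<le> card B" by (intro card_mono fin) auto
  also have "\<dots> \<le> Suc l * (2 * 3 ^ (l - h) * (m * (4 * Suc l) + 2 * Suc l)) + 2 * 3 ^ (l - h)"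
  proof -
    have "card B \<le> card (bad_words h l (other_blocks h l m f j)) + card (reduced_le (l - h))"
      unfolding B_def by (rule card_Un_le)
    also have "\<dots> \<le> Suc l * (2 * 3 ^ (l - h) * (card (other_blocks h l m f j) + 2 * Suc l)) + 2 * 3 ^ (l - h)"
      by (intro add_mono card_bad_words card_reduced_le) simp
    also have "\<dots> \<le> Suc l * (2 * 3 ^ (l - h) * (m * (4 * Suc l) + 2 * Suc l)) + 2 * 3 ^ (l - h)"
      by (intro add_mono mult_le_mono card_other_blocks order_refl)
    finally show ?thesis .
  qed
  finally have "real (card (?C \<inter> B)) \<le>
      real (Suc l * (2 * 3 ^ (l - h) * (m * (4 * Suc l) + 2 * Suc l)) + 2 * 3 ^ (l - h))"
    by (simp only: of_nat_le_iff)
  also have "\<dots> = 3 ^ (l - h) * ((8 * real m + 4) * (real l + 1)\<^sup>2 + 2)"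
    by (simp add: algebra_simps power2_eq_square)
  also have "\<dots> \<le> 3 ^ (l - h) * ((8 * real m + 6) * (real l + 1)\<^sup>2)"
    by (intro mult_left_mono) (auto simp: algebra_simps power2_eq_square)
  finally have num: "real (card (?C \<inter> B)) \<le> 3 ^ (l - h) * ((8 * real m + 6) * (real l + 1)\<^sup>2)" .
  have "3 ^ (l - 1) \<le> card ?C" using card_cyc_reduced_words[of "l - 1"] h(2) by simp
  then have "real (3 ^ (l - 1)) \<le> real (card ?C)" by (simp only: of_nat_le_iff)
  then have den: "3 ^ (l - 1) \<le> real (card ?C)" by simp
  have "measure_pmf.prob (pmf_of_set ?C) {y. f(j := y) \<in>
      {r. r j \<in> bad_words h l (other_blocks h l m r j) \<union> reduced_le (l - h)}} =
      real (card (?C \<inter> B)) / real (card ?C)"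
  proof -
    have "{y. f(j := y) \<in> {r. r j \<in> bad_words h l (other_blocks h l m r j) \<union> reduced_le (l - h)}} = B"
      by (auto simp: B_def other_blocks_upd)
    then show ?thesis
      by (simp only: measure_pmf_of_set[OF cyc_reduced_words_nonempty finite_cyc_reduced_words])
  qed
  also have "\<dots> \<le> 3 ^ (l - h) * ((8 * real m + 6) * (real l + 1)\<^sup>2) / 3 ^ (l - 1)"
    using num den by (intro frac_le) auto
  also have "\<dots> = 3 * (8 * real m + 6) * (real l + 1)\<^sup>2 / 3 ^ h"
  proof -
    have "(3 :: real) ^ l = 3 ^ (l - h) * 3 ^ h" using h(1) by (simp flip: power_add)
    moreover have "(3 :: real) ^ l = 3 * 3 ^ (l - 1)" using h(2) by (simp flip: power_Suc)
    ultimately have eq: "(3 :: real) ^ (l - h) * 3 ^ h = 3 * 3 ^ (l - 1)" by simp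
    define K where "K = (8 * real m + 6) * (real l + 1)\<^sup>2"
    have "3 ^ (l - h) * K * 3 ^ h = 3 * K * 3 ^ (l - 1)"
      using arg_cong[OF eq, of "\<lambda>x. x * K"] by (simp add: mult_ac)
    then have "3 ^ (l - h) * K / 3 ^ (l - 1) = 3 * K / 3 ^ h" by (simp add: field_simps)
    then show ?thesis by (simp add: K_def mult.assoc)
  qed
  finally show "measure_pmf.prob (pmf_of_set ?C) {y. f(j := y) \<in>
      {r. r j \<in> bad_words h l (other_blocks h l m r j) \<union> reduced_le (l - h)}}
    \<le> 3 * (8 * real m + 6) * (real l + 1)\<^sup>2 / 3 ^ h" .
qed (use j in auto)

lemma prob_admits_ge:
  assumes "133 \<le> l"
  shows "1 - real m * (3 * (8 * real m + 6) * (real l + 1)\<^sup>2 / 3 ^ (l div 133)) \<le>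
    measure_pmf.prob (random_relators 2 m l)
      {r. admits_cayley_representation (presented_group {..<2} (r ` {..<m}))}"
proof -
  let ?M = "measure_pmf (random_relators 2 m l)"
  define h where "h = l div 133"
  have h: "0 < h" "133 * h \<le> l" "h \<le> l" "0 < l"
    using assms by (auto simp: h_def div_greater_zero_iff)
  define Bad where "Bad j = {r. r j \<in> bad_words h l (other_blocks h l m r j) \<union> reduced_le (l - h)}" for j
  define Good :: "(nat \<Rightarrow> nat letter list) set" where "Good = {r. admits_cayley_representation (presented_group {..<2} (r ` {..<m}))}"
  have "set_pmf (random_relators 2 m l) \<inter> - Good \<subseteq> (\<Union>j<m. Bad j)"
  proof
    fix r assume r: "r \<in> set_pmf (random_relators 2 m l) \<inter> - Good"
    then have "r i \<in> cyc_reduced_words 2 l" if "i < m" for i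
      using that by (auto simp: random_relators_def set_Pi_pmf PiE_dflt_def
          set_pmf_of_set[OF cyc_reduced_words_nonempty finite_cyc_reduced_words])
    with r show "r \<in> (\<Union>j<m. Bad j)"
      using admits_if_no_bad_words[of m r l h] h unfolding Good_def Bad_def by blast
  qed
  then have "measure ?M (- Good) \<le> measure ?M (\<Union>j<m. Bad j)"
    by (subst measure_Int_set_pmf[symmetric]) (intro measure_pmf.finite_measure_mono; auto)
  also have "\<dots> \<le> (\<Sum>j<m. measure ?M (Bad j))"
    by (rule measure_pmf.finite_measure_subadditive_finite) auto
  also have "\<dots> \<le> (\<Sum>j<m. 3 * (8 * real m + 6) * (real l + 1)\<^sup>2 / 3 ^ h)"
    unfolding Bad_def using h by (intro sum_mono prob_bad_word) auto
  finally have "measure ?M (- Good) \<le> real m * (3 * (8 * real m + 6) * (real l + 1)\<^sup>2 / 3 ^ h)" by simp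
  moreover have "measure ?M (- Good) = 1 - measure ?M Good"
    using measure_pmf.prob_compl[of Good "random_relators 2 m l"] by (simp add: Compl_eq_Diff_UNIV)
  ultimately show ?thesis by (simp add: Good_def h_def)
qed

theorem corollary21:
  fixes m :: nat
  assumes "m \<ge> 1"
  shows "(\<lambda>l. measure_pmf.prob (random_relators 2 m l)
            {r. admits_cayley_representation (presented_group {..<2} (r ` {..<m}))})
          \<longlonglongrightarrow> 1"
proof (rule tendsto_sandwich)
  define c where "c = real m * (3 * (8 * real m + 6))"
  \<comment> \<open>Replacing \<open>l div 133\<close> by the smaller real number l / 133 - 1 gives
    an elementary function with a computable limit.\<close>
  let ?g = "\<lambda>l :: nat. 1 - c * ((real l + 1)\<^sup>2 / 3 powr (real l / 133 - 1))"
  have "(\<lambda>l :: nat. (real l + 1)\<^sup>2 / 3 powr (real l / 133 - 1)) \<longlonglongrightarrow> 0"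
    by real_asymp
  from tendsto_diff[OF tendsto_const tendsto_mult[OF tendsto_const this]]
  show "?g \<longlonglongrightarrow> 1" by simp
  show "\<forall>\<^sub>F l in sequentially. ?g l \<le> measure_pmf.prob (random_relators 2 m l)
      {r. admits_cayley_representation (presented_group {..<2} (r ` {..<m}))}"
    using eventually_ge_at_top[of 133]
  proof eventually_elim
    case (elim l)
    have "l \<le> 133 * (l div 133) + 133"
      using mod_less_divisor[of 133 l] mult_div_mod_eq[of 133 l] by linarith
    then have "real l / 133 - 1 \<le> real (l div 133)" by linarith
    then have "3 powr (real l / 133 - 1) \<le> 3 ^ (l div 133)"
      by (simp flip: powr_realpow)
    then have "c * ((real l + 1)\<^sup>2 / 3 ^ (l div 133)) \<le> c * ((real l + 1)\<^sup>2 / 3 powr (real l / 133 - 1))"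
      by (intro mult_left_mono divide_left_mono) (auto simp: c_def)
    moreover have "c * ((real l + 1)\<^sup>2 / 3 ^ (l div 133)) =
        real m * (3 * (8 * real m + 6) * (real l + 1)\<^sup>2 / 3 ^ (l div 133))"
      by (simp add: c_def)
    ultimately show ?case using prob_admits_ge[OF elim, of m] by linarith
  qed
qed auto

end
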